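(* Let $\mathbf{L}_1,\ldots,\mathbf{L}_k$ be symmetric positive semidefinite $n\times n$ matrices with a total of $m$ nonzero entries, and let $\mathbf{s}_1,\ldots,\mathbf{s}_k\in\mathbb{R}^n$. Suppose there is an algorithm that solves linear systems in matrices of the form $\sum_{i=1}^k\alpha_i\mathbf{L}_i$ (with $\alpha_i>0$) in time $T(n,m)$. Then for any $(\mathbf{x},\mathbf{y})\in\mathbb{R}^n\times\mathbb{R}^k$ with $y_i>\|\mathbf{x}-\mathbf{s}_i\|_{\mathbf{L}_i}$ for all $i$, a linear system in the Hessian $\nabla^2\phi(\mathbf{x},\mathbf{y})$ can be solved in $O(k^{\omega}+k\,T(n,m)+k^2n)$ time.
   Context: $\|\mathbf{z}\|_{\mathbf{L}}=\sqrt{\mathbf{z}^T\mathbf{L}\mathbf{z}}$. The barrier function is $\phi(\mathbf{x},\mathbf{y})=-\sum_{i=1}^k\log\left(y_i^2-\|\mathbf{x}-\mathbf{s}_i\|_{\mathbf{L}_i}^2\right)$, a function of the $n+k$ variables $(\mathbf{x},\mathbf{y})$, so $\nabla^2\phi$ is an $(n+k)\times(n+k)$ matrix. $\omega$ denotes the matrix multiplication exponent. *)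

theory Defs
  imports "HOL-Analysis.Derivative" "Jordan_Normal_Form.Matrix"
begin

section \<open>Machine model: a uniform unit-cost real RAM\<close>

text \<open>
  Programs are finite texts that do not depend on the size of the input. The memory
  of a procedure consists of arrays of natural numbers and arrays of reals; arrays have two
  indices and are initially zero. Real operations are the four field operations and comparison.
  Index operations are addition, truncated subtraction and comparison, so that unit cost is
  realistic for them. There is no conversion from reals to indices. As usual in HOL,
  division by zero gives zero; a program could get the same effect with a comparison.
\<close>

type_synonym 'a array = "nat \<Rightarrow> nat \<Rightarrow> 'a"

type_synonym store = "(nat \<Rightarrow> nat array) \<times> (nat \<Rightarrow> real array)"

datatype iexp = IConst nat | IRead nat iexp iexp | IAdd iexp iexp | ISub iexp iexp

datatype rexp = RConst int | RRead nat iexp iexp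
  | RAdd rexp rexp | RSub rexp rexp | RMul rexp rexp | RDiv rexp rexp

datatype bexp = ILess iexp iexp | RLess rexp rexp | BNot bexp | BAnd bexp bexp

datatype com = Skip
  | IWrite nat iexp iexp iexp
  | RWrite nat iexp iexp rexp
  | Seq com com
  | If bexp com com
  | While bexp com
  | Call nat "nat list" "nat list"

text \<open>A program is a list of (mutually recursive) procedures; execution starts with number 0.\<close>

type_synonym program = "com list"

fun ieval :: "iexp \<Rightarrow> store \<Rightarrow> nat" where
  "ieval (IConst c) s = c"
| "ieval (IRead a e f) s = fst s a (ieval e s) (ieval f s)"
| "ieval (IAdd e f) s = ieval e s + ieval f s"
| "ieval (ISub e f) s = ieval e s - ieval f s"

fun reval :: "rexp \<Rightarrow> store \<Rightarrow> real" where
  "reval (RConst c) s = of_int c"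
| "reval (RRead a e f) s = snd s a (ieval e s) (ieval f s)"
| "reval (RAdd e f) s = reval e s + reval f s"
| "reval (RSub e f) s = reval e s - reval f s"
| "reval (RMul e f) s = reval e s * reval f s"
| "reval (RDiv e f) s = reval e s / reval f s"

fun beval :: "bexp \<Rightarrow> store \<Rightarrow> bool" where
  "beval (ILess e f) s \<longleftrightarrow> ieval e s < ieval f s"
| "beval (RLess e f) s \<longleftrightarrow> reval e s < reval f s"
| "beval (BNot b) s \<longleftrightarrow> \<not> beval b s"
| "beval (BAnd b c) s \<longleftrightarrow> beval b s \<and> beval c s"

text \<open>The cost of evaluating an expression is its number of nodes.\<close>

fun icost :: "iexp \<Rightarrow> nat" where
  "icost (IConst c) = 1"
| "icost (IRead a e f) = 1 + icost e + icost f"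
| "icost (IAdd e f) = 1 + icost e + icost f"
| "icost (ISub e f) = 1 + icost e + icost f"

fun rcost :: "rexp \<Rightarrow> nat" where
  "rcost (RConst c) = 1"
| "rcost (RRead a e f) = 1 + icost e + icost f"
| "rcost (RAdd e f) = 1 + rcost e + rcost f"
| "rcost (RSub e f) = 1 + rcost e + rcost f"
| "rcost (RMul e f) = 1 + rcost e + rcost f"
| "rcost (RDiv e f) = 1 + rcost e + rcost f"

fun bcost :: "bexp \<Rightarrow> nat" where
  "bcost (ILess e f) = 1 + icost e + icost f"
| "bcost (RLess e f) = 1 + rcost e + rcost f"
| "bcost (BNot b) = 1 + bcost b"
| "bcost (BAnd b c) = 1 + bcost b + bcost c"

definition update_at :: "(nat \<Rightarrow> 'a array) \<Rightarrow> nat \<Rightarrow> nat \<Rightarrow> nat \<Rightarrow> 'a \<Rightarrow> (nat \<Rightarrow> 'a array)" where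
  "update_at M a i j v = M(a := (M a)(i := (M a i)(j := v)))"

text \<open>
  Procedure calls pass arrays by reference: the \<open>j\<close>-th array of the callee is the array
  \<open>args ! j\<close> of the caller, all its other arrays are fresh. The arguments must be
  distinct, so there is no aliasing, and binding before and copying back after the execution of
  the body describes passing by reference exactly; that is why the cost of a call does not
  depend on the sizes of the arrays.
\<close>

definition bind_args :: "nat list \<Rightarrow> (nat \<Rightarrow> 'a::zero array) \<Rightarrow> (nat \<Rightarrow> 'a array)" where
  "bind_args args M = (\<lambda>j. if j < length args then M (args ! j) else (\<lambda>_ _. 0))"

definition return_args ::
  "nat list \<Rightarrow> (nat \<Rightarrow> 'a array) \<Rightarrow> (nat \<Rightarrow> 'a array) \<Rightarrow> (nat \<Rightarrow> 'a array)" where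
  "return_args args M M' =
     (\<lambda>a. case map_of (zip args (map M' [0..<length args])) a of None \<Rightarrow> M a | Some X \<Rightarrow> X)"

text \<open>\<open>exec P c s s' t\<close>: command \<open>c\<close> of program \<open>P\<close>, started in \<open>s\<close>, terminates in \<open>s'\<close> in time \<open>t\<close>.\<close>

inductive exec :: "program \<Rightarrow> com \<Rightarrow> store \<Rightarrow> store \<Rightarrow> nat \<Rightarrow> bool" for P where
  Skip: "exec P Skip s s 1"
| IWrite: "exec P (IWrite a e f g) s
    (update_at (fst s) a (ieval e s) (ieval f s) (ieval g s), snd s) (1 + icost e + icost f + icost g)"
| RWrite: "exec P (RWrite a e f g) s
    (fst s, update_at (snd s) a (ieval e s) (ieval f s) (reval g s)) (1 + icost e + icost f + rcost g)"
| Seq: "exec P c s s' t \<Longrightarrow> exec P d s' s'' t' \<Longrightarrow> exec P (Seq c d) s s'' (t + t')"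
| IfTrue: "beval b s \<Longrightarrow> exec P c s s' t \<Longrightarrow> exec P (If b c d) s s' (1 + bcost b + t)"
| IfFalse: "\<not> beval b s \<Longrightarrow> exec P d s s' t \<Longrightarrow> exec P (If b c d) s s' (1 + bcost b + t)"
| WhileFalse: "\<not> beval b s \<Longrightarrow> exec P (While b c) s s (1 + bcost b)"
| WhileTrue: "beval b s \<Longrightarrow> exec P c s s' t \<Longrightarrow> exec P (While b c) s' s'' t' \<Longrightarrow>
    exec P (While b c) s s'' (1 + bcost b + t + t')"
| Call: "p < length P \<Longrightarrow> distinct is \<Longrightarrow> distinct rs \<Longrightarrow>
    exec P (P ! p) (bind_args is (fst s), bind_args rs (snd s)) s' t \<Longrightarrow>
    exec P (Call p is rs) s
      (return_args is (fst s) (fst s'), return_args rs (snd s) (snd s'))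
      (1 + length is + length rs + t)"

text \<open>An input is a list of index arrays and a list of real arrays, each given as a list of rows.\<close>

type_synonym input = "nat list list list \<times> real list list list"

definition input_arrays :: "'a::zero list list list \<Rightarrow> nat \<Rightarrow> 'a array" where
  "input_arrays A a i j =
     (if a < length A \<and> i < length (A ! a) \<and> j < length (A ! a ! i) then A ! a ! i ! j else 0)"

definition input_size :: "input \<Rightarrow> nat" where
  "input_size I = sum_list (map (\<lambda>rows. sum_list (map length rows)) (fst I))
                + sum_list (map (\<lambda>rows. sum_list (map length rows)) (snd I))"

text \<open>
  Running time includes the time for reading the input. The output is the first real array not
  used by the input.
\<close>

definition computes_within :: "program \<Rightarrow> input \<Rightarrow> (real array \<Rightarrow> bool) \<Rightarrow> real \<Rightarrow> bool" where
  "computes_within P I Q t \<longleftrightarrow> P \<noteq> [] \<and>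
     (\<exists>s' c. exec P (P ! 0) (input_arrays (fst I), input_arrays (snd I)) s' c \<and>
             Q (snd s' (length (snd I))) \<and> real (input_size I + c) \<le> t)"

section \<open>The matrix multiplication exponent\<close>

definition matmul_input :: "nat \<Rightarrow> real mat \<Rightarrow> real mat \<Rightarrow> input" where
  "matmul_input n A B = ([[[n]]], [mat_to_list A, mat_to_list B])"

definition matmul_exponents :: "real set" where
  "matmul_exponents = {\<tau>. \<exists>P C. \<forall>n\<ge>1. \<forall>A\<in>carrier_mat n n. \<forall>B\<in>carrier_mat n n.
     computes_within P (matmul_input n A B) (\<lambda>X. mat n n (\<lambda>(i, j). X i j) = A * B)
       (C * real n powr \<tau>)}"

definition matmul_omega :: real where
  "matmul_omega = Inf matmul_exponents"

section \<open>Sparse matrices and linear systems\<close>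

definition nonzero_entries :: "real mat \<Rightarrow> (nat \<times> nat) set" where
  "nonzero_entries A = {(i, j). i < dim_row A \<and> j < dim_col A \<and> A $$ (i, j) \<noteq> 0}"

text \<open>
  A sparse matrix is given to a program by its nonzero entries, each listed once, in an
  arbitrary order; \<open>es\<close> is the list of their positions.
\<close>

definition enumerates_entries :: "(nat \<times> nat) list \<Rightarrow> real mat \<Rightarrow> bool" where
  "enumerates_entries es A \<longleftrightarrow> distinct es \<and> set es = nonzero_entries A"

definition psd_mat :: "real mat \<Rightarrow> bool" where
  "psd_mat A \<longleftrightarrow> transpose_mat A = A \<and> (\<forall>v\<in>carrier_vec (dim_row A). 0 \<le> v \<bullet> (A *\<^sub>v v))"

definition psd_family :: "nat \<Rightarrow> real mat list \<Rightarrow> bool" where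
  "psd_family n Ls \<longleftrightarrow> Ls \<noteq> [] \<and> (\<forall>L\<in>set Ls. L \<in> carrier_mat n n \<and> psd_mat L)"

definition total_nonzeros :: "real mat list \<Rightarrow> nat" where
  "total_nonzeros Ls = (\<Sum>i<length Ls. card (nonzero_entries (Ls ! i)))"

definition lin_comb :: "nat \<Rightarrow> (nat \<Rightarrow> real) \<Rightarrow> real mat list \<Rightarrow> real mat" where
  "lin_comb n \<alpha> Ls = mat n n (\<lambda>(r, c). \<Sum>i<length Ls. \<alpha> i * (Ls ! i) $$ (r, c))"

text \<open>
  The matrices may be singular (e.g. graph Laplacians), so to solve linear systems in \<open>A\<close> means
  to find a solution whenever the right-hand side is such that there is one.
\<close>

definition consistent :: "real mat \<Rightarrow> real vec \<Rightarrow> bool" where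
  "consistent A b \<longleftrightarrow> (\<exists>z\<in>carrier_vec (dim_col A). A *\<^sub>v z = b)"

definition output_solves :: "real mat \<Rightarrow> real vec \<Rightarrow> real array \<Rightarrow> bool" where
  "output_solves A b X \<longleftrightarrow> A *\<^sub>v vec (dim_col A) (\<lambda>i. X 0 i) = b"

definition system_input :: "nat \<Rightarrow> (nat \<times> nat) list \<Rightarrow> real mat \<Rightarrow> real vec \<Rightarrow> input" where
  "system_input n es A b =
     ([[[n, length es]], [map fst es, map snd es]],
      [[map (\<lambda>p. A $$ p) es, list_of_vec b]])"

definition solves_combinations_within :: "program \<Rightarrow> nat \<Rightarrow> real mat list \<Rightarrow> real \<Rightarrow> bool" where
  "solves_combinations_within P n Ls t \<longleftrightarrow>
     (\<forall>\<alpha> b es. (\<forall>i<length Ls. \<alpha> i > 0) \<and> b \<in> carrier_vec n \<and> consistent (lin_comb n \<alpha> Ls) b \<and>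
        enumerates_entries es (lin_comb n \<alpha> Ls) \<longrightarrow>
        computes_within P (system_input n es (lin_comb n \<alpha> Ls) b)
          (output_solves (lin_comb n \<alpha> Ls) b) t)"

section \<open>The barrier function and its Hessian\<close>

definition mat_norm :: "real mat \<Rightarrow> real vec \<Rightarrow> real" where
  "mat_norm L z = sqrt (z \<bullet> (L *\<^sub>v z))"

definition barrier :: "real mat list \<Rightarrow> real vec list \<Rightarrow> real vec \<Rightarrow> real vec \<Rightarrow> real" where
  "barrier Ls ss x y =
     - (\<Sum>i<length Ls. ln ((y $ i)\<^sup>2 - (mat_norm (Ls ! i) (x - ss ! i))\<^sup>2))"

definition partial_deriv :: "nat \<Rightarrow> (real vec \<Rightarrow> real) \<Rightarrow> real vec \<Rightarrow> real" where
  "partial_deriv i f v = deriv (\<lambda>t. f (vec (dim_vec v) (\<lambda>j. if j = i then t else v $ j))) (v $ i)"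

definition hessian :: "(real vec \<Rightarrow> real) \<Rightarrow> real vec \<Rightarrow> real mat" where
  "hessian f v = mat (dim_vec v) (dim_vec v) (\<lambda>(i, j). partial_deriv i (partial_deriv j f) v)"

definition barrier_hessian ::
  "nat \<Rightarrow> real mat list \<Rightarrow> real vec list \<Rightarrow> real vec \<Rightarrow> real vec \<Rightarrow> real mat" where
  "barrier_hessian n Ls ss x y =
     hessian (\<lambda>w. barrier Ls ss (vec_first w n) (vec_last w (length Ls))) (x @\<^sub>v y)"

definition hessian_input ::
  "nat \<Rightarrow> (nat \<times> nat) list list \<Rightarrow> real mat list \<Rightarrow> real vec list \<Rightarrow> real vec \<Rightarrow> real vec \<Rightarrow> real vec \<Rightarrow> input"
where
  "hessian_input n ess Ls ss x y b =
     ([[[n, length Ls], map length ess], map (map fst) ess, map (map snd) ess],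
      [map2 (\<lambda>L. map (\<lambda>p. L $$ p)) Ls ess, map list_of_vec ss,
       [list_of_vec x, list_of_vec y, list_of_vec b]])"

definition solves_barrier_hessians_within :: "program \<Rightarrow> nat \<Rightarrow> real mat list \<Rightarrow> real \<Rightarrow> bool" where
  "solves_barrier_hessians_within P n Ls t \<longleftrightarrow>
     (\<forall>ess ss x y b.
        list_all2 enumerates_entries ess Ls \<and>
        length ss = length Ls \<and> set ss \<subseteq> carrier_vec n \<and>
        x \<in> carrier_vec n \<and> y \<in> carrier_vec (length Ls) \<and>
        (\<forall>i<length Ls. y $ i > mat_norm (Ls ! i) (x - ss ! i)) \<and>
        b \<in> carrier_vec (n + length Ls) \<and> consistent (barrier_hessian n Ls ss x y) b \<longrightarrow>
        computes_within P (hessian_input n ess Ls ss x y b)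
          (output_solves (barrier_hessian n Ls ss x y) b) t)"

end

theory Submission
  imports Defs
begin

text \<open>
  Put \<open>f i = (y i)\<^sup>2 - q i\<close>, \<open>g i = (y i)\<^sup>2 + q i\<close> and \<open>v i = L i (x - s i)\<close>, where \<open>q i\<close> is the squared norm
  of \<open>x - s i\<close>. The \<open>y\<close>-block of the Hessian is diagonal with entries \<open>2 g i / (f i)\<^sup>2\<close>; eliminating it
  leaves the Schur complement \<open>S = M - (\<Sum>i. d i * v i * (v i)\<^sup>T)\<close> with \<open>M = (\<Sum>i. 2 / f i * L i)\<close> and
  \<open>d i = 4 / (f i * g i)\<close>. Solve \<open>M w = c\<close> for the \<open>k + 1\<close> right-hand sides \<open>v 0, \<dots>, v (k - 1)\<close> and the
  reduced right-hand side, and then subtract the rank one terms one at a time, adjusting the solutions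
  that are still needed by the Sherman-Morrison formula. These are at most \<open>k\<^sup>2\<close> vector operations of
  length \<open>n\<close>, so that no \<open>k \<times> k\<close> matrix has to be inverted. The denominators do not vanish because
  \<open>d i * v i * (v i)\<^sup>T\<close> is bounded by \<open>2 q i / g i < 1\<close> times \<open>2 / f i * L i\<close>, by Cauchy-Schwarz; and all
  systems are solvable because the kernel of \<open>M\<close> is contained in that of every \<open>L i\<close>.
\<close>

section \<open>Reasoning about programs\<close>

text \<open>The bound has no term in the number of entries, so reading the matrices, assembling
  \<open>M\<close> and copying it for each of the \<open>k + 1\<close> calls must be paid for by
  \<open>k * T\<close>. This works because the time of the given solver includes reading its input:
  for each \<open>i\<close> some admissible combination keeps all nonzero entries of
  \<open>L i\<close>, so \<open>T\<close> exceeds both their number and \<open>n\<close>. The solver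
  is a black box. It expects every nonzero entry once, although entries of different
  \<open>L i\<close> may coincide or cancel; and as the systems may be singular, it may return any
  solution. Hence nothing below refers to inverses or to uniqueness: the Sherman-Morrison step is
  stated for arbitrary solutions of the current systems, and needs only a nonzero denominator. The
  factor \<open>2 q i / g i\<close> is below 1 exactly because
  \<open>q i < (y i)\<^sup>2\<close>.\<close>

definition runs :: "program \<Rightarrow> com \<Rightarrow> store \<Rightarrow> nat \<Rightarrow> (store \<Rightarrow> bool) \<Rightarrow> bool" where
  "runs P c s t Q \<longleftrightarrow> (\<exists>s' t'. exec P c s s' t' \<and> t' \<le> t \<and> Q s')"

text \<open>The budget in \<open>runs\<close> is only an upper bound, so later lemmas can use round
  constants instead of exact costs.\<close>

lemma runs_mono: "runs P c s t Q \<Longrightarrow> t \<le> t' \<Longrightarrow> (\<And>s'. Q s' \<Longrightarrow> Q' s') \<Longrightarrow> runs P c s t' Q'"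
  unfolding runs_def by (meson le_trans)

inductive_cases exec_SkipE: "exec P Skip s s' t"
inductive_cases exec_IWriteE: "exec P (IWrite a e f g) s s' t"
inductive_cases exec_RWriteE: "exec P (RWrite a e f g) s s' t"
inductive_cases exec_SeqE: "exec P (Seq c d) s s' t"
inductive_cases exec_IfE: "exec P (If b c d) s s' t"

text \<open>For straight-line code the rules are equivalences, so that the simplifier executes
  commands symbolically and carries the remaining budget along.\<close>

lemma runs_Skip [simp]: "runs P Skip s t Q \<longleftrightarrow> 1 \<le> t \<and> Q s" (is "?l \<longleftrightarrow> ?r")
proof
  assume ?l
  then show ?r unfolding runs_def by (elim exE conjE exec_SkipE) simp
next
  assume ?r
  then show ?l unfolding runs_def using exec.Skip by blast
qed

lemma runs_IWrite [simp]: "runs P (IWrite a e f g) s t Q \<longleftrightarrow>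
    1 + icost e + icost f + icost g \<le> t \<and>
    Q (update_at (fst s) a (ieval e s) (ieval f s) (ieval g s), snd s)" (is "?l \<longleftrightarrow> ?r")
proof
  assume ?l
  then show ?r unfolding runs_def by (elim exE conjE exec_IWriteE) simp
next
  assume ?r
  then show ?l unfolding runs_def using exec.IWrite by blast
qed

lemma runs_RWrite [simp]: "runs P (RWrite a e f g) s t Q \<longleftrightarrow>
    1 + icost e + icost f + rcost g \<le> t \<and>
    Q (fst s, update_at (snd s) a (ieval e s) (ieval f s) (reval g s))" (is "?l \<longleftrightarrow> ?r")
proof
  assume ?l
  then show ?r unfolding runs_def by (elim exE conjE exec_RWriteE) simp
next
  assume ?r
  then show ?l unfolding runs_def using exec.RWrite by blast
qed

lemma runs_Seq: "runs P c s t (\<lambda>s'. runs P d s' u Q) \<Longrightarrow> t + u \<le> T \<Longrightarrow> runs P (Seq c d) s T Q"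
proof -
  assume "runs P c s t (\<lambda>s'. runs P d s' u Q)" and T: "t + u \<le> T"
  then obtain s1 t1 s2 t2 where "exec P c s s1 t1" "t1 \<le> t" "exec P d s1 s2 t2" "t2 \<le> u" "Q s2"
    unfolding runs_def by blast
  then have "exec P (Seq c d) s s2 (t1 + t2)" "t1 + t2 \<le> T"
    using T by (auto intro: exec.Seq)
  with \<open>Q s2\<close> show ?thesis unfolding runs_def by blast
qed

lemma runs_Seq_IWrite [simp]: "runs P (Seq (IWrite a e f g) d) s t Q \<longleftrightarrow>
    1 + icost e + icost f + icost g \<le> t \<and>
    runs P d (update_at (fst s) a (ieval e s) (ieval f s) (ieval g s), snd s)
      (t - (1 + icost e + icost f + icost g)) Q" (is "?l \<longleftrightarrow> ?c \<le> t \<and> ?r")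
proof
  assume ?l
  then obtain s' u where "exec P (Seq (IWrite a e f g) d) s s' u" "u \<le> t" "Q s'"
    unfolding runs_def by blast
  then show "?c \<le> t \<and> ?r"
  proof (elim exec_SeqE exec_IWriteE, goal_cases)
    case (1 s1 t1 t2)
    then have "?c \<le> t" "t2 \<le> t - ?c" by simp_all
    then show ?case using 1 unfolding runs_def by blast
  qed
next
  assume "?c \<le> t \<and> ?r"
  then show ?l by (intro runs_Seq[of _ _ _ ?c _ "t - ?c"]) auto
qed

lemma runs_Seq_RWrite [simp]: "runs P (Seq (RWrite a e f g) d) s t Q \<longleftrightarrow>
    1 + icost e + icost f + rcost g \<le> t \<and>
    runs P d (fst s, update_at (snd s) a (ieval e s) (ieval f s) (reval g s))
      (t - (1 + icost e + icost f + rcost g)) Q" (is "?l \<longleftrightarrow> ?c \<le> t \<and> ?r")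
proof
  assume ?l
  then obtain s' u where "exec P (Seq (RWrite a e f g) d) s s' u" "u \<le> t" "Q s'"
    unfolding runs_def by blast
  then show "?c \<le> t \<and> ?r"
  proof (elim exec_SeqE exec_RWriteE, goal_cases)
    case (1 s1 t1 t2)
    then have "?c \<le> t" "t2 \<le> t - ?c" by simp_all
    then show ?case using 1 unfolding runs_def by blast
  qed
next
  assume "?c \<le> t \<and> ?r"
  then show ?l by (intro runs_Seq[of _ _ _ ?c _ "t - ?c"]) auto
qed

lemma runs_If: "(beval b s \<Longrightarrow> runs P c s u Q) \<Longrightarrow>
    (\<not> beval b s \<Longrightarrow> runs P d s u Q) \<Longrightarrow> 1 + bcost b + u \<le> t \<Longrightarrow> runs P (If b c d) s t Q"
  unfolding runs_def
  by (cases "beval b s") (metis IfTrue IfFalse nat_add_left_cancel_le le_trans)+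

lemma update_at_simps [simp]:
  "update_at M a i j v b = (if b = a then (M a)(i := (M a i)(j := v)) else M b)"
  by (simp add: update_at_def)

section \<open>Frame conditions\<close>

fun iwrites :: "com \<Rightarrow> nat set" where
  "iwrites (IWrite a e f g) = {a}"
| "iwrites (Seq c d) = iwrites c \<union> iwrites d"
| "iwrites (If b c d) = iwrites c \<union> iwrites d"
| "iwrites (While b c) = iwrites c"
| "iwrites (Call p is rs) = set is"
| "iwrites _ = {}"

fun rwrites :: "com \<Rightarrow> nat set" where
  "rwrites (RWrite a e f g) = {a}"
| "rwrites (Seq c d) = rwrites c \<union> rwrites d"
| "rwrites (If b c d) = rwrites c \<union> rwrites d"
| "rwrites (While b c) = rwrites c"
| "rwrites (Call p is rs) = set rs"
| "rwrites _ = {}"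

text \<open>Read off from the text of a command, this relieves loop invariants of all arrays that
  the loop does not write. A call counts as writing everything that is passed to it.\<close>

definition agree :: "com \<Rightarrow> store \<Rightarrow> store \<Rightarrow> bool" where
  "agree c s s' \<longleftrightarrow> (\<forall>a. a \<notin> iwrites c \<longrightarrow> fst s' a = fst s a) \<and>
     (\<forall>a. a \<notin> rwrites c \<longrightarrow> snd s' a = snd s a)"

lemma return_args_other: "a \<notin> set args \<Longrightarrow> return_args args M M' a = M a"
proof -
  assume "a \<notin> set args"
  then have "map_of (zip args (map M' [0..<length args])) a = None"
    unfolding map_of_eq_None_iff by (auto dest: set_zip_leftD)
  then show ?thesis unfolding return_args_def by (simp only: option.case)
qed

lemma return_args_nth:
  assumes "distinct args" "j < length args"
  shows "return_args args M M' (args ! j) = M' j"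
proof -
  have "map_of (zip args (map M' [0..<length args])) (args ! j) = Some (map M' [0..<length args] ! j)"
    using assms by (intro map_of_zip_nth) auto
  then show ?thesis using assms by (simp add: return_args_def)
qed

lemma exec_agree: "exec P c s s' t \<Longrightarrow> agree c s s'"
  by (induction rule: exec.induct) (auto simp: agree_def return_args_other)

lemma runs_agree: "runs P c s t Q \<Longrightarrow> runs P c s t (\<lambda>s'. Q s' \<and> agree c s s')"
  unfolding runs_def using exec_agree by blast

section \<open>Counting loops\<close>

abbreviation ivar :: "nat \<Rightarrow> iexp" where "ivar v \<equiv> IRead v (IConst 0) (IConst 0)"

definition iset :: "nat \<Rightarrow> nat \<Rightarrow> store \<Rightarrow> store" where
  "iset v x s = (update_at (fst s) v 0 0 x, snd s)"

lemma iset_simps [simp]: "snd (iset v x s) = snd s" "fst (iset v x s) v 0 0 = x"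
  "b \<noteq> v \<Longrightarrow> fst (iset v x s) b = fst s b"
  by (auto simp: iset_def)

definition for_body :: "nat \<Rightarrow> com \<Rightarrow> com" where
  "for_body v c = Seq c (IWrite v (IConst 0) (IConst 0) (IAdd (ivar v) (IConst 1)))"

definition for_loop :: "nat \<Rightarrow> iexp \<Rightarrow> com \<Rightarrow> com" where
  "for_loop v N c = Seq (IWrite v (IConst 0) (IConst 0) (IConst 0))
     (While (ILess (ivar v) N) (for_body v c))"

lemma writes_for_loop [simp]: "iwrites (for_loop v N c) = insert v (iwrites c)"
  "rwrites (for_loop v N c) = rwrites c"
  by (auto simp: for_loop_def for_body_def)

text \<open>A test costs \<open>5 + icost N\<close> and the increment 8, so
  \<open>icost N + 15\<close> covers both. The limit \<open>N\<close> is evaluated anew at every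
  test, hence \<open>bound\<close>; the invariant speaks of the state after the increment, hence
  \<open>iset\<close> in \<open>body\<close>.\<close>

lemma runs_while_for:
  assumes "i \<le> m" "I i s" "fst s v 0 0 = i"
    and bound: "\<And>i s. i \<le> m \<Longrightarrow> I i s \<Longrightarrow> fst s v 0 0 = i \<Longrightarrow> ieval N s = m"
    and body: "\<And>i s. i < m \<Longrightarrow> I i s \<Longrightarrow> fst s v 0 0 = i \<Longrightarrow>
      runs P c s (t i) (\<lambda>s'. fst s' v 0 0 = i \<and> I (Suc i) (iset v (Suc i) s'))"
  shows "runs P (While (ILess (ivar v) N) (for_body v c)) s
    (5 + icost N + (\<Sum>j = i..<m. t j + icost N + 15)) (\<lambda>s'. I m s' \<and> fst s' v 0 0 = m)"
  using assms(1-3)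
proof (induction "m - i" arbitrary: i s)
  case 0
  then have "i = m" by simp
  with 0 bound[of i s] have "\<not> beval (ILess (ivar v) N) s" by simp
  then have "exec P (While (ILess (ivar v) N) (for_body v c)) s s (1 + bcost (ILess (ivar v) N))"
    by (rule exec.WhileFalse)
  then show ?case using 0 \<open>i = m\<close> unfolding runs_def
    by (intro exI conjI) (assumption, auto)
next
  case (Suc d)
  then have i: "i < m" by simp
  have b: "beval (ILess (ivar v) N) s" using bound[OF Suc.prems] Suc.prems i by simp
  obtain s1 t1 where 1: "exec P c s s1 t1" "t1 \<le> t i" "fst s1 v 0 0 = i" "I (Suc i) (iset v (Suc i) s1)"
    using body[OF i Suc.prems(2,3)] unfolding runs_def by blast
  have "exec P (IWrite v (IConst 0) (IConst 0) (IAdd (ivar v) (IConst 1))) s1 (iset v (Suc i) s1) 8"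
    using exec.IWrite[of P v "IConst 0" "IConst 0" "IAdd (ivar v) (IConst 1)" s1] 1(3)
    by (simp add: iset_def eval_nat_numeral)
  then have 2: "exec P (for_body v c) s (iset v (Suc i) s1) (t1 + 8)"
    unfolding for_body_def using 1(1) by (blast intro: exec.Seq)
  obtain s2 t2 where 3: "exec P (While (ILess (ivar v) N) (for_body v c)) (iset v (Suc i) s1) s2 t2"
    "t2 \<le> 5 + icost N + (\<Sum>j = Suc i..<m. t j + icost N + 15)" "I m s2" "fst s2 v 0 0 = m"
  proof -
    have "d = m - Suc i" using Suc.hyps(2) by simp
    then have "runs P (While (ILess (ivar v) N) (for_body v c)) (iset v (Suc i) s1)
      (5 + icost N + (\<Sum>j = Suc i..<m. t j + icost N + 15)) (\<lambda>s'. I m s' \<and> fst s' v 0 0 = m)"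
      using 1(4) i by (intro Suc.hyps(1)) auto
    then show ?thesis unfolding runs_def using that by blast
  qed
  have "exec P (While (ILess (ivar v) N) (for_body v c)) s s2
      (1 + bcost (ILess (ivar v) N) + (t1 + 8) + t2)"
    using b 2 3(1) by (rule exec.WhileTrue)
  moreover have "(\<Sum>j = i..<m. t j + icost N + 15) =
      t i + icost N + 15 + (\<Sum>j = Suc i..<m. t j + icost N + 15)"
    using i by (simp add: sum.atLeast_Suc_lessThan)
  moreover have "1 + bcost (ILess (ivar v) N) + (t1 + 8) + t2 \<le>
      5 + icost N + (t i + icost N + 15 + (\<Sum>j = Suc i..<m. t j + icost N + 15))"
    using 3(2) 1(2) by simp
  ultimately show ?case using 3(3,4) unfolding runs_def by metis
qed

text \<open>The 9 is 4 for setting the counter to zero plus 5 for the last test.\<close>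

lemma runs_for:
  assumes "I 0 (iset v 0 s)"
    and bound: "\<And>i s. i \<le> m \<Longrightarrow> I i s \<Longrightarrow> fst s v 0 0 = i \<Longrightarrow> ieval N s = m"
    and body: "\<And>i s. i < m \<Longrightarrow> I i s \<Longrightarrow> fst s v 0 0 = i \<Longrightarrow>
      runs P c s (t i) (\<lambda>s'. fst s' v 0 0 = i \<and> I (Suc i) (iset v (Suc i) s'))"
    and post: "\<And>s'. I m s' \<Longrightarrow> fst s' v 0 0 = m \<Longrightarrow> Q s'"
    and time: "9 + icost N + (\<Sum>j<m. t j + icost N + 15) \<le> T"
  shows "runs P (for_loop v N c) s T Q"
proof -
  have "runs P (While (ILess (ivar v) N) (for_body v c)) (iset v 0 s)
    (5 + icost N + (\<Sum>j = 0..<m. t j + icost N + 15)) (\<lambda>s'. I m s' \<and> fst s' v 0 0 = m)"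
    using assms(1) by (intro runs_while_for bound body) auto
  then show ?thesis using time post unfolding for_loop_def
    by (auto simp: iset_def lessThan_atLeast0 elim!: runs_mono)
qed

text \<open>Puts \<open>agree\<close> into the invariant once and for all. Since the body does not
  write \<open>v\<close>, the frame condition also shows that the counter survives until the
  increment.\<close>

lemma runs_for_frame:
  assumes v: "v \<notin> iwrites c" and "I 0 (iset v 0 s)"
    and bound: "\<And>i s'. i \<le> m \<Longrightarrow> I i s' \<Longrightarrow> fst s' v 0 0 = i \<Longrightarrow> agree (for_loop v N c) s s' \<Longrightarrow>
      ieval N s' = m"
    and body: "\<And>i s'. i < m \<Longrightarrow> I i s' \<Longrightarrow> fst s' v 0 0 = i \<Longrightarrow> agree (for_loop v N c) s s' \<Longrightarrow>
      runs P c s' (t i) (\<lambda>s''. I (Suc i) (iset v (Suc i) s''))"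
    and post: "\<And>s'. I m s' \<Longrightarrow> agree (for_loop v N c) s s' \<Longrightarrow> Q s'"
    and time: "9 + icost N + (\<Sum>j<m. t j + icost N + 15) \<le> T"
  shows "runs P (for_loop v N c) s T Q"
proof (rule runs_for[where I = "\<lambda>i s'. I i s' \<and> agree (for_loop v N c) s s'" and t = t and m = m])
  show "I 0 (iset v 0 s) \<and> agree (for_loop v N c) s (iset v 0 s)"
    using assms(2) by (simp add: agree_def)
next
  fix i s'
  assume *: "i < m" "I i s' \<and> agree (for_loop v N c) s s'" "fst s' v 0 0 = i"
  then have "runs P c s' (t i) (\<lambda>s''. I (Suc i) (iset v (Suc i) s''))" using body by blast
  then show "runs P c s' (t i) (\<lambda>s'a. fst s'a v 0 0 = i \<and>
      I (Suc i) (iset v (Suc i) s'a) \<and> agree (for_loop v N c) s (iset v (Suc i) s'a))"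
    using * v by (elim runs_agree[THEN runs_mono]) (auto simp: agree_def)
qed (use bound post time in auto)

section \<open>Procedure calls and relocation of programs\<close>

lemma runs_Call:
  assumes "p < length P" "distinct is" "distinct rs"
    and "runs P (P ! p) (bind_args is (fst s), bind_args rs (snd s)) u
      (\<lambda>s'. Q (return_args is (fst s) (fst s'), return_args rs (snd s) (snd s')))"
    and "1 + length is + length rs + u \<le> t"
  shows "runs P (Call p is rs) s t Q"
proof -
  obtain s' v where "exec P (P ! p) (bind_args is (fst s), bind_args rs (snd s)) s' v" "v \<le> u"
    "Q (return_args is (fst s) (fst s'), return_args rs (snd s) (snd s'))"
    using assms(4) unfolding runs_def by blast
  moreover from this(1) have "exec P (Call p is rs) s
      (return_args is (fst s) (fst s'), return_args rs (snd s) (snd s')) (1 + length is + length rs + v)"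
    by (rule exec.Call[OF assms(1-3)])
  moreover have "1 + length is + length rs + v \<le> t" using \<open>v \<le> u\<close> assms(5) by simp
  ultimately show ?thesis unfolding runs_def by blast
qed

text \<open>The given solver becomes the tail of a larger program, so its procedure numbers move by
  the length \<open>d\<close> of what precedes it.\<close>

fun shift_calls :: "nat \<Rightarrow> com \<Rightarrow> com" where
  "shift_calls d (Seq b c) = Seq (shift_calls d b) (shift_calls d c)"
| "shift_calls d (If b c e) = If b (shift_calls d c) (shift_calls d e)"
| "shift_calls d (While b c) = While b (shift_calls d c)"
| "shift_calls d (Call p is rs) = Call (p + d) is rs"
| "shift_calls d c = c"

lemma exec_shift_calls:
  "exec P c s s' t \<Longrightarrow> exec (A @ map (shift_calls (length A)) P) (shift_calls (length A) c) s s' t"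
proof (induction rule: exec.induct)
  case (Call p "is" rs s s' t)
  have "exec (A @ map (shift_calls (length A)) P) (Call (p + length A) is rs) s
      (return_args is (fst s) (fst s'), return_args rs (snd s) (snd s'))
      (1 + length is + length rs + t)"
    using Call by (intro exec.Call) (auto simp: nth_append)
  then show ?case by simp
qed (simp_all only: shift_calls.simps, (rule exec.intros; assumption)+)

section \<open>Positive semidefinite matrices\<close>

text \<open>Vectors and matrices are plain functions of which only the arguments below
  \<open>n\<close> count, so that rows of arrays can serve as vectors without conversion.\<close>

definition ip :: "nat \<Rightarrow> (nat \<Rightarrow> real) \<Rightarrow> (nat \<Rightarrow> real) \<Rightarrow> real" where
  "ip n u w = (\<Sum>r<n. u r * w r)"

definition mv :: "nat \<Rightarrow> (nat \<Rightarrow> nat \<Rightarrow> real) \<Rightarrow> (nat \<Rightarrow> real) \<Rightarrow> nat \<Rightarrow> real" where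
  "mv n A u r = (\<Sum>c<n. A r c * u c)"

definition symm :: "nat \<Rightarrow> (nat \<Rightarrow> nat \<Rightarrow> real) \<Rightarrow> bool" where
  "symm n A \<longleftrightarrow> (\<forall>r<n. \<forall>c<n. A r c = A c r)"

definition psd :: "nat \<Rightarrow> (nat \<Rightarrow> nat \<Rightarrow> real) \<Rightarrow> bool" where
  "psd n A \<longleftrightarrow> symm n A \<and> (\<forall>u. 0 \<le> ip n u (mv n A u))"

lemma ip_commute: "ip n u w = ip n w u"
  by (simp add: ip_def mult.commute)

lemma ip_add: "ip n u (\<lambda>r. v r + w r) = ip n u v + ip n u w"
  by (simp add: ip_def distrib_left sum.distrib)

lemma ip_add_left: "ip n (\<lambda>r. v r + w r) u = ip n v u + ip n w u"
  by (simp add: ip_def distrib_right sum.distrib)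

lemma ip_diff: "ip n u (\<lambda>r. v r - w r) = ip n u v - ip n u w"
  by (simp add: ip_def right_diff_distrib sum_subtractf)

lemma ip_diff_left: "ip n (\<lambda>r. v r - w r) u = ip n v u - ip n w u"
  by (simp add: ip_def left_diff_distrib sum_subtractf)

lemma ip_scale: "ip n u (\<lambda>r. a * w r) = a * ip n u w"
  by (simp add: ip_def sum_distrib_left mult.left_commute)

lemma ip_scale_left: "ip n (\<lambda>r. a * w r) u = a * ip n w u"
  by (simp add: ip_def sum_distrib_left mult.assoc)

lemma ip_sum: "ip n u (\<lambda>r. \<Sum>i\<in>I. f i r) = (\<Sum>i\<in>I. ip n u (f i))"
  unfolding ip_def sum_distrib_left by (rule sum.swap)

lemma ip_sum_left: "ip n (\<lambda>r. \<Sum>i\<in>I. f i r) u = (\<Sum>i\<in>I. ip n (f i) u)"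
  unfolding ip_def sum_distrib_right by (rule sum.swap)

lemmas ip_linear = ip_add ip_add_left ip_diff ip_diff_left ip_scale ip_scale_left ip_sum ip_sum_left

lemma ip_cong: "(\<And>r. r < n \<Longrightarrow> u r = u' r) \<Longrightarrow> (\<And>r. r < n \<Longrightarrow> w r = w' r) \<Longrightarrow> ip n u w = ip n u' w'"
  by (auto simp: ip_def intro: sum.cong)

lemma ip_self_eq_0: "ip n u u = 0 \<Longrightarrow> r < n \<Longrightarrow> u r = 0"
  unfolding ip_def by (subst (asm) sum_nonneg_eq_0_iff) auto

lemma mv_add: "mv n A (\<lambda>r. v r + w r) r = mv n A v r + mv n A w r"
  by (simp add: mv_def distrib_left sum.distrib)

lemma mv_diff: "mv n A (\<lambda>r. v r - w r) r = mv n A v r - mv n A w r"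
  by (simp add: mv_def right_diff_distrib sum_subtractf)

lemma mv_scale: "mv n A (\<lambda>r. a * w r) r = a * mv n A w r"
  by (simp add: mv_def sum_distrib_left mult.left_commute)

lemma mv_sum: "mv n A (\<lambda>r. \<Sum>i\<in>I. f i r) r = (\<Sum>i\<in>I. mv n A (f i) r)"
  unfolding mv_def sum_distrib_left by (rule sum.swap)

lemma mv_cong: "(\<And>c. c < n \<Longrightarrow> u c = u' c) \<Longrightarrow> mv n A u r = mv n A u' r"
  by (auto simp: mv_def intro: sum.cong)

lemma ip_mv_symm:
  assumes "symm n A"
  shows "ip n u (mv n A w) = ip n (mv n A u) w"
proof -
  have "ip n u (mv n A w) = (\<Sum>r<n. \<Sum>c<n. u r * (A r c * w c))"
    by (simp add: ip_def mv_def sum_distrib_left)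
  also have "\<dots> = (\<Sum>c<n. \<Sum>r<n. u r * (A r c * w c))"
    by (rule sum.swap)
  also have "\<dots> = (\<Sum>c<n. \<Sum>r<n. A c r * u r * w c)"
    using assms by (intro sum.cong refl) (auto simp: symm_def)
  also have "\<dots> = ip n (mv n A u) w"
    by (simp add: ip_def mv_def sum_distrib_right)
  finally show ?thesis .
qed

text \<open>Gram-Schmidt without linear independence. The induction hypothesis is used for
  \<open>v\<close> and for \<open>a k\<close>, whose residuals are \<open>w\<close> and
  \<open>p\<close>; hence \<open>v\<close> is arbitrary.\<close>

lemma projection_exists:
  fixes a :: "nat \<Rightarrow> nat \<Rightarrow> real" and k :: nat
  shows "\<exists>c. \<forall>j<k. ip n (\<lambda>r. v r - (\<Sum>i<k. c i * a i r)) (a j) = 0"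
proof (induction k arbitrary: v)
  case 0
  then show ?case by simp
next
  case (Suc k)
  obtain c1 where c1: "\<And>j. j < k \<Longrightarrow> ip n (\<lambda>r. v r - (\<Sum>i<k. c1 i * a i r)) (a j) = 0"
    using Suc[of v] by blast
  obtain c2 where c2: "\<And>j. j < k \<Longrightarrow> ip n (\<lambda>r. a k r - (\<Sum>i<k. c2 i * a i r)) (a j) = 0"
    using Suc[of "a k"] by blast
  define p where "p = (\<lambda>r. a k r - (\<Sum>i<k. c2 i * a i r))"
  define w where "w = (\<lambda>r. v r - (\<Sum>i<k. c1 i * a i r))"
  \<comment> \<open>Removes the component along \<open>p\<close>. If \<open>a k\<close> depends on
    the earlier vectors, \<open>p\<close> is zero below \<open>n\<close> and any coefficient would
    do.\<close>
  define \<beta> where "\<beta> = ip n w p / ip n p p"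
  define c where "c = (\<lambda>i. if i = k then \<beta> else c1 i - \<beta> * c2 i)"
  have res: "(\<lambda>r. v r - (\<Sum>i<Suc k. c i * a i r)) = (\<lambda>r. w r - \<beta> * p r)"
    by (auto simp: c_def w_def p_def fun_eq_iff left_diff_distrib sum_subtractf right_diff_distrib
        sum_distrib_left mult.assoc)
  have old: "ip n (\<lambda>r. w r - \<beta> * p r) (a j) = 0" if "j < k" for j
    using c1[OF that] c2[OF that] by (simp add: ip_linear w_def[symmetric] p_def[symmetric])
  have ak: "a k = (\<lambda>r. p r + (\<Sum>i<k. c2 i * a i r))" by (simp add: p_def)
  have "ip n (\<lambda>r. w r - \<beta> * p r) p = 0"
  proof (cases "ip n p p = 0")
    case True
    then have "ip n u p = 0" for u using ip_self_eq_0[OF True] by (simp add: ip_def)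
    then show ?thesis by simp
  next
    case False
    then have "\<beta> * ip n p p = ip n w p" by (simp add: \<beta>_def)
    then show ?thesis by (simp add: ip_linear)
  qed
  then have "ip n (\<lambda>r. w r - \<beta> * p r) (a k) = 0"
    by (subst ak) (simp add: ip_add ip_sum ip_scale old)
  with old have "\<forall>j<Suc k. ip n (\<lambda>r. w r - \<beta> * p r) (a j) = 0"
    by (auto simp: less_Suc_eq)
  then show ?case unfolding res[symmetric] by blast
qed

text \<open>The range is the orthogonal complement of the kernel: the residual \<open>u\<close> of
  projecting \<open>v\<close> onto the columns is in the kernel by symmetry, hence orthogonal to
  \<open>v\<close> and so to itself.\<close>

lemma symm_range:
  assumes A: "symm n A"
    and ker: "\<And>u. (\<And>r. r < n \<Longrightarrow> mv n A u r = 0) \<Longrightarrow> ip n v u = 0"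
  obtains z where "\<And>r. r < n \<Longrightarrow> mv n A z r = v r"
proof -
  obtain z where z: "\<And>j. j < n \<Longrightarrow> ip n (\<lambda>r. v r - (\<Sum>i<n. z i * A r i)) (\<lambda>r. A r j) = 0"
    using projection_exists[of n n v "\<lambda>i r. A r i"] by blast
  define u where "u = (\<lambda>r. v r - mv n A z r)"
  have u: "u = (\<lambda>r. v r - (\<Sum>i<n. z i * A r i))"
    by (simp add: u_def mv_def mult.commute)
  have "mv n A u j = 0" if "j < n" for j
  proof -
    have "mv n A u j = ip n u (\<lambda>r. A r j)"
      using A that by (auto simp: mv_def ip_def symm_def intro!: sum.cong)
    then show ?thesis using z[OF that] u by simp
  qed
  note mu = this
  have "ip n u u = ip n v u - ip n (mv n A z) u"
    by (subst (1) u_def) (rule ip_diff_left)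
  also have "ip n (mv n A z) u = ip n z (mv n A u)" by (rule ip_mv_symm[OF A, symmetric])
  also have "\<dots> = 0" using mu by (simp add: ip_def)
  finally have "ip n u u = 0" using ker mu by simp
  then have "u r = 0" if "r < n" for r using ip_self_eq_0 that by blast
  then show ?thesis by (intro that[of z]) (simp add: u_def)
qed

text \<open>The quadratic \<open>?a + 2 * t * ?b + t\<^sup>2 * ?c\<close> is nonnegative for all
  \<open>t\<close>. Semidefiniteness allows \<open>?c = 0\<close>; then it is linear in
  \<open>t\<close>, which forces \<open>?b = 0\<close>.\<close>

lemma psd_Cauchy_Schwarz:
  assumes "psd n A"
  shows "(ip n u (mv n A w))\<^sup>2 \<le> ip n u (mv n A u) * ip n w (mv n A w)"
proof -
  let ?a = "ip n u (mv n A u)" and ?b = "ip n u (mv n A w)" and ?c = "ip n w (mv n A w)"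
  have b: "ip n w (mv n A u) = ?b"
    using assms ip_mv_symm[of n A w u] by (simp add: psd_def ip_commute)
  have "0 \<le> ?a + 2 * t * ?b + t\<^sup>2 * ?c" for t
  proof -
    have "mv n A (\<lambda>r. u r + t * w r) = (\<lambda>r. mv n A u r + t * mv n A w r)"
      by (simp add: fun_eq_iff mv_add mv_scale)
    then have "ip n (\<lambda>r. u r + t * w r) (mv n A (\<lambda>r. u r + t * w r)) = ?a + 2 * t * ?b + t\<^sup>2 * ?c"
      using b by (simp add: ip_linear algebra_simps power2_eq_square)
    moreover have "0 \<le> ip n (\<lambda>r. u r + t * w r) (mv n A (\<lambda>r. u r + t * w r))"
      using assms unfolding psd_def by blast
    ultimately show ?thesis by simp
  qed
  note q = this
  have c: "0 \<le> ?c" using assms by (simp add: psd_def)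
  show ?thesis
  proof (cases "?c = 0")
    case True
    have "?b = 0"
    proof (rule ccontr)
      assume "?b \<noteq> 0"
      \<comment> \<open>At this \<open>t\<close> the linear function takes the value -1.\<close>
      with q[of "- (?a + 1) / (2 * ?b)"] True have "0 \<le> ?a - (?a + 1)"
        by (simp add: field_simps)
      then show False by simp
    qed
    with True show ?thesis by simp
  next
    case False
    with c have "?c > 0" by simp
    with q[of "- ?b / ?c"] show ?thesis by (simp add: field_simps power2_eq_square)
  qed
qed

lemma psd_sum:
  assumes "\<And>i. i \<in> I \<Longrightarrow> psd n (A i)" "\<And>i. i \<in> I \<Longrightarrow> 0 \<le> \<alpha> i"
  shows "psd n (\<lambda>r c. \<Sum>i\<in>I. \<alpha> i * A i r c)"
proof -
  have "mv n (\<lambda>r c. \<Sum>i\<in>I. \<alpha> i * A i r c) u = (\<lambda>r. \<Sum>i\<in>I. \<alpha> i * mv n (A i) u r)" for u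
    unfolding mv_def sum_distrib_right sum_distrib_left mult.assoc by (intro ext sum.swap)
  then show ?thesis using assms
    by (auto simp: psd_def symm_def ip_linear intro!: sum_nonneg sum.cong)
qed

section \<open>Sherman-Morrison updates\<close>

text \<open>The relations among the coefficients that the updates rely on. By \<open>dq\<close>, the
  quadratic form of each rank one term is at most that of \<open>\<alpha> i * L i\<close>, with
  equality only where both vanish.\<close>

locale downdate =
  fixes n k :: nat and L :: "nat \<Rightarrow> nat \<Rightarrow> nat \<Rightarrow> real"
    and \<alpha> d q :: "nat \<Rightarrow> real" and e v :: "nat \<Rightarrow> nat \<Rightarrow> real"
  assumes psdL: "\<And>i. i < k \<Longrightarrow> psd n (L i)"
    and alpha: "\<And>i. i < k \<Longrightarrow> 0 < \<alpha> i" and d: "\<And>i. i < k \<Longrightarrow> 0 < d i"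
    and dq: "\<And>i. i < k \<Longrightarrow> d i * q i < \<alpha> i"
    and v: "\<And>i r. i < k \<Longrightarrow> r < n \<Longrightarrow> v i r = mv n (L i) (e i) r"
    and q: "\<And>i. i < k \<Longrightarrow> q i = ip n (e i) (mv n (L i) (e i))"
begin

definition M :: "nat \<Rightarrow> nat \<Rightarrow> real" where
  "M r c = (\<Sum>i<k. \<alpha> i * L i r c)"

definition S :: "nat \<Rightarrow> nat \<Rightarrow> nat \<Rightarrow> real" where
  "S j r c = M r c - (\<Sum>i<j. d i * v i r * v i c)"

lemma psd_M: "psd n M"
  using psd_sum[of "{..<k}" n L \<alpha>] psdL alpha unfolding M_def by (auto intro: less_imp_le)

lemma mv_M: "mv n M u r = (\<Sum>i<k. \<alpha> i * mv n (L i) u r)"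
  unfolding mv_def M_def by (simp add: sum_distrib_right sum_distrib_left mult.assoc) (rule sum.swap)

lemma mv_S: "mv n (S j) u r = mv n M u r - (\<Sum>i<j. d i * ip n (v i) u * v i r)"
proof -
  have "mv n (S j) u r = mv n M u r - (\<Sum>c<n. \<Sum>i<j. d i * (v i c * u c) * v i r)"
    by (simp add: mv_def S_def sum_distrib_right left_diff_distrib right_diff_distrib sum_distrib_left sum_subtractf mult_ac)
  also have "(\<Sum>c<n. \<Sum>i<j. d i * (v i c * u c) * v i r) = (\<Sum>i<j. \<Sum>c<n. d i * (v i c * u c) * v i r)"
    by (rule sum.swap)
  finally show ?thesis by (simp add: ip_def sum_distrib_left sum_distrib_right)
qed

text \<open>Cauchy-Schwarz for the semi-inner product of \<open>L i\<close>, applied to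
  \<open>e i\<close> and \<open>u\<close>.\<close>

lemma ip_v_sq: "i < k \<Longrightarrow> (ip n (v i) u)\<^sup>2 \<le> q i * ip n u (mv n (L i) u)"
proof -
  assume i: "i < k"
  have "ip n (v i) u = ip n (mv n (L i) (e i)) u"
    using v[OF i] by (intro ip_cong) auto
  also have "\<dots> = ip n (e i) (mv n (L i) u)"
    using psdL[OF i] by (simp add: psd_def ip_mv_symm)
  finally show ?thesis using psd_Cauchy_Schwarz[OF psdL[OF i], of "e i" u] q[OF i] by simp
qed

lemma quad_nonneg: "i < k \<Longrightarrow> 0 \<le> ip n u (mv n (L i) u)"
  using psdL by (simp add: psd_def)

lemma ip_v_eq_0: "i < k \<Longrightarrow> ip n u (mv n (L i) u) = 0 \<Longrightarrow> ip n (v i) u = 0"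
  using ip_v_sq[of i u] by simp

text \<open>If \<open>M\<close> maps \<open>u\<close> to 0, the nonnegative numbers
  \<open>\<alpha> i * ip n u (mv n (L i) u)\<close> add up to 0, so each of them vanishes and
  \<open>v j\<close> is orthogonal to \<open>u\<close>.\<close>

lemma v_in_range_M:
  assumes j: "j < k"
  obtains w where "\<And>r. r < n \<Longrightarrow> mv n M w r = v j r"
proof (rule symm_range[of n M "v j"])
  show "symm n M" using psd_M by (simp add: psd_def)
next
  fix u assume "\<And>r. r < n \<Longrightarrow> mv n M u r = 0"
  then have "0 = ip n u (mv n M u)" by (simp add: ip_def)
  also have "\<dots> = (\<Sum>i<k. \<alpha> i * ip n u (mv n (L i) u))"
    by (simp add: mv_M[abs_def] ip_linear)
  finally have "\<alpha> j * ip n u (mv n (L j) u) = 0"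
    using quad_nonneg alpha j
    by (subst (asm) eq_commute, subst (asm) sum_nonneg_eq_0_iff) (auto simp: less_imp_le)
  then show "ip n (v j) u = 0" using ip_v_eq_0 alpha[OF j] j by simp
qed (use that in blast)

text \<open>Moving the rank one terms to the other side changes the right-hand side by multiples of
  the \<open>v i\<close>, which lie in the range of \<open>M\<close>. For \<open>j = k\<close> this
  makes the reduced right-hand side admissible for the given solver.\<close>

lemma range_S:
  assumes j: "j \<le> k" and c: "\<And>r. r < n \<Longrightarrow> mv n (S j) z r = c r"
  obtains w where "\<And>r. r < n \<Longrightarrow> mv n M w r = c r"
proof -
  have "\<forall>i\<in>{..<j}. \<exists>w. \<forall>r<n. mv n M w r = v i r" using v_in_range_M j
    by (metis lessThan_iff order_less_le_trans)
  then obtain W where W: "\<And>i r. i < j \<Longrightarrow> r < n \<Longrightarrow> mv n M (W i) r = v i r" by (metis lessThan_iff)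
  have "mv n M (\<lambda>r. z r - (\<Sum>i<j. (d i * ip n (v i) z) * W i r)) r = c r" if "r < n" for r
    using W that c[OF that] by (simp add: mv_diff mv_sum mv_scale mv_S)
  then show ?thesis by (rule that)
qed

text \<open>Otherwise \<open>d j * a = 1\<close> for \<open>a = ip n (v j) w\<close>. Testing the
  system with \<open>w\<close>, and bounding the earlier rank one terms by
  \<open>\<alpha> i * Q i\<close>, gives \<open>\<alpha> j * Q j \<le> a\<close>; on the other hand
  \<open>a = d j * a * a \<le> d j * q j * Q j\<close>. Now \<open>dq\<close> forces
  \<open>Q j = 0\<close>, whence \<open>a = 0\<close>.\<close>

lemma denominator:
  assumes j: "j < k" and w: "\<And>r. r < n \<Longrightarrow> mv n (S j) w r = v j r"
  shows "1 - d j * ip n (v j) w \<noteq> 0"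
proof
  assume *: "1 - d j * ip n (v j) w = 0"
  define a where "a = ip n (v j) w"
  define Q where "Q = (\<lambda>i. ip n w (mv n (L i) w))"
  have a: "d j * a = 1" using * a_def by simp
  have "a = ip n w (mv n (S j) w)"
    unfolding a_def by (subst ip_commute) (rule ip_cong, auto simp: w)
  also have "\<dots> = (\<Sum>i<k. \<alpha> i * Q i) - (\<Sum>i<j. d i * (ip n (v i) w)\<^sup>2)"
    by (simp add: mv_S[abs_def] mv_M[abs_def] ip_linear Q_def ip_commute[of n w "v _"] power2_eq_square mult.assoc)
  finally have 1: "a = (\<Sum>i<k. \<alpha> i * Q i) - (\<Sum>i<j. d i * (ip n (v i) w)\<^sup>2)" .
  have dQ: "d i * (ip n (v i) w)\<^sup>2 \<le> \<alpha> i * Q i" if "i < k" for i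
  proof -
    have "d i * (ip n (v i) w)\<^sup>2 \<le> d i * (q i * Q i)"
      using ip_v_sq[OF that, of w] d[OF that] by (simp add: Q_def)
    also have "\<dots> \<le> \<alpha> i * Q i"
      using dq[OF that] quad_nonneg[OF that, of w] mult_right_mono[of "d i * q i" "\<alpha> i" "Q i"]
      by (simp add: Q_def mult.assoc)
    finally show ?thesis .
  qed
  have "(\<Sum>i<j. d i * (ip n (v i) w)\<^sup>2) + \<alpha> j * Q j \<le> (\<Sum>i<j. \<alpha> i * Q i) + \<alpha> j * Q j"
    using dQ j by (intro add_right_mono sum_mono) auto
  also have "\<dots> = (\<Sum>i<Suc j. \<alpha> i * Q i)" by simp
  also have "\<dots> \<le> (\<Sum>i<k. \<alpha> i * Q i)"
    using j quad_nonneg alpha by (intro sum_mono2) (auto simp: Q_def less_imp_le)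
  finally have "\<alpha> j * Q j \<le> a" using 1 by simp
  also have "a = d j * a * a" using a by simp
  also have "\<dots> \<le> d j * (q j * Q j)"
    using ip_v_sq[OF j, of w] d[OF j] by (simp add: Q_def a_def power2_eq_square mult.assoc)
  finally have "(\<alpha> j - d j * q j) * Q j \<le> 0" by (simp add: algebra_simps)
  then have "Q j = 0" using dq[OF j] quad_nonneg[OF j, of w]
    by (auto simp: Q_def mult_le_0_iff)
  then have "a = 0" using ip_v_eq_0[OF j] by (simp add: Q_def a_def)
  with a show False by simp
qed

text \<open>Since \<open>w\<close> solves the system for \<open>v j\<close>, the new matrix maps
  \<open>z + \<beta> * w\<close> to \<open>c\<close> plus a multiple of \<open>v j\<close>, and
  \<open>\<beta>\<close> makes this multiple vanish. The matrices may be singular.\<close>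

lemma update:
  assumes j: "j < k" and w: "\<And>r. r < n \<Longrightarrow> mv n (S j) w r = v j r"
    and z: "\<And>r. r < n \<Longrightarrow> mv n (S j) z r = c r" and r: "r < n"
  shows "mv n (S (Suc j)) (\<lambda>r. z r + d j * ip n (v j) z / (1 - d j * ip n (v j) w) * w r) r = c r"
proof -
  define D where "D = 1 - d j * ip n (v j) w"
  define \<beta> where "\<beta> = d j * ip n (v j) z / D"
  have D: "D \<noteq> 0" using denominator[OF j w] by (simp add: D_def)
  have S: "mv n (S (Suc j)) u r = mv n (S j) u r - d j * ip n (v j) u * v j r" for u
    by (simp add: mv_S)
  have "mv n (S (Suc j)) (\<lambda>r. z r + \<beta> * w r) r = c r + v j r * (\<beta> * D - d j * ip n (v j) z)"
    using w[OF r] z[OF r] by (simp add: S mv_add mv_scale ip_linear D_def algebra_simps)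
  also have "\<beta> * D - d j * ip n (v j) z = 0" using D by (simp add: \<beta>_def)
  finally show ?thesis by (simp add: \<beta>_def D_def)
qed

end

section \<open>The Hessian of the barrier function\<close>

lemma sum_lessThan_add: "(\<Sum>j<n + k. f j) = (\<Sum>j<n. f j) + (\<Sum>l<k. f (n + l) :: real)" for n k :: nat
  by (induction k) auto

lemma all_less_add: "(\<forall>i<n + k. P i) \<longleftrightarrow> (\<forall>i<n. P i) \<and> (\<forall>l<k. P (n + l))" for n k :: nat
proof (intro iffI allI impI conjI)
  fix i assume *: "(\<forall>i<n. P i) \<and> (\<forall>l<k. P (n + l))" "i < n + k"
  show "P i"
  proof (cases "i < n")
    case False
    then obtain l where "i = n + l" using le_Suc_ex[of n i] by auto
    then show ?thesis using * by simp
  qed (use * in auto)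
qed auto

locale barrier_data =
  fixes n k :: nat and L :: "nat \<Rightarrow> nat \<Rightarrow> nat \<Rightarrow> real" and s :: "nat \<Rightarrow> nat \<Rightarrow> real"
  assumes psdL: "\<And>l. l < k \<Longrightarrow> psd n (L l)"
begin

text \<open>A point \<open>w\<close> holds \<open>x\<close> in its coordinates below \<open>n\<close> and \<open>y\<close> in the next \<open>k\<close> ones.\<close>

definition vf :: "nat \<Rightarrow> (nat \<Rightarrow> real) \<Rightarrow> nat \<Rightarrow> real" where
  "vf l w = mv n (L l) (\<lambda>c. w c - s l c)"

definition qf :: "nat \<Rightarrow> (nat \<Rightarrow> real) \<Rightarrow> real" where
  "qf l w = ip n (\<lambda>c. w c - s l c) (vf l w)"

lemma qf_nonneg: "l < k \<Longrightarrow> 0 \<le> qf l w"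
  using psdL unfolding qf_def vf_def psd_def by blast

definition F :: "nat \<Rightarrow> (nat \<Rightarrow> real) \<Rightarrow> real" where
  "F l w = (w (n + l))\<^sup>2 - qf l w"

definition phi :: "(nat \<Rightarrow> real) \<Rightarrow> real" where
  "phi w = - (\<Sum>l<k. ln (F l w))"

definition grad :: "nat \<Rightarrow> (nat \<Rightarrow> real) \<Rightarrow> real" where
  "grad j w = (if j < n then \<Sum>l<k. 2 * vf l w j / F l w else - 2 * w j / F (j - n) w)"

definition dF :: "nat \<Rightarrow> nat \<Rightarrow> (nat \<Rightarrow> real) \<Rightarrow> real" where
  "dF l i w = (if i = n + l then 2 * w i else 0) - (if i < n then 2 * vf l w i else 0)"

text \<open>The derivative of \<open>grad j\<close> in direction \<open>i\<close>, in the order used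
  by \<open>hessian\<close>. The last block is diagonal because each \<open>F l\<close> contains
  only one coordinate of \<open>y\<close>.\<close>

definition hess :: "nat \<Rightarrow> nat \<Rightarrow> (nat \<Rightarrow> real) \<Rightarrow> real" where
  "hess i j w =
    (if i < n then
       if j < n then \<Sum>l<k. 2 * L l j i / F l w + 4 * vf l w j * vf l w i / (F l w)\<^sup>2
       else - 4 * w j * vf (j - n) w i / (F (j - n) w)\<^sup>2
     else if j < n then - 4 * w i * vf (i - n) w j / (F (i - n) w)\<^sup>2
     else if i = j then - 2 / F (i - n) w + 4 * (w i)\<^sup>2 / (F (i - n) w)\<^sup>2 else 0)"

definition domain :: "(nat \<Rightarrow> real) \<Rightarrow> bool" where
  "domain w \<longleftrightarrow> (\<forall>l<k. 0 < F l w)"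

section \<open>Derivatives along coordinate lines\<close>

lemma deriv_coord: "((\<lambda>t. (w(i := t)) r) has_real_derivative (if r = i then 1 else 0)) (at a)"
  by (auto intro!: derivative_eq_intros)

lemma deriv_coord_diff:
  "((\<lambda>t. (w(i := t)) r - a) has_real_derivative (if r = i then 1 else 0)) (at x)"
  using DERIV_diff[OF deriv_coord[of w i r x] DERIV_const[of a]] by (simp only: diff_0_right)

lemma deriv_vf:
  "((\<lambda>t. vf l (w(i := t)) r) has_real_derivative (if i < n then L l r i else 0)) (at a)"
proof -
  have "((\<lambda>t. vf l (w(i := t)) r) has_real_derivative (\<Sum>c<n. L l r c * (if c = i then 1 else 0))) (at a)"
    unfolding vf_def mv_def
    by (rule DERIV_sum, rule DERIV_cmult, rule deriv_coord_diff)
  also have "(\<Sum>c<n. L l r c * (if c = i then 1 else 0)) = (\<Sum>c<n. if c = i then L l r i else 0)"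
    by (rule sum.cong) auto
  also have "\<dots> = (if i < n then L l r i else 0)" by (subst sum.delta) auto
  finally show ?thesis .
qed

lemma deriv_qf:
  assumes "l < k"
  shows "((\<lambda>t. qf l (w(i := t))) has_real_derivative (if i < n then 2 * vf l w i else 0)) (at (w i))"
proof -
  let ?D = "\<Sum>r<n. (if r = i then 1 else 0) * vf l w r + (if i < n then L l r i else 0) * (w r - s l r)"

  have "((\<lambda>t. qf l (w(i := t))) has_real_derivative ?D) (at (w i))"
    unfolding qf_def ip_def
  proof (rule DERIV_sum)
    fix r
    show "((\<lambda>t. ((w(i := t)) r - s l r) * vf l (w(i := t)) r) has_real_derivative
        (if r = i then 1 else 0) * vf l w r + (if i < n then L l r i else 0) * (w r - s l r)) (at (w i))"
      using DERIV_mult[OF deriv_coord_diff[of w i r "s l r" "w i"] deriv_vf[of l w i r "w i"]]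
      by (simp only: fun_upd_triv)
  qed
  \<comment> \<open>Symmetry of \<open>L l\<close> turns the second half of the product rule into
    another copy of \<open>vf l w i\<close>.\<close>
  also have "?D = (\<Sum>r<n. if r = i then vf l w i else 0) + (\<Sum>r<n. if i < n then L l i r * (w r - s l r) else 0)"
    unfolding sum.distrib using psdL[OF assms]
    by (intro arg_cong2[where f = "(+)"] sum.cong) (auto simp: psd_def symm_def)
  also have "\<dots> = (if i < n then 2 * vf l w i else 0)"
    by (subst sum.delta) (auto simp: vf_def mv_def)
  finally show ?thesis .
qed

lemma deriv_F:
  assumes "l < k"
  shows "((\<lambda>t. F l (w(i := t))) has_real_derivative dF l i w) (at (w i))"
proof -
  have "((\<lambda>t. ((w(i := t)) (n + l))\<^sup>2) has_real_derivative (if i = n + l then 2 * w i else 0)) (at (w i))"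
    by (auto intro!: derivative_eq_intros)
  from DERIV_diff[OF this deriv_qf[OF assms, of w i]] show ?thesis
    unfolding F_def dF_def .
qed

lemma deriv_phi:
  assumes w: "domain w" and j: "j < n + k"
  shows "((\<lambda>t. phi (w(j := t))) has_real_derivative grad j w) (at (w j))"
proof -
  have pos: "0 < F l w" if "l < k" for l using w that by (simp add: domain_def)
  have "((\<lambda>t. phi (w(j := t))) has_real_derivative - (\<Sum>l<k. 1 / F l w * dF l j w)) (at (w j))"
    unfolding phi_def
  proof (rule DERIV_minus, rule DERIV_sum)
    fix l assume "l \<in> {..<k}"
    then show "((\<lambda>t. ln (F l (w(j := t)))) has_real_derivative 1 / F l w * dF l j w) (at (w j))"
      using DERIV_chain2[OF _ deriv_F[of l w j], of ln "1 / F l w"] DERIV_ln_divide[of "F l w"] pos by simp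
  qed
  also have "- (\<Sum>l<k. 1 / F l w * dF l j w) = grad j w"
  proof (cases "j < n")
    case True
    then show ?thesis by (simp add: grad_def dF_def sum_negf)
  next
    case False
    have "(\<Sum>l<k. 1 / F l w * dF l j w) = (\<Sum>l<k. if l = j - n then 2 * w j / F (j - n) w else 0)"
      using False by (intro sum.cong) (auto simp: dF_def)
    also have "\<dots> = 2 * w j / F (j - n) w" using False j by (subst sum.delta) auto
    finally show ?thesis using False by (simp add: grad_def)
  qed
  finally show ?thesis .
qed

lemma deriv_grad:
  assumes w: "domain w" and i: "i < n + k" and j: "j < n + k"
  shows "((\<lambda>t. grad j (w(i := t))) has_real_derivative hess i j w) (at (w i))"
proof -
  have pos: "F l w \<noteq> 0" if "l < k" for l using w that by (force simp: domain_def)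
  show ?thesis
  proof (cases "j < n")
    case True
    let ?D = "\<lambda>l. (2 * (if i < n then L l j i else 0) * F l w - 2 * vf l w j * dF l i w) / (F l w * F l w)"
    have "((\<lambda>t. grad j (w(i := t))) has_real_derivative (\<Sum>l<k. ?D l)) (at (w i))"
      unfolding grad_def using True
    proof (simp, intro DERIV_sum)
      fix l assume "l \<in> {..<k}"
      then show "((\<lambda>t. 2 * vf l (w(i := t)) j / F l (w(i := t))) has_real_derivative ?D l) (at (w i))"
        using DERIV_divide[OF DERIV_cmult[OF deriv_vf[of l w i j "w i"], of 2] deriv_F[of l w i]] pos
        by (simp only: fun_upd_triv lessThan_iff not_False_eq_True)
    qed
    also have "(\<Sum>l<k. ?D l) = hess i j w"
    proof (cases "i < n")
      case i: True
      then show ?thesis using True pos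
        by (auto simp: hess_def dF_def power2_eq_square add_divide_distrib intro!: sum.cong)
    next
      case i: False
      have "(\<Sum>l<k. ?D l) = (\<Sum>l<k. if l = i - n then - 4 * w i * vf (i - n) w j / (F (i - n) w)\<^sup>2 else 0)"
        using i by (intro sum.cong) (auto simp: dF_def power2_eq_square)
      also have "\<dots> = - 4 * w i * vf (i - n) w j / (F (i - n) w)\<^sup>2"
        using i \<open>i < n + k\<close> by (subst sum.delta) auto
      finally show ?thesis using True i by (simp add: hess_def)
    qed
    finally show ?thesis .
  next
    case False
    then have l: "j - n < k" using j by auto
    have "((\<lambda>t. - 2 * (w(i := t)) j / F (j - n) (w(i := t))) has_real_derivative
        (- 2 * (if j = i then 1 else 0) * F (j - n) w - - 2 * w j * dF (j - n) i w) /
          (F (j - n) w * F (j - n) w)) (at (w i))"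
      using DERIV_divide[OF DERIV_cmult[OF deriv_coord[of w i j "w i"], of "- 2"] deriv_F[OF l, of w i]] pos[OF l]
      by (simp only: fun_upd_triv not_False_eq_True)
    also have "(- 2 * (if j = i then 1 else 0) * F (j - n) w - - 2 * w j * dF (j - n) i w) /
          (F (j - n) w * F (j - n) w) = hess i j w"
      using False pos[OF l]
      by (cases "i = j") (auto simp: hess_def dF_def power2_eq_square diff_divide_distrib)
    finally show ?thesis using False by (simp only: grad_def if_False)
  qed
qed

text \<open>\<open>grad\<close> is known to be the gradient only inside the domain; to differentiate
  it once more, this must hold in a neighbourhood on the coordinate line.\<close>

lemma domain_open:
  assumes "domain w"
  shows "eventually (\<lambda>t. domain (w(i := t))) (nhds (w i))"
proof -
  have "eventually (\<lambda>t. 0 < F l (w(i := t))) (nhds (w i))" if "l < k" for l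
  proof -
    have "isCont (\<lambda>t. F l (w(i := t))) (w i)" using DERIV_isCont[OF deriv_F[OF that]] .
    then have "((\<lambda>t. F l (w(i := t))) \<longlongrightarrow> F l (w(i := w i))) (nhds (w i))"
      using tendsto_at_iff_tendsto_nhds[of "\<lambda>t. F l (w(i := t))" "w i"] unfolding isCont_def by blast
    moreover have "0 < F l (w(i := w i))" using assms that by (simp only: domain_def fun_upd_triv)
    ultimately show ?thesis by (rule order_tendstoD(1))
  qed
  then have "eventually (\<lambda>t. \<forall>l\<in>{..<k}. 0 < F l (w(i := t))) (nhds (w i))"
    by (intro eventually_ball_finite) auto
  then show ?thesis by (simp add: domain_def lessThan_def)
qed

lemma partial_deriv_vec:
  "i < m \<Longrightarrow> partial_deriv i f (vec m w) = deriv (\<lambda>t. f (vec m (w(i := t)))) (w i)"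
proof -
  assume i: "i < m"
  have "vec (dim_vec (vec m w)) (\<lambda>j. if j = i then t else vec m w $ j) = vec m (w(i := t))" for t
    by (rule eq_vecI) auto
  then show ?thesis using i by (simp add: partial_deriv_def)
qed

lemma hessian_vec:
  assumes f: "\<And>u. f (vec (n + k) u) = phi u" and w: "domain w"
  shows "hessian f (vec (n + k) w) = mat (n + k) (n + k) (\<lambda>(i, j). hess i j w)"
proof -
  have g: "partial_deriv j f (vec (n + k) u) = grad j u" if "domain u" "j < n + k" for u j
    using DERIV_imp_deriv[OF deriv_phi[OF that]] that by (simp add: partial_deriv_vec f)
  have "partial_deriv i (partial_deriv j f) (vec (n + k) w) = hess i j w" if "i < n + k" "j < n + k" for i j
  proof -
    have "eventually (\<lambda>t. partial_deriv j f (vec (n + k) (w(i := t))) = grad j (w(i := t))) (nhds (w i))"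
      using domain_open[OF w] by eventually_elim (simp add: g that)
    then have "deriv (\<lambda>t. partial_deriv j f (vec (n + k) (w(i := t)))) (w i) = deriv (\<lambda>t. grad j (w(i := t))) (w i)"
      by (rule deriv_cong_ev) simp
    then show ?thesis using DERIV_imp_deriv[OF deriv_grad[OF w that]] that
      by (simp add: partial_deriv_vec)
  qed
  then show ?thesis by (intro eq_matI) (auto simp: hessian_def)
qed

end

section \<open>Elimination of the y-variables at a strictly feasible point\<close>

locale barrier_point = barrier_data +
  fixes w :: "nat \<Rightarrow> real"
  assumes y_pos: "\<And>l. l < k \<Longrightarrow> 0 < w (n + l)"
    and q_less: "\<And>l. l < k \<Longrightarrow> qf l w < (w (n + l))\<^sup>2"
begin

abbreviation f :: "nat \<Rightarrow> real" where "f l \<equiv> F l w"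
definition g :: "nat \<Rightarrow> real" where "g l = (w (n + l))\<^sup>2 + qf l w"
abbreviation v :: "nat \<Rightarrow> nat \<Rightarrow> real" where "v l \<equiv> vf l w"



lemma f_pos: "l < k \<Longrightarrow> 0 < f l" using q_less by (simp add: F_def)

lemma g_pos: "l < k \<Longrightarrow> 0 < g l"
  using y_pos[of l] qf_nonneg[of l] by (simp add: g_def add_pos_nonneg)

lemma domain_point: "domain w" using f_pos by (simp add: domain_def)

sublocale downdate n k L "\<lambda>l. 2 / f l" "\<lambda>l. 4 / (f l * g l)" "\<lambda>l. qf l w" "\<lambda>l c. w c - s l c" v
proof
  fix l assume l: "l < k"
  show "0 < 2 / f l" "0 < 4 / (f l * g l)" using f_pos[OF l] g_pos[OF l] by simp_all
  \<comment> \<open>Equivalent to \<open>2 * qf l w < g l\<close>, which is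
    \<open>q_less\<close>.\<close>
  show "4 / (f l * g l) * qf l w < 2 / f l"
    using f_pos[OF l] g_pos[OF l] q_less[OF l] by (simp add: divide_simps) (simp add: g_def)
qed (use psdL in \<open>auto simp: vf_def qf_def\<close>)

definition rhs :: "(nat \<Rightarrow> real) \<Rightarrow> nat \<Rightarrow> real" where
  "rhs b r = b r + (\<Sum>l<k. 2 * w (n + l) * b (n + l) / g l * v l r)"

definition ysol :: "(nat \<Rightarrow> real) \<Rightarrow> (nat \<Rightarrow> real) \<Rightarrow> nat \<Rightarrow> real" where
  "ysol b z l = (b (n + l) + 4 * w (n + l) / (f l)\<^sup>2 * ip n (v l) z) * (f l)\<^sup>2 / (2 * g l)"

lemma hess_row_y:
  assumes "l < k"
  shows "(\<Sum>j<n + k. hess (n + l) j w * z j) = b (n + l) \<longleftrightarrow> z (n + l) = ysol b z l"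
proof -
  have "(\<Sum>j<n + k. hess (n + l) j w * z j) =
      (\<Sum>j<n. - 4 * w (n + l) / (f l)\<^sup>2 * (v l j * z j)) +
      (\<Sum>m<k. if m = l then (- 2 / f l + 4 * (w (n + l))\<^sup>2 / (f l)\<^sup>2) * z (n + l) else 0)"
    unfolding sum_lessThan_add by (intro arg_cong2[where f = "(+)"] sum.cong) (auto simp: hess_def)
  also have "\<dots> = - 4 * w (n + l) / (f l)\<^sup>2 * ip n (v l) z + (- 2 / f l + 4 * (w (n + l))\<^sup>2 / (f l)\<^sup>2) * z (n + l)"
    using assms by (subst sum.delta) (auto simp: ip_def sum_distrib_left)
  \<comment> \<open>Because \<open>2 * (w (n + l))\<^sup>2 - f l = g l\<close>; so the pivot is
    positive.\<close>
  also have "- 2 / f l + 4 * (w (n + l))\<^sup>2 / (f l)\<^sup>2 = 2 * g l / (f l)\<^sup>2"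
  proof -
    have "2 * g l = - 2 * f l + 4 * (w (n + l))\<^sup>2" by (simp add: g_def F_def)
    then show ?thesis using f_pos[OF assms] by (simp add: power2_eq_square diff_divide_distrib)
  qed
  finally have row: "(\<Sum>j<n + k. hess (n + l) j w * z j) =
    2 * g l / (f l)\<^sup>2 * z (n + l) - 4 * w (n + l) / (f l)\<^sup>2 * ip n (v l) z" by simp
  have solve: "A * Z - B = \<beta> \<longleftrightarrow> Z = (\<beta> + B) / A" if "A > 0" for A Z B \<beta> :: real
  proof -
    have "A * Z - B = \<beta> \<longleftrightarrow> Z * A = \<beta> + B" by (auto simp: mult.commute)
    then show ?thesis using that by (simp add: eq_divide_eq)
  qed
  have "0 < 2 * g l / (f l)\<^sup>2" using f_pos[OF assms] g_pos[OF assms] by simp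
  moreover have "ysol b z l = (b (n + l) + 4 * w (n + l) / (f l)\<^sup>2 * ip n (v l) z) / (2 * g l / (f l)\<^sup>2)"
    by (simp add: ysol_def)
  ultimately show ?thesis unfolding row by (simp only: solve)
qed

text \<open>Substituting \<open>ysol\<close> turns the coefficient \<open>4 / f\<^sup>2\<close> of
  the rank one term into \<open>4 / f\<^sup>2 * (1 - 2 * y\<^sup>2 / g)\<close>. As
  \<open>g - 2 * y\<^sup>2 = - f\<close>, this is \<open>- 4 / (f * g)\<close>: the sign changes,
  which is why the updates are downdates.\<close>

lemma hess_row_x:
  assumes i: "i < n" and y: "\<And>l. l < k \<Longrightarrow> z (n + l) = ysol b z l"
  shows "(\<Sum>j<n + k. hess i j w * z j) = b i \<longleftrightarrow> mv n (S k) z i = rhs b i"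
proof -
  have "(\<Sum>j<n + k. hess i j w * z j) =
      (\<Sum>j<n. \<Sum>l<k. 2 / f l * L l j i * z j + 4 / (f l)\<^sup>2 * v l i * (v l j * z j)) +
      (\<Sum>l<k. - 4 * w (n + l) * v l i / (f l)\<^sup>2 * z (n + l))"
    unfolding sum_lessThan_add using i
    by (intro arg_cong2[where f = "(+)"] sum.cong) (auto simp: hess_def sum_distrib_left distrib_left mult_ac intro!: sum.cong)
  also have "(\<Sum>j<n. \<Sum>l<k. 2 / f l * L l j i * z j + 4 / (f l)\<^sup>2 * v l i * (v l j * z j)) =
      (\<Sum>l<k. 2 / f l * mv n (L l) z i + 4 / (f l)\<^sup>2 * v l i * ip n (v l) z)"
    using psdL i by (subst sum.swap)
      (auto simp: sum.distrib sum_distrib_left mv_def ip_def psd_def symm_def mult.assoc intro!: sum.cong)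
  also have "\<dots> = mv n M z i + (\<Sum>l<k. 4 / (f l)\<^sup>2 * v l i * ip n (v l) z)"
    by (simp add: sum.distrib mv_M)
  also have "\<dots> + (\<Sum>l<k. - 4 * w (n + l) * v l i / (f l)\<^sup>2 * z (n + l)) = mv n M z i +
      (\<Sum>l<k. (4 / (f l)\<^sup>2 * ip n (v l) z - 4 * w (n + l) / (f l)\<^sup>2 * z (n + l)) * v l i)"
    unfolding add.assoc sum.distrib[symmetric]
    by (simp add: left_diff_distrib right_diff_distrib mult_ac)
  also have "\<dots> = mv n M z i + (\<Sum>l<k. - (4 / (f l * g l) * ip n (v l) z * v l i) -
      2 * w (n + l) * b (n + l) / g l * v l i)"
  proof (intro arg_cong2[where f = "(+)"] sum.cong refl)
    fix l assume "l \<in> {..<k}"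
    then have l: "l < k" by simp
    let ?a = "ip n (v l) z" and ?y = "w (n + l)"
    have "4 / (f l)\<^sup>2 * ?a - 4 * ?y / (f l)\<^sup>2 * z (n + l) =
        4 / (f l)\<^sup>2 * ?a * (g l - 2 * ?y\<^sup>2) / g l - 2 * ?y * b (n + l) / g l"
    proof -
      have "z (n + l) = b (n + l) * (f l)\<^sup>2 / (2 * g l) + 2 * ?y * ?a / g l"
        using f_pos[OF l] unfolding y[OF l] ysol_def by (simp add: distrib_right add_divide_distrib)
      then have "4 * ?y / (f l)\<^sup>2 * z (n + l) = 2 * ?y * b (n + l) / g l + 4 / (f l)\<^sup>2 * ?a * (2 * ?y\<^sup>2 / g l)"
        using f_pos[OF l] by (simp add: distrib_left power2_eq_square mult_ac)
      moreover have "(g l - 2 * ?y\<^sup>2) / g l = 1 - 2 * ?y\<^sup>2 / g l"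
        using g_pos[OF l] by (simp add: diff_divide_distrib)
      moreover have "4 / (f l)\<^sup>2 * ?a * (g l - 2 * ?y\<^sup>2) / g l = 4 / (f l)\<^sup>2 * ?a * ((g l - 2 * ?y\<^sup>2) / g l)"
        by simp
      ultimately show ?thesis by (simp only: right_diff_distrib mult_1_right)
    qed
    also have "g l - 2 * ?y\<^sup>2 = - f l" by (simp add: g_def F_def)
    also have "4 / (f l)\<^sup>2 * ?a * (- f l) / g l = - (4 / (f l * g l) * ?a)"
      using f_pos[OF l] by (simp add: power2_eq_square)
    finally show "(4 / (f l)\<^sup>2 * ?a - 4 * ?y / (f l)\<^sup>2 * z (n + l)) * v l i =
        - (4 / (f l * g l) * ?a * v l i) - 2 * ?y * b (n + l) / g l * v l i"
      by (simp only: left_diff_distrib minus_mult_left)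
  qed
  also have "\<dots> = mv n (S k) z i - (\<Sum>l<k. 2 * w (n + l) * b (n + l) / g l * v l i)"
    by (simp add: mv_S sum_subtractf sum_negf)
  finally show ?thesis by (auto simp: rhs_def)
qed

text \<open>Read from left to right it shows that the reduced system is solvable, from right to left
  that the output is correct.\<close>

lemma hess_system:
  "(\<forall>i<n + k. (\<Sum>j<n + k. hess i j w * z j) = b i) \<longleftrightarrow>
   (\<forall>i<n. mv n (S k) z i = rhs b i) \<and> (\<forall>l<k. z (n + l) = ysol b z l)" (is "?l \<longleftrightarrow> ?r")
proof -
  have "?l \<longleftrightarrow> (\<forall>i<n. (\<Sum>j<n + k. hess i j w * z j) = b i) \<and> (\<forall>l<k. z (n + l) = ysol b z l)"
    unfolding all_less_add using hess_row_y by blast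
  then show ?thesis using hess_row_x by auto
qed

end

section \<open>The algorithm\<close>

lemma runs_Seq_agree:
  assumes "runs P c s t Q1" "\<And>s'. Q1 s' \<Longrightarrow> agree c s s' \<Longrightarrow> runs P d s' u Q" "t + u \<le> T"
  shows "runs P (Seq c d) s T Q"
  using assms by (intro runs_Seq[OF runs_mono[OF runs_agree[OF assms(1)]]]) auto

abbreviation "z0 \<equiv> IConst 0"
abbreviation "Iv \<equiv> ivar 3"
abbreviation "Jv \<equiv> ivar 4"
abbreviation "Xv \<equiv> ivar 5"
abbreviation "Nv \<equiv> IRead 0 z0 z0"
abbreviation "Kv \<equiv> IRead 0 z0 (IConst 1)"
abbreviation "Lenv \<equiv> IRead 0 (IConst 1) Iv"
abbreviation "Rv \<equiv> IRead 1 Iv Jv"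
abbreviation "Cv \<equiv> IRead 2 Iv Jv"

text \<open>
  Beyond the input and the output, the index arrays are: 3, 4 and 10 loop counters, 5 the number of
  entries found, 6 the marks of the entries found, 7 their positions. The real arrays are: 4 the
  vectors \<open>v i\<close> and (row \<open>k\<close>) the reduced right-hand side, 5 the numbers \<open>f\<close>, \<open>g\<close>, \<open>q\<close> (rows 0, 1, 2),
  6 the solutions, 7 the dense matrix \<open>M\<close>, 8 its nonzero entries, 9 scalar products. A dense matrix
  costs nothing, since arrays are initially zero and only the positions listed in the input are touched.
\<close>

definition vec_com :: com where
  "vec_com = for_loop 4 Lenv (RWrite 4 Iv Rv (RAdd (RRead 4 Iv Rv)
     (RMul (RRead 0 Iv Jv) (RSub (RRead 2 z0 Cv) (RRead 1 Iv Cv)))))"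

definition q_com :: com where
  "q_com = for_loop 4 Nv (RWrite 5 (IConst 2) Iv (RAdd (RRead 5 (IConst 2) Iv)
     (RMul (RSub (RRead 2 z0 Jv) (RRead 1 Iv Jv)) (RRead 4 Iv Jv))))"

abbreviation "Yv \<equiv> RRead 2 (IConst 1) Iv"

definition fg_com :: com where
  "fg_com = Seq (RWrite 5 z0 Iv (RSub (RMul Yv Yv) (RRead 5 (IConst 2) Iv)))
     (RWrite 5 (IConst 1) Iv (RAdd (RMul Yv Yv) (RRead 5 (IConst 2) Iv)))"

definition acc_com :: com where
  "acc_com = for_loop 4 Lenv (RWrite 7 Rv Cv (RAdd (RRead 7 Rv Cv)
     (RMul (RDiv (RConst 2) (RRead 5 z0 Iv)) (RRead 0 Iv Jv))))"

definition rhs_com :: com where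
  "rhs_com = for_loop 4 Nv (RWrite 4 Kv Jv (RAdd (RRead 4 Kv Jv)
     (RMul (RDiv (RMul (RMul (RConst 2) Yv) (RRead 2 (IConst 2) (IAdd Nv Iv))) (RRead 5 (IConst 1) Iv))
       (RRead 4 Iv Jv))))"

definition init_com :: com where
  "init_com = for_loop 4 Nv (RWrite 4 Kv Jv (RRead 2 (IConst 2) Jv))"

definition setup_com :: com where
  "setup_com = Seq init_com (for_loop 3 Kv
     (Seq vec_com (Seq q_com (Seq fg_com (Seq acc_com rhs_com)))))"

lemma writes_setup [simp]:
  "iwrites vec_com = {4}" "rwrites vec_com = {4}"
  "iwrites q_com = {4}" "rwrites q_com = {5}"
  "iwrites fg_com = {}" "rwrites fg_com = {5}"
  "iwrites acc_com = {4}" "rwrites acc_com = {7}"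
  "iwrites rhs_com = {4}" "rwrites rhs_com = {4}"
  "iwrites init_com = {4}" "rwrites init_com = {4}"
  "iwrites setup_com = {3, 4}" "rwrites setup_com = {4, 5, 7}"
  by (auto simp: vec_com_def q_com_def fg_com_def acc_com_def rhs_com_def init_com_def setup_com_def)

text \<open>The program is analysed on arbitrary array contents; that they encode matrices and
  vectors enters only in \<open>hessian_instance\<close>.\<close>

locale solver_input =
  fixes P :: program and n k :: nat and len :: "nat \<Rightarrow> nat" and R C :: "nat array"
    and A sa xyb :: "real array"
begin

definition inp :: "store \<Rightarrow> bool" where
  "inp s \<longleftrightarrow> fst s 0 0 0 = n \<and> fst s 0 0 1 = k \<and> (\<forall>i<k. fst s 0 1 i = len i) \<and>
     fst s 1 = R \<and> fst s 2 = C \<and> snd s 0 = A \<and> snd s 1 = sa \<and> snd s 2 = xyb"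

lemma inpD: "inp s \<Longrightarrow> fst s 0 0 0 = n" "inp s \<Longrightarrow> fst s 0 0 (Suc 0) = k"
  "inp s \<Longrightarrow> i < k \<Longrightarrow> fst s 0 (Suc 0) i = len i"
  "inp s \<Longrightarrow> fst s (Suc 0) = R" "inp s \<Longrightarrow> fst s 2 = C" "inp s \<Longrightarrow> snd s 0 = A"
  "inp s \<Longrightarrow> snd s (Suc 0) = sa" "inp s \<Longrightarrow> snd s 2 = xyb"
  by (auto simp: inp_def)

lemma inp_agree:
  "agree c s s' \<Longrightarrow> inp s \<Longrightarrow> iwrites c \<inter> {0, 1, 2} = {} \<Longrightarrow> rwrites c \<inter> {0, 1, 2} = {} \<Longrightarrow> inp s'"
  unfolding inp_def agree_def by (metis disjoint_iff insertCI)

text \<open>What the first \<open>m\<close> listed entries contribute. Repeated positions would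
  simply add up; that there are none matters only when \<open>vv\<close> is compared with the true
  vector.\<close>

definition v0 :: "nat \<Rightarrow> nat \<Rightarrow> nat \<Rightarrow> real" where
  "v0 m i r = (\<Sum>e<m. if R i e = r then A i e * (xyb 0 (C i e) - sa i (C i e)) else 0)"

definition "vv i = v0 (len i) i"

definition qq :: "nat \<Rightarrow> real" where
  "qq i = (\<Sum>r<n. (xyb 0 r - sa i r) * vv i r)"

definition ff :: "nat \<Rightarrow> real" where "ff i = (xyb 1 i)\<^sup>2 - qq i"
definition gg :: "nat \<Rightarrow> real" where "gg i = (xyb 1 i)\<^sup>2 + qq i"

definition M0 :: "nat \<Rightarrow> nat \<Rightarrow> nat \<Rightarrow> nat \<Rightarrow> real" where
  "M0 m i r c = (\<Sum>e<m. if R i e = r \<and> C i e = c then 2 / ff i * A i e else 0)"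

definition MM :: "nat \<Rightarrow> nat \<Rightarrow> nat \<Rightarrow> real" where
  "MM m r c = (\<Sum>i<m. M0 (len i) i r c)"

text \<open>Zero from \<open>n\<close> on, like the cells of the array that are never written, so
  that whole rows can be compared as functions.\<close>

definition cc :: "nat \<Rightarrow> nat \<Rightarrow> real" where
  "cc m r = (if r < n then xyb 2 r + (\<Sum>i<m. 2 * xyb 1 i * xyb 2 (n + i) / gg i * vv i r) else 0)"

text \<open>An iteration takes at most 100 steps for the body and 20 for the loop. Here and below
  the constants are rounded up generously.\<close>

lemma runs_vec:
  assumes "inp s" "fst s 3 0 0 = i" "i < k"
  shows "runs P vec_com s (30 + 130 * len i) (\<lambda>s'. snd s' 4 = (snd s 4)(i := \<lambda>r. snd s 4 i r + vv i r))"
  unfolding vec_com_def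
proof (rule runs_for_frame[where m = "len i" and t = "\<lambda>_. 100"
      and I = "\<lambda>e s'. snd s' 4 = (snd s 4)(i := \<lambda>r. snd s 4 i r + v0 e i r)"], goal_cases)
  case (4 e s')
  then show ?case using assms inp_agree[OF 4(4) assms(1)]
    by (auto simp: agree_def inpD v0_def fun_eq_iff)
qed (use assms in \<open>auto simp: v0_def vv_def inpD agree_def\<close>)

lemma runs_q:
  assumes "inp s" "fst s 3 0 0 = i" "i < k" "snd s 4 i = vv i"
  shows "runs P q_com s (30 + 130 * n) (\<lambda>s'. snd s' 5 = (snd s 5)(2 := (snd s 5 2)(i := snd s 5 2 i + qq i)))"
  unfolding q_com_def
proof (rule runs_for_frame[where m = n and t = "\<lambda>_. 100"
      and I = "\<lambda>e s'. snd s' 5 = (snd s 5)(2 := (snd s 5 2)(i := snd s 5 2 i + (\<Sum>r<e. (xyb 0 r - sa i r) * vv i r)))"],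
    goal_cases)
  case (4 e s')
  then show ?case using assms inp_agree[OF 4(4) assms(1)]
    by (auto simp: agree_def inpD fun_eq_iff)
qed (use assms in \<open>auto simp: qq_def inpD agree_def\<close>)

lemma runs_fg:
  assumes "inp s" "fst s 3 0 0 = i" "i < k" "snd s 5 2 i = qq i"
  shows "runs P fg_com s 100 (\<lambda>s'. snd s' 5 = (snd s 5)(0 := (snd s 5 0)(i := ff i), 1 := (snd s 5 1)(i := gg i)))"
  unfolding fg_com_def using assms by (auto simp: inpD ff_def gg_def power2_eq_square fun_eq_iff)

lemma runs_acc:
  assumes "inp s" "fst s 3 0 0 = i" "i < k" "snd s 5 0 i = ff i"
  shows "runs P acc_com s (30 + 130 * len i) (\<lambda>s'. snd s' 7 = (\<lambda>r c. snd s 7 r c + M0 (len i) i r c))"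
  unfolding acc_com_def
proof (rule runs_for_frame[where m = "len i" and t = "\<lambda>_. 100"
      and I = "\<lambda>e s'. snd s' 7 = (\<lambda>r c. snd s 7 r c + M0 e i r c)"], goal_cases)
  case (4 e s')
  then show ?case using assms inp_agree[OF 4(4) assms(1)]
    by (auto simp: agree_def inpD M0_def fun_eq_iff)
qed (use assms in \<open>auto simp: M0_def inpD agree_def\<close>)

lemma runs_rhs:
  assumes "inp s" "fst s 3 0 0 = i" "i < k" "snd s 5 1 i = gg i" "snd s 4 i = vv i" "snd s 4 k = cc i"
  shows "runs P rhs_com s (30 + 130 * n) (\<lambda>s'. snd s' 4 = (snd s 4)(k := cc (Suc i)))"
  unfolding rhs_com_def
proof (rule runs_for_frame[where m = n and t = "\<lambda>_. 100"
      and I = "\<lambda>e s'. snd s' 4 = (snd s 4)(k := \<lambda>r. if r < e then cc (Suc i) r else cc i r)"], goal_cases)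
  case (4 e s')
  then show ?case using assms inp_agree[OF 4(4) assms(1)]
    by (auto simp: agree_def inpD cc_def fun_eq_iff less_Suc_eq)
next
  case (5 s')
  then show ?case using assms by (auto simp: fun_eq_iff cc_def)
qed (use assms in \<open>auto simp: inpD agree_def fun_eq_iff\<close>)

lemma runs_init:
  assumes "inp s" "snd s 4 = (\<lambda>_ _. 0)"
  shows "runs P init_com s (30 + 130 * n) (\<lambda>s'. snd s' 4 = (\<lambda>_ _. 0)(k := cc 0))"
  unfolding init_com_def
proof (rule runs_for_frame[where m = n and t = "\<lambda>_. 100"
      and I = "\<lambda>e s'. snd s' 4 = (\<lambda>_ _. 0)(k := \<lambda>r. if r < e then cc 0 r else 0)"], goal_cases)
  case (4 e s')
  then show ?case using assms inp_agree[OF 4(4) assms(1)]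
    by (auto simp: agree_def inpD cc_def fun_eq_iff less_Suc_eq)
next
  case (5 s')
  then show ?case using assms by (auto simp: fun_eq_iff cc_def)
qed (use assms in \<open>auto simp: inpD agree_def fun_eq_iff\<close>)

text \<open>Array 4 after \<open>m\<close> iterations. With the reduced right-hand side in row
  \<open>k\<close>, a single loop can solve all \<open>k + 1\<close> systems.\<close>

definition V :: "nat \<Rightarrow> nat \<Rightarrow> nat \<Rightarrow> real" where
  "V m a = (if a < m then vv a else if a = k then cc m else (\<lambda>_. 0))"

definition par :: "nat \<Rightarrow> nat \<Rightarrow> nat \<Rightarrow> real" where
  "par m a l = (if l < m then if a = 0 then ff l else if a = 1 then gg l else if a = 2 then qq l else 0 else 0)"

lemma runs_setup:
  assumes "inp s" "snd s 4 = (\<lambda>_ _. 0)" "snd s 5 = (\<lambda>_ _. 0)" "snd s 7 = (\<lambda>_ _. 0)"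
  shows "runs P setup_com s (100 + 130 * n + (\<Sum>i<k. 500 + 260 * n + 260 * len i))
    (\<lambda>s'. snd s' 4 = V k \<and> snd s' 5 = par k \<and> snd s' 7 = MM k)"
  unfolding setup_com_def
proof (rule runs_Seq_agree[OF runs_init])
  fix s1 assume s1: "snd s1 4 = (\<lambda>_ _. 0)(k := cc 0)" "agree init_com s s1"
  have inp1: "inp s1" using s1(2) assms(1) by (rule inp_agree) auto
  show "runs P (for_loop 3 Kv (Seq vec_com (Seq q_com (Seq fg_com (Seq acc_com rhs_com))))) s1
    (20 + (\<Sum>i<k. 500 + 260 * n + 260 * len i)) (\<lambda>s'. snd s' 4 = V k \<and> snd s' 5 = par k \<and> snd s' 7 = MM k)"
  proof (rule runs_for_frame[where m = k and t = "\<lambda>i. 400 + 260 * n + 260 * len i"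
      and I = "\<lambda>i s'. snd s' 4 = V i \<and> snd s' 5 = par i \<and> snd s' 7 = MM i"], goal_cases)
    case 2
    then show ?case using s1 assms by (auto simp: V_def par_def MM_def fun_eq_iff agree_def)
  next
    case (4 i s2)
    have inp2: "inp s2" using 4(4) inp1 by (rule inp_agree) auto
    show ?case
    proof (rule runs_Seq_agree[OF runs_vec[OF inp2 4(3,1)]])
      fix s3 assume s3: "snd s3 4 = (snd s2 4)(i := \<lambda>r. snd s2 4 i r + vv i r)" "agree vec_com s2 s3"
      have inp3: "inp s3" using s3(2) inp2 by (rule inp_agree) auto
      have i3: "fst s3 3 0 0 = i" using s3(2) 4 by (simp add: agree_def)
      have v3: "snd s3 4 i = vv i" using s3(1) 4 by (simp add: V_def)
      show "runs P (Seq q_com (Seq fg_com (Seq acc_com rhs_com))) s3 (300 + 260 * n + 130 * len i)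
        (\<lambda>s'. snd (iset 3 (Suc i) s') 4 = V (Suc i) \<and> snd (iset 3 (Suc i) s') 5 = par (Suc i) \<and>
          snd (iset 3 (Suc i) s') 7 = MM (Suc i))"
      proof (rule runs_Seq_agree[OF runs_q[OF inp3 i3 4(1) v3]])
        fix s4 assume s4: "snd s4 5 = (snd s3 5)(2 := (snd s3 5 2)(i := snd s3 5 2 i + qq i))" "agree q_com s3 s4"
        have inp4: "inp s4" using s4(2) inp3 by (rule inp_agree) auto
        have i4: "fst s4 3 0 0 = i" using s4(2) i3 by (simp add: agree_def)
        have v4: "snd s4 5 2 i = qq i" using s4(1) s3(2) 4(2) by (simp add: par_def agree_def)
        show "runs P (Seq fg_com (Seq acc_com rhs_com)) s4 (200 + 130 * n + 130 * len i)
          (\<lambda>s'. snd (iset 3 (Suc i) s') 4 = V (Suc i) \<and> snd (iset 3 (Suc i) s') 5 = par (Suc i) \<and>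
            snd (iset 3 (Suc i) s') 7 = MM (Suc i))"
        proof (rule runs_Seq_agree[OF runs_fg[OF inp4 i4 4(1) v4]])
          fix s5 assume s5: "snd s5 5 = (snd s4 5)(0 := (snd s4 5 0)(i := ff i), 1 := (snd s4 5 1)(i := gg i))"
            "agree fg_com s4 s5"
          have inp5: "inp s5" using s5(2) inp4 by (rule inp_agree) auto
          have i5: "fst s5 3 0 0 = i" using s5(2) i4 by (simp add: agree_def)
          have f5: "snd s5 5 0 i = ff i" using s5(1) by simp
          show "runs P (Seq acc_com rhs_com) s5 (100 + 130 * n + 130 * len i)
            (\<lambda>s'. snd (iset 3 (Suc i) s') 4 = V (Suc i) \<and> snd (iset 3 (Suc i) s') 5 = par (Suc i) \<and>
              snd (iset 3 (Suc i) s') 7 = MM (Suc i))"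
          proof (rule runs_Seq_agree[OF runs_acc[OF inp5 i5 4(1) f5]])
            fix s6 assume s6: "snd s6 7 = (\<lambda>r c. snd s5 7 r c + M0 (len i) i r c)" "agree acc_com s5 s6"
            have inp6: "inp s6" using s6(2) inp5 by (rule inp_agree) auto
            have i6: "fst s6 3 0 0 = i" using s6(2) i5 by (simp add: agree_def)
            have five: "snd s6 5 = par (Suc i)"
              using s6(2) s5(1) s4(1) s3(2) 4(2) by (auto simp: agree_def par_def fun_eq_iff less_Suc_eq)
            have seven: "snd s6 7 = MM (Suc i)"
              using s6(1) s5(2) s4(2) s3(2) 4(2) by (auto simp: agree_def MM_def fun_eq_iff)
            \<comment> \<open>Row \<open>k\<close> still holds \<open>cc i\<close>; only
              \<open>rhs_com\<close> completes this to \<open>V (Suc i)\<close>.\<close>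
            have four: "snd s6 4 = (V i)(i := vv i)"
              using s6(2) s5(2) s4(2) s3(1) 4(1,2) by (auto simp: agree_def V_def fun_eq_iff)
            have "snd s6 5 1 i = gg i" "snd s6 4 i = vv i" "snd s6 4 k = cc i"
              using five four 4(1) by (simp_all add: par_def V_def)
            from runs_rhs[OF inp6 i6 4(1) this]
            show "runs P rhs_com s6 (30 + 130 * n)
              (\<lambda>s'. snd (iset 3 (Suc i) s') 4 = V (Suc i) \<and> snd (iset 3 (Suc i) s') 5 = par (Suc i) \<and>
                snd (iset 3 (Suc i) s') 7 = MM (Suc i))"
              using five seven four 4(1)
              by (elim runs_agree[THEN runs_mono]) (auto simp: agree_def V_def fun_eq_iff less_Suc_eq)
          qed simp
        qed simp
      qed simp
    qed simp
  next
    case (3 i s2)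
    then show ?case using inp_agree[OF 3(4) inp1] by (simp add: inpD)
  next
    case 6
    show ?case by (simp, rule trans_le_add2, rule sum_mono, simp)
  qed auto
qed (use assms in auto)

end

text \<open>Several \<open>L i\<close> may contribute to one position, and the contributions may
  cancel, whereas the solver expects each nonzero entry once: hence the marks and the test against
  0, which takes two comparisons because equality is not primitive.\<close>

definition list_body :: com where
  "list_body = If (BAnd (ILess (IRead 6 Rv Cv) (IConst 1))
       (BNot (BAnd (BNot (RLess (RRead 7 Rv Cv) (RConst 0))) (BNot (RLess (RConst 0) (RRead 7 Rv Cv))))))
     (Seq (IWrite 7 z0 Xv Rv) (Seq (IWrite 7 (IConst 1) Xv Cv) (Seq (RWrite 8 z0 Xv (RRead 7 Rv Cv))
       (Seq (IWrite 6 Rv Cv (IConst 1)) (IWrite 5 z0 z0 (IAdd Xv (IConst 1)))))))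
     Skip"

definition list_com :: com where
  "list_com = for_loop 3 Kv (for_loop 4 Lenv list_body)"

lemma writes_list [simp]:
  "iwrites list_body = {5, 6, 7}" "rwrites list_body = {8}"
  "iwrites list_com = {3, 4, 5, 6, 7}" "rwrites list_com = {8}"
  by (auto simp: list_body_def list_com_def)

definition entries_stored :: "(nat \<Rightarrow> nat \<Rightarrow> real) \<Rightarrow> (nat \<times> nat) list \<Rightarrow> store \<Rightarrow> bool" where
  "entries_stored M es s \<longleftrightarrow> fst s 5 0 0 = length es \<and>
     (\<forall>j<length es. fst s 7 0 j = fst (es ! j) \<and> fst s 7 1 j = snd (es ! j) \<and>
        snd s 8 0 j = M (fst (es ! j)) (snd (es ! j)))"

context solver_input
begin

definition visited :: "nat \<Rightarrow> nat \<Rightarrow> (nat \<times> nat) set" where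
  "visited i e = {(R i' e', C i' e') | i' e'. i' < i \<and> e' < len i' \<or> i' = i \<and> e' < e}"

lemma visited_0: "visited 0 0 = {}" "visited (Suc i) 0 = visited i (len i)"
  by (auto simp: visited_def less_Suc_eq)

lemma visited_Suc: "visited i (Suc e) = insert (R i e, C i e) (visited i e)"
  by (auto simp: visited_def less_Suc_eq)

text \<open>The list is existential: its order depends on the input, and the solver accepts every
  order.\<close>

definition list_inv :: "(nat \<Rightarrow> nat \<Rightarrow> real) \<Rightarrow> (nat \<times> nat) set \<Rightarrow> store \<Rightarrow> bool" where
  "list_inv M Z s \<longleftrightarrow> (\<exists>es. distinct es \<and> set es = {(r, c) \<in> Z. M r c \<noteq> 0} \<and> entries_stored M es s \<and>
     fst s 6 = (\<lambda>r c. if (r, c) \<in> set es then 1 else 0))"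

lemma runs_list_body:
  assumes "inp s" "fst s 3 0 0 = i" "fst s 4 0 0 = e" "snd s 7 = M" "list_inv M Z s"
  shows "runs P list_body s 200 (list_inv M (insert (R i e, C i e) Z))"
proof -
  obtain es where es: "distinct es" "set es = {(r, c) \<in> Z. M r c \<noteq> 0}" "entries_stored M es s"
    "fst s 6 = (\<lambda>r c. if (r, c) \<in> set es then 1 else 0)"
    using assms(5) unfolding list_inv_def by blast
  show ?thesis unfolding list_body_def
  proof (rule runs_If[where u = 100], goal_cases)
    case 1
    then have new: "(R i e, C i e) \<notin> set es" "M (R i e) (C i e) \<noteq> 0"
      using assms es(4) by (auto simp: inpD split: if_splits)
    let ?es = "es @ [(R i e, C i e)]"
    have "distinct ?es" "set ?es = {(r, c) \<in> insert (R i e, C i e) Z. M r c \<noteq> 0}"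
      using es new by auto
    note new_es = this
    show ?case using assms es(3,4)
      by (simp add: list_inv_def inpD entries_stored_def, intro exI[of _ ?es] conjI)
        (use new_es in \<open>auto simp: nth_append less_Suc_eq fun_eq_iff\<close>)
  next
    case 2
    then have "(R i e, C i e) \<in> set es \<or> M (R i e) (C i e) = 0"
      using assms es(4) by (auto simp: inpD split: if_splits)
    then have "set es = {(r, c) \<in> insert (R i e, C i e) Z. M r c \<noteq> 0}" using es(2) by auto
    then show ?case using es by (auto simp: list_inv_def)
  qed simp
qed

lemma list_inv_iset [simp]: "v \<notin> {5, 6, 7} \<Longrightarrow> list_inv M Z (iset v x s) = list_inv M Z s"
  by (simp add: list_inv_def entries_stored_def)

lemma runs_list:
  assumes "inp s" "snd s 7 = M" "fst s 5 = (\<lambda>_ _. 0)" "fst s 6 = (\<lambda>_ _. 0)"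
  shows "runs P list_com s (20 + (\<Sum>i<k. 100 + 230 * len i)) (list_inv M (visited k 0))"
  unfolding list_com_def
proof (rule runs_for_frame[where m = k and t = "\<lambda>i. 60 + 230 * len i"
      and I = "\<lambda>i. list_inv M (visited i 0)"], goal_cases)
  case 2
  then show ?case using assms by (auto simp: list_inv_def visited_0 entries_stored_def)
next
  case (3 i s1)
  then show ?case using inp_agree[OF 3(4) assms(1)] by (simp add: inpD)
next
  case (4 i s1)
  have inp1: "inp s1" using 4(4) assms(1) by (rule inp_agree) auto
  show ?case
  proof (rule runs_for_frame[where m = "len i" and t = "\<lambda>_. 200"
      and I = "\<lambda>e. list_inv M (visited i e)"], goal_cases)
    case (3 e s2)
    have "inp s2" using 3(4) inp1 by (rule inp_agree) auto
    moreover have "fst s2 3 0 0 = i" using 3(4) 4(3) by (simp add: agree_def)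
    ultimately show ?case using 4(1) by (simp add: inpD)
  next
    case (4 e s2)
    have "inp s2" using 4(4) inp1 by (rule inp_agree) auto
    moreover have "fst s2 3 0 0 = i" "snd s2 7 = M"
      using 4 \<open>fst s1 3 0 0 = i\<close> \<open>agree _ s s1\<close> assms(2) by (auto simp: agree_def)
    ultimately show ?case using runs_list_body[of s2 i e M "visited i e"] 4 by (simp add: visited_Suc)
  qed (use 4 in \<open>auto simp: visited_0\<close>)
next
  case 6
  show ?case by (simp, rule trans_le_add2, rule sum_mono, simp)
qed auto

end

text \<open>
  The given solver may destroy its arguments, so it is called from a procedure that first copies
  the system into fresh arrays.
\<close>

definition solve_com :: com where
  "solve_com =
    Seq (IWrite 4 z0 z0 Nv) (Seq (IWrite 4 z0 (IConst 1) (ivar 1))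
    (Seq (for_loop 6 (ivar 1) (Seq (IWrite 5 z0 (ivar 6) (IRead 2 z0 (ivar 6)))
        (Seq (IWrite 5 (IConst 1) (ivar 6) (IRead 2 (IConst 1) (ivar 6)))
          (RWrite 3 z0 (ivar 6) (RRead 0 z0 (ivar 6))))))
    (Seq (for_loop 6 Nv (RWrite 3 (IConst 1) (ivar 6) (RRead 1 Iv (ivar 6))))
    (Seq (Call 2 [4, 5] [3, 4])
      (for_loop 6 Nv (RWrite 2 Iv (ivar 6) (RRead 4 z0 (ivar 6))))))))"

lemma writes_solve [simp]: "iwrites solve_com = {4, 5, 6}" "rwrites solve_com = {2, 3, 4}"
  by (auto simp: solve_com_def)

text \<open>The store that \<open>system_input\<close> produces, see
  \<open>system_input_store\<close>. It has to be matched exactly, zeros included, since nothing is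
  known about the given program on other stores.\<close>

definition solver_store :: "nat \<Rightarrow> (nat \<times> nat) list \<Rightarrow> (nat \<Rightarrow> nat \<Rightarrow> real) \<Rightarrow> (nat \<Rightarrow> real) \<Rightarrow> store" where
  "solver_store n es M b =
    (\<lambda>a i j. if a = 0 then if i = 0 then if j = 0 then n else if j = 1 then length es else 0 else 0
       else if a = 1 \<and> j < length es then if i = 0 then fst (es ! j) else if i = 1 then snd (es ! j) else 0
       else 0,
     \<lambda>a i j. if a = 0 then if i = 0 then if j < length es then M (fst (es ! j)) (snd (es ! j)) else 0
         else if i = 1 then if j < n then b j else 0 else 0
       else 0)"

lemma runs_solve:
  assumes P: "2 < length P" and c: "runs P (P ! 2) (solver_store n es M b) t (\<lambda>s'. Q (snd s' 1 0))"
    and s: "fst s 0 0 0 = n" "fst s 1 0 0 = length es" "fst s 3 0 0 = l"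
    "\<And>j. j < length es \<Longrightarrow> fst s 2 0 j = fst (es ! j)" "\<And>j. j < length es \<Longrightarrow> fst s 2 1 j = snd (es ! j)"
    "\<And>j. j < length es \<Longrightarrow> snd s 0 0 j = M (fst (es ! j)) (snd (es ! j))"
    "\<And>j. j < n \<Longrightarrow> snd s 1 l j = b j"
    "fst s 4 = (\<lambda>_ _. 0)" "fst s 5 = (\<lambda>_ _. 0)" "snd s 3 = (\<lambda>_ _. 0)" "snd s 4 = (\<lambda>_ _. 0)"
  shows "runs P solve_com s (200 + 200 * length es + 300 * n + t)
    (\<lambda>s'. \<exists>z. Q z \<and> snd s' 2 = (snd s 2)(l := \<lambda>j. if j < n then z j else snd s 2 l j))"
proof -
  let ?S = "solver_store n es M b"
  define s1 where "s1 = (update_at (update_at (fst s) 4 0 0 n) 4 0 1 (length es), snd s)"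
  let ?loop1 = "for_loop 6 (ivar 1) (Seq (IWrite 5 z0 (ivar 6) (IRead 2 z0 (ivar 6)))
        (Seq (IWrite 5 (IConst 1) (ivar 6) (IRead 2 (IConst 1) (ivar 6)))
          (RWrite 3 z0 (ivar 6) (RRead 0 z0 (ivar 6)))))"
  let ?loop2 = "for_loop 6 Nv (RWrite 3 (IConst 1) (ivar 6) (RRead 1 Iv (ivar 6)))"
  let ?loop3 = "for_loop 6 Nv (RWrite 2 Iv (ivar 6) (RRead 4 z0 (ivar 6)))"
  have 1: "runs P ?loop1 s1 (30 + 200 * length es) (\<lambda>s'. fst s' 5 = fst ?S 1 \<and>
      snd s' 3 = (\<lambda>i j. if i = 0 then snd ?S 0 0 j else 0))"
  proof (rule runs_for_frame[where m = "length es" and t = "\<lambda>_. 150" and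
      I = "\<lambda>e s'. fst s' 5 = (\<lambda>i j. if j < e then fst ?S 1 i j else 0) \<and>
        snd s' 3 = (\<lambda>i j. if i = 0 \<and> j < e then snd ?S 0 0 j else 0)"], goal_cases)
    case (4 e s2)
    then show ?case using s by (auto simp: s1_def agree_def solver_store_def fun_eq_iff less_Suc_eq)
  qed (use s in \<open>auto simp: s1_def solver_store_def agree_def fun_eq_iff\<close>)
  have 2: "runs P ?loop2 s2 (30 + 150 * n) (\<lambda>s'. snd s' 3 = snd ?S 0)"
    if "snd s2 3 = (\<lambda>i j. if i = 0 then snd ?S 0 0 j else 0)" "agree ?loop1 s1 s2" for s2
  proof (rule runs_for_frame[where m = n and t = "\<lambda>_. 100" and
      I = "\<lambda>e s'. snd s' 3 = (\<lambda>i j. if i = 1 \<and> n \<le> j \<or> i = 1 \<and> e \<le> j then 0 else snd ?S 0 i j)"], goal_cases)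
    case (4 e s3)
    then show ?case using that s by (auto simp: s1_def agree_def solver_store_def fun_eq_iff less_Suc_eq)
  qed (use s that in \<open>auto simp: s1_def solver_store_def agree_def fun_eq_iff\<close>)
  \<comment> \<open>Procedure 2 is the entry point of the given solver. Its input has one real
    array, so its output is its real array 1, which comes back as array 4.\<close>
  have 3: "runs P (Call 2 [4, 5] [3, 4]) s3 (5 + t) (\<lambda>s'. Q (snd s' 4 0))"
    if "fst s3 4 = fst ?S 0" "fst s3 5 = fst ?S 1" "snd s3 3 = snd ?S 0" "snd s3 4 = (\<lambda>_ _. 0)" for s3
  proof (rule runs_Call)
    have "(bind_args [4, 5] (fst s3), bind_args [3, 4] (snd s3)) = ?S"
      using that by (auto simp: bind_args_def solver_store_def fun_eq_iff less_Suc_eq numeral_2_eq_2)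
    then show "runs P (P ! 2) (bind_args [4, 5] (fst s3), bind_args [3, 4] (snd s3)) t
      (\<lambda>s'. Q (snd (return_args [4, 5] (fst s3) (fst s'), return_args [3, 4] (snd s3) (snd s')) 4 0))"
      using c return_args_nth[of "[3, 4::nat]" 1 "snd s3"] by (simp add: runs_mono)
  qed (use P in auto)
  have 4: "runs P ?loop3 s4 (30 + 150 * n)
      (\<lambda>s'. snd s' 2 = (snd s 2)(l := \<lambda>j. if j < n then snd s4 4 0 j else snd s 2 l j))"
    if "fst s4 0 0 0 = n" "fst s4 3 0 0 = l" "snd s4 2 = snd s 2" for s4
  proof (rule runs_for_frame[where m = n and t = "\<lambda>_. 100" and
      I = "\<lambda>e s'. snd s' 2 = (snd s 2)(l := \<lambda>j. if j < e then snd s4 4 0 j else snd s 2 l j)"], goal_cases)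
    case (4 e s3)
    then show ?case using that s by (auto simp: agree_def fun_eq_iff less_Suc_eq)
  qed (use s that in \<open>auto simp: agree_def fun_eq_iff\<close>)
  have "runs P (Seq ?loop1 (Seq ?loop2 (Seq (Call 2 [4, 5] [3, 4]) ?loop3))) s1
      (100 + 200 * length es + 300 * n + t)
      (\<lambda>s'. \<exists>z. Q z \<and> snd s' 2 = (snd s 2)(l := \<lambda>j. if j < n then z j else snd s 2 l j))"
  proof (rule runs_Seq_agree[OF 1])
    fix s2 assume s2: "fst s2 5 = fst ?S 1 \<and> snd s2 3 = (\<lambda>i j. if i = 0 then snd ?S 0 0 j else 0)"
      "agree ?loop1 s1 s2"
    then show "runs P (Seq ?loop2 (Seq (Call 2 [4, 5] [3, 4]) ?loop3)) s2 (70 + 300 * n + t)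
      (\<lambda>s'. \<exists>z. Q z \<and> snd s' 2 = (snd s 2)(l := \<lambda>j. if j < n then z j else snd s 2 l j))"
    proof (intro runs_Seq_agree[OF 2])
      fix s3 assume s3: "snd s3 3 = snd ?S 0" "agree ?loop2 s2 s3"
      have "fst s3 4 = fst ?S 0" using s2(2) s3(2) s
        by (auto simp: agree_def s1_def solver_store_def fun_eq_iff)
      moreover have "fst s3 5 = fst ?S 1" "snd s3 4 = (\<lambda>_ _. 0)" using s2 s3(2) s
        by (auto simp: agree_def s1_def)
      ultimately show "runs P (Seq (Call 2 [4, 5] [3, 4]) ?loop3) s3 (35 + 150 * n + t)
        (\<lambda>s'. \<exists>z. Q z \<and> snd s' 2 = (snd s 2)(l := \<lambda>j. if j < n then z j else snd s 2 l j))"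
      proof (intro runs_Seq_agree[OF 3])
        fix s4 assume s4: "Q (snd s4 4 0)" "agree (Call 2 [4, 5] [3, 4]) s3 s4"
        have "fst s4 0 0 0 = n" "fst s4 3 0 0 = l" "snd s4 2 = snd s 2"
          using s s2(2) s3(2) s4(2) by (auto simp: agree_def s1_def)
        from 4[OF this] show "runs P ?loop3 s4 (30 + 150 * n)
          (\<lambda>s'. \<exists>z. Q z \<and> snd s' 2 = (snd s 2)(l := \<lambda>j. if j < n then z j else snd s 2 l j))"
          by (rule runs_mono) (use s4(1) in auto)
      qed (use s3 in auto)
    qed auto
  qed simp
  then show ?thesis unfolding solve_com_def using s
    by (auto simp: s1_def elim!: runs_mono)
qed

text \<open>For \<open>solve_com\<close>, the index arrays 0 to 3 are the dimensions, the number of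
  entries, their positions and the loop counter; the real arrays 0 to 2 are the entries, the
  right-hand sides and the solutions.\<close>

definition solve_all_com :: com where
  "solve_all_com = for_loop 3 (IAdd Kv (IConst 1)) (Call 1 [0, 5, 7, 3] [8, 4, 6])"

definition dot_com :: "iexp \<Rightarrow> iexp \<Rightarrow> com" where
  "dot_com B q = Seq (RWrite 9 z0 q (RConst 0)) (for_loop 4 Nv
     (RWrite 9 z0 q (RAdd (RRead 9 z0 q) (RMul (RRead 4 Iv Jv) (RRead 6 B Jv)))))"

text \<open>Counter 10 stays below \<open>k - i\<close>, so these are the rows \<open>i + 1\<close>
  to \<open>k\<close>, the solutions still needed after step \<open>i\<close>.\<close>

abbreviation "Lv \<equiv> IAdd (IAdd Iv (ivar 10)) (IConst 1)"
abbreviation "Fv \<equiv> RRead 5 z0 Iv"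
abbreviation "Gv \<equiv> RRead 5 (IConst 1) Iv"
abbreviation "Dv \<equiv> RDiv (RConst 4) (RMul Fv Gv)"

text \<open>Cell (0, 0) of array 9 holds the product of \<open>v i\<close> with its own solution
  during the whole inner loop; cell (0, 1) is computed for each row and then replaced by the
  Sherman-Morrison factor.\<close>

definition update_row_com :: com where
  "update_row_com = Seq (dot_com Lv (IConst 1))
     (Seq (RWrite 9 z0 (IConst 1) (RDiv (RMul Dv (RRead 9 z0 (IConst 1)))
        (RSub (RConst 1) (RMul Dv (RRead 9 z0 z0)))))
     (for_loop 4 Nv (RWrite 6 Lv Jv (RAdd (RRead 6 Lv Jv) (RMul (RRead 9 z0 (IConst 1)) (RRead 6 Iv Jv))))))"

text \<open>For \<open>n = 0\<close> the guard avoids \<open>k\<^sup>2\<close> loop iterations, which \<open>k\<^sup>2 n\<close> would not pay for.\<close>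

definition update_com :: com where
  "update_com = If (ILess z0 Nv)
     (for_loop 3 Kv (Seq (dot_com Iv z0) (for_loop 10 (ISub Kv Iv) update_row_com)))
     Skip"

definition output_com :: com where
  "output_com = Seq (for_loop 3 Nv (RWrite 3 z0 Iv (RRead 6 Kv Iv)))
     (for_loop 3 Kv (Seq (dot_com Kv z0)
       (RWrite 3 z0 (IAdd Nv Iv) (RDiv (RMul (RAdd (RRead 2 (IConst 2) (IAdd Nv Iv))
           (RMul (RDiv (RMul (RConst 4) Yv) (RMul Fv Fv)) (RRead 9 z0 z0))) (RMul Fv Fv))
         (RMul (RConst 2) Gv)))))"

definition main_com :: com where
  "main_com = Seq setup_com (Seq list_com (Seq solve_all_com (Seq update_com output_com)))"

lemma writes_update [simp]:
  "iwrites (dot_com B q) = {4}" "rwrites (dot_com B q) = {9}"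
  "iwrites update_row_com = {4}" "rwrites update_row_com = {6, 9}"
  "iwrites update_com = {3, 4, 10}" "rwrites update_com = {6, 9}"
  "iwrites output_com = {3, 4}" "rwrites output_com = {3, 9}"
  by (auto simp: dot_com_def update_row_com_def update_com_def output_com_def)

text \<open>The row expression \<open>B\<close> is evaluated anew in every iteration, hence the
  hypothesis about all states that agree with \<open>s\<close>.\<close>

lemma runs_dot:
  assumes n: "fst s 0 0 0 = n" and i: "fst s 3 0 0 = i"
    and B: "\<And>s'. agree (dot_com B (IConst q)) s s' \<Longrightarrow> ieval B s' = b" "icost B \<le> 20"
  shows "runs P (dot_com B (IConst q)) s (50 + 130 * n)
    (\<lambda>s'. snd s' 9 = (snd s 9)(0 := (snd s 9 0)(q := ip n (snd s 4 i) (snd s 6 b))))"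
proof -
  define s1 where "s1 = (fst s, update_at (snd s) 9 0 q 0)"
  have "runs P (for_loop 4 Nv
     (RWrite 9 z0 (IConst q) (RAdd (RRead 9 z0 (IConst q)) (RMul (RRead 4 Iv Jv) (RRead 6 B Jv))))) s1 (30 + 130 * n)
    (\<lambda>s'. snd s' 9 = (snd s 9)(0 := (snd s 9 0)(q := ip n (snd s 4 i) (snd s 6 b))))"
  proof (rule runs_for_frame[where m = n and t = "\<lambda>_. 100" and
      I = "\<lambda>e s'. snd s' 9 = (snd s 9)(0 := (snd s 9 0)(q := (\<Sum>r<e. snd s 4 i r * snd s 6 b r)))"], goal_cases)
    case (4 e s')
    have "agree (dot_com B (IConst q)) s s'" using 4(4) by (auto simp: agree_def s1_def)
    then have "ieval B s' = b" by (rule B)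
    then show ?case using 4 n i B(2) by (auto simp: agree_def s1_def fun_eq_iff)
  qed (use n in \<open>auto simp: s1_def agree_def fun_eq_iff ip_def\<close>)
  then show ?thesis unfolding dot_com_def by (auto simp: s1_def elim!: runs_mono)
qed

text \<open>Of its arguments \<open>solve_com\<close> writes only the solutions, so the caller sees
  a change in array 6 alone. This is sharper than \<open>agree\<close>, which treats all arguments
  of a call as written.\<close>

lemma runs_Call_solve:
  assumes P: "2 < length P" "P ! 1 = solve_com"
    and c: "runs P (P ! 2) (solver_store n es M b) t (\<lambda>s'. Q (snd s' 1 0))"
    and s: "fst s 0 0 0 = n" "fst s 3 0 0 = l" "entries_stored M es s" "\<And>j. j < n \<Longrightarrow> snd s 4 l j = b j"
  shows "runs P (Call 1 [0, 5, 7, 3] [8, 4, 6]) s (220 + 200 * length es + 300 * n + t)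
    (\<lambda>s'. (\<forall>a. fst s' a = fst s a) \<and> (\<forall>a. a \<noteq> 6 \<longrightarrow> snd s' a = snd s a) \<and>
      (\<exists>z. Q z \<and> snd s' 6 = (snd s 6)(l := \<lambda>j. if j < n then z j else snd s 6 l j)))"
proof (rule runs_Call)
  let ?is = "[0, 5, 7, 3] :: nat list" and ?rs = "[8, 4, 6] :: nat list"
  let ?s = "(bind_args ?is (fst s), bind_args ?rs (snd s))"
  have "runs P solve_com ?s (200 + 200 * length es + 300 * n + t)
    (\<lambda>s'. \<exists>z. Q z \<and> snd s' 2 = (snd ?s 2)(l := \<lambda>j. if j < n then z j else snd ?s 2 l j))"
    using s by (intro runs_solve[OF P(1) c]) (auto simp: bind_args_def entries_stored_def)
  from runs_agree[OF this]
  show "runs P (P ! 1) ?s (200 + 200 * length es + 300 * n + t)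
    (\<lambda>s'. (\<forall>a. fst (return_args ?is (fst s) (fst s'), return_args ?rs (snd s) (snd s')) a = fst s a) \<and>
      (\<forall>a. a \<noteq> 6 \<longrightarrow> snd (return_args ?is (fst s) (fst s'), return_args ?rs (snd s) (snd s')) a = snd s a) \<and>
      (\<exists>z. Q z \<and> snd (return_args ?is (fst s) (fst s'), return_args ?rs (snd s) (snd s')) 6 =
         (snd s 6)(l := \<lambda>j. if j < n then z j else snd s 6 l j)))"
    unfolding P(2)
  proof (rule runs_mono)
    fix s'
    assume *: "(\<exists>z. Q z \<and> snd s' 2 = (snd ?s 2)(l := \<lambda>j. if j < n then z j else snd ?s 2 l j)) \<and> agree solve_com ?s s'"
    have "return_args ?is (fst s) (fst s') a = fst s a" for a
    proof (cases "a \<in> set ?is")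
      case True
      then have "a = 0 \<or> a = 5 \<or> a = 7 \<or> a = 3" by simp
      then show ?thesis
        using * return_args_nth[of ?is 0 "fst s" "fst s'"] return_args_nth[of ?is 1 "fst s" "fst s'"]
          return_args_nth[of ?is 2 "fst s" "fst s'"] return_args_nth[of ?is 3 "fst s" "fst s'"]
        by (auto simp: agree_def bind_args_def)
    qed (rule return_args_other)
    moreover have "return_args ?rs (snd s) (snd s') a = snd s a" if "a \<noteq> 6" for a
    proof (cases "a \<in> set ?rs")
      case True
      then have "a = 8 \<or> a = 4" using that by simp
      then show ?thesis
        using * return_args_nth[of ?rs 0 "snd s" "snd s'"] return_args_nth[of ?rs 1 "snd s" "snd s'"]
        by (auto simp: agree_def bind_args_def)
    qed (rule return_args_other)
    moreover have "return_args ?rs (snd s) (snd s') 6 = snd s' 2"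
      using return_args_nth[of ?rs 2 "snd s" "snd s'"] by simp
    moreover have b: "snd ?s 2 = snd s 6" by (simp add: bind_args_def)
    from * obtain z where "Q z" "snd s' 2 = (snd ?s 2)(l := \<lambda>j. if j < n then z j else snd ?s 2 l j)"
      by blast
    note this[unfolded b]
    ultimately show "(\<forall>a. fst (return_args ?is (fst s) (fst s'), return_args ?rs (snd s) (snd s')) a = fst s a) \<and>
      (\<forall>a. a \<noteq> 6 \<longrightarrow> snd (return_args ?is (fst s) (fst s'), return_args ?rs (snd s) (snd s')) a = snd s a) \<and>
      (\<exists>z. Q z \<and> snd (return_args ?is (fst s) (fst s'), return_args ?rs (snd s) (snd s')) 6 =
         (snd s 6)(l := \<lambda>j. if j < n then z j else snd s 6 l j))"
      using * by auto
  qed simp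
qed (use P in auto)

definition row_update ::
  "nat \<Rightarrow> real \<Rightarrow> (nat \<Rightarrow> real) \<Rightarrow> (nat \<Rightarrow> real) \<Rightarrow> (nat \<Rightarrow> real) \<Rightarrow> nat \<Rightarrow> real" where
  "row_update n d u w z r = (if r < n then z r + d * ip n u z / (1 - d * ip n u w) * w r else z r)"

text \<open>The two update loops as a pure function. Row \<open>l\<close> keeps up with the matrices
  \<open>S i\<close> as long as \<open>i \<le> l\<close> and is left behind afterwards.\<close>

fun all_updates ::
  "nat \<Rightarrow> nat \<Rightarrow> (nat \<Rightarrow> real) \<Rightarrow> (nat \<Rightarrow> nat \<Rightarrow> real) \<Rightarrow> (nat \<Rightarrow> nat \<Rightarrow> real) \<Rightarrow> nat \<Rightarrow> nat \<Rightarrow> nat \<Rightarrow> real" where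
  "all_updates n k d u W 0 = W"
| "all_updates n k d u W (Suc i) = (\<lambda>l. if i < l \<and> l \<le> k
     then row_update n (d i) (u i) (all_updates n k d u W i i) (all_updates n k d u W i l)
     else all_updates n k d u W i l)"

context solver_input
begin

lemma runs_solve_all:
  assumes P: "2 < length P" "P ! 1 = solve_com"
    and c: "\<And>l. l \<le> k \<Longrightarrow> runs P (P ! 2) (solver_store n es M (U l)) t (\<lambda>s'. Q l (snd s' 1 0))"
    and Q: "\<And>l z z'. (\<And>r. r < n \<Longrightarrow> z r = z' r) \<Longrightarrow> Q l z \<Longrightarrow> Q l z'"
    and s: "inp s" "entries_stored M es s" "\<And>l j. l \<le> k \<Longrightarrow> j < n \<Longrightarrow> snd s 4 l j = U l j"
  shows "runs P solve_all_com s (20 + (k + 1) * (250 + 200 * length es + 300 * n + t))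
    (\<lambda>s'. (\<forall>a. a \<noteq> 3 \<longrightarrow> fst s' a = fst s a) \<and> (\<forall>a. a \<noteq> 6 \<longrightarrow> snd s' a = snd s a) \<and>
      (\<forall>l\<le>k. Q l (snd s' 6 l)))"
  unfolding solve_all_com_def
\<comment> \<open>\<open>runs_for_frame\<close> does not apply, as the counter 3 is itself an
  argument of the call. The finer frame of \<open>runs_Call_solve\<close> is put into the invariant
  instead.\<close>
proof (rule runs_for[where m = "k + 1" and t = "\<lambda>_. 220 + 200 * length es + 300 * n + t" and
      I = "\<lambda>l s'. (\<forall>a. a \<noteq> 3 \<longrightarrow> fst s' a = fst s a) \<and> (\<forall>a. a \<noteq> 6 \<longrightarrow> snd s' a = snd s a) \<and>
      (\<forall>a<l. Q a (snd s' 6 a))"], goal_cases)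
  case (2 l s')
  then show ?case using s by (simp add: inpD)
next
  case (3 l s')
  then have "fst s' 0 0 0 = n" "entries_stored M es s'" "\<And>j. j < n \<Longrightarrow> snd s' 4 l j = U l j"
    using s by (auto simp: inpD entries_stored_def)
  from runs_Call_solve[where Q = "Q l", OF P c this(1) 3(3) this(2,3)] 3
  show ?case by (auto elim!: runs_mono simp: less_Suc_eq intro: Q)
qed (auto simp: algebra_simps)

lemma runs_update_row:
  assumes n: "fst s 0 0 0 = n" and i: "fst s 3 0 0 = i" and t: "fst s 10 0 0 = t"
    and a: "snd s 9 0 0 = ip n (snd s 4 i) (snd s 6 i)"
    and d: "d = 4 / (snd s 5 0 i * snd s 5 1 i)"
  shows "runs P update_row_com s (300 + 300 * n) (\<lambda>s'. snd s' 9 0 0 = snd s 9 0 0 \<and>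
    snd s' 6 = (snd s 6)(Suc (i + t) := row_update n d (snd s 4 i) (snd s 6 i) (snd s 6 (Suc (i + t)))))"
  unfolding update_row_com_def
proof (rule runs_Seq_agree[OF runs_dot[OF n i]])
  fix s' assume "agree (dot_com Lv (IConst 1)) s s'"
  then show "ieval Lv s' = Suc (i + t)" using i t by (simp add: agree_def)
next
  let ?l = "Suc (i + t)"
  let ?b = "d * ip n (snd s 4 i) (snd s 6 ?l) / (1 - d * ip n (snd s 4 i) (snd s 6 i))"
  fix s1 assume s1: "snd s1 9 = (snd s 9)(0 := (snd s 9 0)(1 := ip n (snd s 4 i) (snd s 6 ?l)))"
    "agree (dot_com Lv (IConst 1)) s s1"
  define s2 where "s2 = (fst s1, update_at (snd s1) 9 0 1 ?b)"
  let ?loop = "for_loop 4 Nv (RWrite 6 Lv Jv (RAdd (RRead 6 Lv Jv) (RMul (RRead 9 z0 (IConst 1)) (RRead 6 Iv Jv))))"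
  have "runs P ?loop s2 (30 + 150 * n) (\<lambda>s'. snd s' 9 0 0 = snd s 9 0 0 \<and>
      snd s' 6 = (snd s 6)(?l := row_update n d (snd s 4 i) (snd s 6 i) (snd s 6 ?l)))"
  proof (rule runs_for_frame[where m = n and t = "\<lambda>_. 120" and
      I = "\<lambda>e s'. snd s' 6 = (snd s 6)(?l := \<lambda>r. if r < e then row_update n d (snd s 4 i) (snd s 6 i) (snd s 6 ?l) r
         else snd s 6 ?l r)"], goal_cases)
    case (4 e s')
    then show ?case using s1 n i t
      by (auto simp: s2_def agree_def fun_eq_iff less_Suc_eq row_update_def)
  next
    case (5 s')
    then show ?case using s1 by (auto simp: s2_def agree_def fun_eq_iff row_update_def)
  qed (use s1 n in \<open>auto simp: s2_def agree_def\<close>)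
  then show "runs P (Seq (RWrite 9 z0 (IConst 1) (RDiv (RMul Dv (RRead 9 z0 (IConst 1)))
        (RSub (RConst 1) (RMul Dv (RRead 9 z0 z0))))) ?loop) s1 (230 + 150 * n)
      (\<lambda>s'. snd s' 9 0 0 = snd s 9 0 0 \<and>
        snd s' 6 = (snd s 6)(?l := row_update n d (snd s 4 i) (snd s 6 i) (snd s 6 ?l)))"
    using s1 i a d by (auto simp: s2_def agree_def elim!: runs_mono)
qed auto

text \<open>For \<open>n = 0\<close> nothing is computed, and nothing has to be: the solutions have
  no coordinates below \<open>n\<close>.\<close>

lemma runs_update:
  assumes "inp s" and d: "\<And>i. i < k \<Longrightarrow> d i = 4 / (snd s 5 0 i * snd s 5 1 i)"
  shows "runs P update_com s (50 + n * (k * (500 + k * 1000)))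
    (\<lambda>s'. n = 0 \<or> snd s' 6 = all_updates n k d (snd s 4) (snd s 6) k)"
  unfolding update_com_def
proof (rule runs_If[where u = "20 + n * (k * (500 + k * 1000))"], goal_cases)
  case 1
  then have n: "n > 0" using assms by (simp add: inpD)
  let ?W = "all_updates n k d (snd s 4) (snd s 6)"
  show ?case
  proof (rule runs_for_frame[where m = k and t = "\<lambda>i. 100 + 130 * n + k * (400 + 300 * n)" and
        I = "\<lambda>i s'. snd s' 6 = ?W i"], goal_cases)
    case (3 i s1)
    then show ?case using inp_agree[OF 3(4) assms(1)] by (simp add: inpD)
  next
    case (4 i s1)
    have inp1: "inp s1" using 4(4) assms(1) by (rule inp_agree) auto
    then have n1: "fst s1 0 0 0 = n" by (simp add: inpD)
    have s1: "snd s1 4 = snd s 4" "d i = 4 / (snd s1 5 0 i * snd s1 5 1 i)"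
      using 4 d by (auto simp: agree_def)
    show ?case
    proof (rule runs_Seq_agree[OF runs_dot[OF n1 4(3)]])
      fix s' assume "agree (dot_com Iv z0) s1 s'"
      then show "ieval Iv s' = i" using 4(3) by (simp add: agree_def)
    next
      fix s2 assume s2: "snd s2 9 = (snd s1 9)(0 := (snd s1 9 0)(0 := ip n (snd s1 4 i) (snd s1 6 i)))"
        "agree (dot_com Iv z0) s1 s2"
      have inp2: "inp s2" using s2(2) inp1 by (rule inp_agree) auto
      have i2: "fst s2 3 0 0 = i" and s2': "snd s2 4 = snd s 4" "snd s2 6 = ?W i"
        "d i = 4 / (snd s2 5 0 i * snd s2 5 1 i)" "snd s2 9 0 0 = ip n (snd s 4 i) (?W i i)"
        using s2 4 s1 by (auto simp: agree_def)
      show "runs P (for_loop 10 (ISub Kv Iv) update_row_com) s2 (30 + k * (400 + 300 * n))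
        (\<lambda>s''. snd (iset 3 (Suc i) s'') 6 = ?W (Suc i))"
      proof (rule runs_for_frame[where m = "k - i" and t = "\<lambda>_. 300 + 300 * n" and
          I = "\<lambda>t s'. snd s' 9 0 0 = ip n (snd s 4 i) (?W i i) \<and> snd s' 6 = (\<lambda>l. if i < l \<and> l \<le> i + t
            then row_update n (d i) (snd s 4 i) (?W i i) (?W i l) else ?W i l)"], goal_cases)
        case (3 t s3)
        have "fst s3 3 0 0 = i" "fst s3 0 = fst s2 0" using 3(4) i2 by (simp_all add: agree_def)
        then show ?case using inp2 by (simp add: inpD)
      next
        case (4 t s3)
        have i3: "fst s3 3 0 0 = i" "fst s3 0 0 0 = n" using 4(4) i2 inp2 by (simp_all add: agree_def inpD)
        have s3: "snd s3 4 = snd s 4" "d i = 4 / (snd s3 5 0 i * snd s3 5 1 i)" "snd s3 6 i = ?W i i"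
          "snd s3 6 (Suc (i + t)) = ?W i (Suc (i + t))"
          using 4 s2' by (auto simp: agree_def)
        have a3: "snd s3 9 0 0 = ip n (snd s3 4 i) (snd s3 6 i)" using 4(2) s3 by simp
        show ?case
          by (rule runs_mono[OF runs_update_row[OF i3(2,1) 4(3) a3 s3(2)]])
            (use 4(2) s3 in \<open>auto simp: fun_eq_iff le_Suc_eq\<close>)
      next
        case (5 s3)
        then show ?case using \<open>i < k\<close> by (auto simp: fun_eq_iff)
      next
        case 6
        have "(k - i) * (322 + 300 * n) \<le> k * (322 + 300 * n)" by (rule mult_le_mono1) simp
        then show ?case by (simp add: algebra_simps)
      qed (use s2' in \<open>auto simp: fun_eq_iff\<close>)
    qed auto
  next
    case 6
    \<comment> \<open>Since \<open>n > 0\<close>, the constants 118 and 400 are absorbed by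
      multiples of \<open>n\<close>.\<close>
    have "k * (118 + (130 * n + k * (400 + 300 * n))) \<le> k * (n * (500 + k * 1000))"
    proof (rule mult_le_mono2)
      have "k * (400 + 300 * n) \<le> k * (1000 * n)" using n by (intro mult_le_mono2) simp
      moreover have "118 + 130 * n \<le> 500 * n" using n by simp
      ultimately have "118 + 130 * n + k * (400 + 300 * n) \<le> 500 * n + k * (1000 * n)" by (rule add_mono[rotated])
      then show "118 + (130 * n + k * (400 + 300 * n)) \<le> n * (500 + k * 1000)"
        by (simp add: algebra_simps)
    qed
    then show ?case by (simp add: algebra_simps)
  qed auto
qed (use assms in \<open>auto simp: inpD\<close>)

lemma runs_output:
  assumes "inp s"
  shows "runs P output_com s (50 + 130 * n + k * (300 + 130 * n))
    (\<lambda>s'. (\<forall>r<n. snd s' 3 0 r = snd s 6 k r) \<and>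
      (\<forall>i<k. snd s' 3 0 (n + i) = (xyb 2 (n + i) + 4 * xyb 1 i / (snd s 5 0 i)\<^sup>2 * ip n (snd s 4 i) (snd s 6 k)) *
        (snd s 5 0 i)\<^sup>2 / (2 * snd s 5 1 i)))"
  unfolding output_com_def
proof (rule runs_Seq_agree[where u = "20 + k * (300 + 130 * n)"])
  show "runs P (for_loop 3 Nv (RWrite 3 z0 Iv (RRead 6 Kv Iv))) s (30 + 130 * n)
    (\<lambda>s'. \<forall>r<n. snd s' 3 0 r = snd s 6 k r)"
  proof (rule runs_for_frame[where m = n and t = "\<lambda>_. 100" and
      I = "\<lambda>e s'. \<forall>r<e. snd s' 3 0 r = snd s 6 k r"], goal_cases)
    case (4 e s')
    have "inp s'" using 4(4) assms by (rule inp_agree) auto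
    moreover have "snd s' 6 = snd s 6" using 4(4) by (simp add: agree_def)
    ultimately show ?case using 4(1-3) by (auto simp: inpD less_Suc_eq)
  qed (use assms in \<open>auto simp: inpD agree_def\<close>)
next
  fix s1 assume s1: "\<forall>r<n. snd s1 3 0 r = snd s 6 k r" "agree (for_loop 3 Nv (RWrite 3 z0 Iv (RRead 6 Kv Iv))) s s1"
  have inp1: "inp s1" using s1(2) assms by (rule inp_agree) auto
  let ?z = "\<lambda>i. (xyb 2 (n + i) + 4 * xyb 1 i / (snd s 5 0 i)\<^sup>2 * ip n (snd s 4 i) (snd s 6 k)) *
        (snd s 5 0 i)\<^sup>2 / (2 * snd s 5 1 i)"
  show "runs P (for_loop 3 Kv (Seq (dot_com Kv z0)
       (RWrite 3 z0 (IAdd Nv Iv) (RDiv (RMul (RAdd (RRead 2 (IConst 2) (IAdd Nv Iv))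
           (RMul (RDiv (RMul (RConst 4) Yv) (RMul Fv Fv)) (RRead 9 z0 z0))) (RMul Fv Fv))
         (RMul (RConst 2) Gv))))) s1 (20 + k * (300 + 130 * n))
    (\<lambda>s'. (\<forall>r<n. snd s' 3 0 r = snd s 6 k r) \<and> (\<forall>i<k. snd s' 3 0 (n + i) = ?z i))"
  proof (rule runs_for_frame[where m = k and t = "\<lambda>_. 250 + 130 * n" and
      I = "\<lambda>e s'. (\<forall>r<n. snd s' 3 0 r = snd s 6 k r) \<and> (\<forall>i<e. snd s' 3 0 (n + i) = ?z i)"], goal_cases)
    case (3 i s2)
    then show ?case using inp_agree[OF 3(4) inp1] by (simp add: inpD)
  next
    case (4 i s2)
    have inp2: "inp s2" using 4(4) inp1 by (rule inp_agree) auto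
    then have n2: "fst s2 0 0 0 = n" by (simp add: inpD)
    show ?case
    proof (rule runs_Seq_agree[OF runs_dot[OF n2 4(3)]])
      fix s' assume "agree (dot_com Kv z0) s2 s'"
      from inp_agree[OF this inp2] show "ieval Kv s' = k" by (simp add: inpD)
    next
      fix s3 assume s3: "snd s3 9 = (snd s2 9)(0 := (snd s2 9 0)(0 := ip n (snd s2 4 i) (snd s2 6 k)))"
        "agree (dot_com Kv z0) s2 s3"
      have inp3: "inp s3" using s3(2) inp2 by (rule inp_agree) auto
      have i3: "fst s3 3 0 0 = i" "snd s3 5 = snd s 5" "snd s3 3 = snd s2 3"
        "snd s3 9 0 0 = ip n (snd s 4 i) (snd s 6 k)"
        using s3 4 s1(2) by (auto simp: agree_def)
      show "runs P (RWrite 3 z0 (IAdd Nv Iv) (RDiv (RMul (RAdd (RRead 2 (IConst 2) (IAdd Nv Iv))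
           (RMul (RDiv (RMul (RConst 4) Yv) (RMul Fv Fv)) (RRead 9 z0 z0))) (RMul Fv Fv))
         (RMul (RConst 2) Gv))) s3 200
        (\<lambda>s''. (\<forall>r<n. snd (iset 3 (Suc i) s'') 3 0 r = snd s 6 k r) \<and>
          (\<forall>ia<Suc i. snd (iset 3 (Suc i) s'') 3 0 (n + ia) = ?z ia))"
        using inp3 i3 4(2) by (auto simp: inpD power2_eq_square less_Suc_eq)
    qed auto
  qed (use s1 in \<open>auto simp: algebra_simps\<close>)
qed auto

end

context downdate
begin

text \<open>Before step \<open>i\<close>, rows \<open>i\<close> and \<open>l\<close> solve the
  systems in \<open>S i\<close> for \<open>v i\<close> and \<open>U l\<close>, which is what
  \<open>update\<close> asks for. With \<open>i = l = k\<close> this is the Schur complement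
  system.\<close>

lemma all_updates_correct:
  assumes U: "\<And>i r. i < k \<Longrightarrow> r < n \<Longrightarrow> U i r = v i r"
    and W: "\<And>l r. l \<le> k \<Longrightarrow> r < n \<Longrightarrow> mv n M (W l) r = U l r"
  shows "i \<le> l \<Longrightarrow> l \<le> k \<Longrightarrow> r < n \<Longrightarrow> mv n (S i) (all_updates n k d U W i l) r = U l r"
proof (induction i arbitrary: l r)
  case 0
  then show ?case using W by (simp add: S_def[abs_def])
next
  case (Suc i)
  let ?W = "all_updates n k d U W i"
  have i: "i < k" using Suc.prems by simp
  have ip: "ip n (U i) z = ip n (v i) z" for z using U[OF i] by (intro ip_cong) auto
  have "mv n (S (Suc i)) (all_updates n k d U W (Suc i) l) r =
      mv n (S (Suc i)) (\<lambda>r. ?W l r + d i * ip n (v i) (?W l) / (1 - d i * ip n (v i) (?W i)) * ?W i r) r"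
    using Suc.prems by (intro mv_cong) (auto simp: row_update_def ip)
  also have "\<dots> = U l r"
    using Suc.prems i by (intro update[OF i]) (auto simp: Suc.IH U)
  finally show ?case .
qed

end

context solver_input
begin

text \<open>The solver hypothesis covers every enumeration of the entries, because the one found by
  \<open>list_com\<close> is known only up to order. \<open>W\<close> is whatever the solver
  happened to return.\<close>

lemma runs_main:
  assumes P: "2 < length P" "P ! 1 = solve_com"
    and c: "\<And>es l. distinct es \<Longrightarrow> set es = {(r, c) \<in> visited k 0. MM k r c \<noteq> 0} \<Longrightarrow> l \<le> k \<Longrightarrow>
      length es \<le> p \<and> runs P (P ! 2) (solver_store n es (MM k) (V k l)) t
        (\<lambda>s'. \<forall>r<n. mv n (MM k) (snd s' 1 0) r = V k l r)"
    and s: "inp s" "\<And>a. 3 \<le> a \<Longrightarrow> fst s a = (\<lambda>_ _. 0)" "\<And>a. 3 \<le> a \<Longrightarrow> snd s a = (\<lambda>_ _. 0)"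
  shows "runs P main_com s
    (240 + 260 * n + (\<Sum>i<k. 900 + 390 * n + 490 * len i) + (k + 1) * (250 + 200 * p + 300 * n + t)
      + n * (k * (500 + k * 1000)))
    (\<lambda>s'. \<exists>W. (\<forall>l\<le>k. \<forall>r<n. mv n (MM k) (W l) r = V k l r) \<and>
      (\<forall>r<n. snd s' 3 0 r = all_updates n k (\<lambda>i. 4 / (ff i * gg i)) (V k) W k k r) \<and>
      (\<forall>i<k. snd s' 3 0 (n + i) = (xyb 2 (n + i) + 4 * xyb 1 i / (ff i)\<^sup>2 *
          ip n (vv i) (all_updates n k (\<lambda>i. 4 / (ff i * gg i)) (V k) W k k)) * (ff i)\<^sup>2 / (2 * gg i)))"
    (is "runs P main_com s ?T ?Q")
  unfolding main_com_def
proof (rule runs_Seq_agree[OF runs_setup])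
  fix s1 assume s1: "snd s1 4 = V k \<and> snd s1 5 = par k \<and> snd s1 7 = MM k" "agree setup_com s s1"
  have inp1: "inp s1" using s1(2) s(1) by (rule inp_agree) auto
  let ?t1 = "(k + 1) * (250 + 200 * p + 300 * n + t)" and ?t2 = "n * (k * (500 + k * 1000))"
  let ?t3 = "50 + 130 * n + k * (300 + 130 * n)"
  show "runs P (Seq list_com (Seq solve_all_com (Seq update_com output_com))) s1
      (20 + (\<Sum>i<k. 100 + 230 * len i) + (20 + ?t1 + (50 + ?t2 + ?t3))) ?Q"
  proof (rule runs_Seq_agree[OF runs_list])
    fix s2 assume s2: "list_inv (MM k) (visited k 0) s2" "agree list_com s1 s2"
    have inp2: "inp s2" using s2(2) inp1 by (rule inp_agree) auto
    obtain es where es: "distinct es" "set es = {(r, c) \<in> visited k 0. MM k r c \<noteq> 0}"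
      "entries_stored (MM k) es s2"
      using s2(1) unfolding list_inv_def by blast
    have four: "snd s2 4 = V k" "snd s2 5 = par k" using s1 s2(2) by (simp_all add: agree_def)
    let ?I = "\<lambda>s'. (\<forall>a. a \<noteq> 3 \<longrightarrow> fst s' a = fst s2 a) \<and> (\<forall>a. a \<noteq> 6 \<longrightarrow> snd s' a = snd s2 a) \<and>
      (\<forall>l\<le>k. \<forall>r<n. mv n (MM k) (snd s' 6 l) r = V k l r)"
    have "runs P solve_all_com s2 (20 + (k + 1) * (250 + 200 * length es + 300 * n + t)) ?I"
    proof (rule runs_solve_all[where U = "V k" and M = "MM k" and
        Q = "\<lambda>l z. \<forall>r<n. mv n (MM k) z r = V k l r"])
      fix l z z' assume z: "\<And>r. r < n \<Longrightarrow> z r = (z' r :: real)" and "\<forall>r<n. mv n (MM k) z r = V k l r"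
      then show "\<forall>r<n. mv n (MM k) z' r = V k l r" using mv_cong[of n z' z] by simp
    qed (use P c es inp2 four in auto)
    moreover have "20 + (k + 1) * (250 + 200 * length es + 300 * n + t) \<le> 20 + ?t1"
      using c[OF es(1,2), of 0] by (intro add_left_mono mult_le_mono2) simp
    ultimately have 3: "runs P solve_all_com s2 (20 + ?t1) ?I" by (rule runs_mono) auto
    show "runs P (Seq solve_all_com (Seq update_com output_com)) s2 (20 + ?t1 + (50 + ?t2 + ?t3)) ?Q"
    proof (rule runs_Seq_agree[OF 3])
      fix s3 assume s3: "?I s3"
      have inp3: "inp s3" using s3 inp2 by (auto simp: inp_def)
      have four3: "snd s3 4 = V k" "snd s3 5 = par k" using s3 four by auto
      let ?d = "\<lambda>i. 4 / (ff i * gg i)"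
      have "?d i = 4 / (snd s3 5 0 i * snd s3 5 1 i)" if "i < k" for i
        using that four3 by (simp add: par_def)
      from runs_update[OF inp3 this]
      show "runs P (Seq update_com output_com) s3 (50 + ?t2 + ?t3) ?Q"
      proof (rule runs_Seq_agree)
        let ?W = "all_updates n k ?d (V k) (snd s3 6) k"
        fix s4 assume s4: "n = 0 \<or> snd s4 6 = all_updates n k ?d (snd s3 4) (snd s3 6) k"
          "agree update_com s3 s4"
        have inp4: "inp s4" using s4(2) inp3 by (rule inp_agree) auto
        have four4: "snd s4 4 = V k" "snd s4 5 = par k" using s4(2) four3 by (simp_all add: agree_def)
        have W: "r < n \<Longrightarrow> snd s4 6 k r = ?W k r" for r using s4(1) four3 by auto
        then have "ip n u (snd s4 6 k) = ip n u (?W k)" for u by (intro ip_cong) auto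
        then show "runs P output_com s4 ?t3 ?Q"
          using W four4 s3 by (intro runs_mono[OF runs_output[OF inp4]] exI[of _ "snd s3 6"])
            (auto simp: par_def V_def)
      qed auto
    qed auto
  qed (use s1 s inp1 in \<open>auto simp: agree_def\<close>)
next
  have "(\<Sum>i<k. 900 + 390 * n + 490 * len i) = (\<Sum>i<k. 500 + 260 * n + 260 * len i) +
      (\<Sum>i<k. 100 + 230 * len i) + (\<Sum>i<k. 300 + 130 * n)"
    unfolding sum.distrib[symmetric] by (rule sum.cong) auto
  then show "100 + 130 * n + (\<Sum>i<k. 500 + 260 * n + 260 * len i) +
    (20 + (\<Sum>i<k. 100 + 230 * len i) + (20 + (k + 1) * (250 + 200 * p + 300 * n + t) +
      (50 + n * (k * (500 + k * 1000)) + (50 + 130 * n + k * (300 + 130 * n))))) \<le> ?T"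
    by simp
qed (use s in auto)

end

section \<open>Matrices, inputs and the entry lists\<close>

text \<open>Turns loops over entry lists into sums over all positions: the lists have no
  repetitions, and omitted positions contribute 0.\<close>

lemma enumerates_sum:
  assumes "enumerates_entries es A" "A \<in> carrier_mat n n"
    and "\<And>p. A $$ p = 0 \<Longrightarrow> g p = (0 :: real)"
  shows "(\<Sum>e<length es. g (es ! e)) = (\<Sum>p\<in>{..<n} \<times> {..<n}. g p)"
proof -
  have "(\<Sum>e<length es. g (es ! e)) = (\<Sum>p\<in>set es. g p)"
    using assms(1) by (intro sum.reindex_bij_betw bij_betw_nth) (auto simp: enumerates_entries_def)
  also have "\<dots> = (\<Sum>p\<in>{..<n} \<times> {..<n}. g p)"
    using assms by (intro sum.mono_neutral_left) (auto simp: enumerates_entries_def nonzero_entries_def)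
  finally show ?thesis .
qed

lemma scalar_prod_lessThan: "dim_vec w = n \<Longrightarrow> u \<bullet> w = (\<Sum>i<n. u $ i * w $ i)"
  by (simp add: scalar_prod_def lessThan_atLeast0)

lemma mult_mat_vec_ip:
  "A \<in> carrier_mat m n \<Longrightarrow> v \<in> carrier_vec n \<Longrightarrow> i < m \<Longrightarrow>
   (A *\<^sub>v v) $ i = mv n (\<lambda>r c. A $$ (r, c)) (\<lambda>c. v $ c) i"
  by (auto simp: scalar_prod_lessThan mv_def intro!: sum.cong)

lemma quad_form_ip:
  "A \<in> carrier_mat n n \<Longrightarrow> v \<in> carrier_vec n \<Longrightarrow>
   v \<bullet> (A *\<^sub>v v) = ip n (\<lambda>c. v $ c) (mv n (\<lambda>r c. A $$ (r, c)) (\<lambda>c. v $ c))"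
  by (subst scalar_prod_lessThan[of _ n]) (auto simp: ip_def mult_mat_vec_ip intro!: sum.cong simp del: index_mult_mat_vec)

lemma psd_psd_mat:
  assumes A: "A \<in> carrier_mat n n" and "psd_mat A"
  shows "psd n (\<lambda>r c. A $$ (r, c))"
  unfolding psd_def symm_def
proof (intro conjI allI impI)
  fix r c assume "r < n" "c < n"
  then have "A\<^sup>T $$ (r, c) = A $$ (c, r)" using A by simp
  then show "A $$ (r, c) = A $$ (c, r)" using assms(2) by (simp add: psd_mat_def)
next
  fix u
  have "0 \<le> vec n u \<bullet> (A *\<^sub>v vec n u)" using assms by (auto simp: psd_mat_def)
  also have "\<dots> = ip n (\<lambda>c. vec n u $ c) (mv n (\<lambda>r c. A $$ (r, c)) (\<lambda>c. vec n u $ c))"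
    by (rule quad_form_ip[OF A]) simp
  also have "\<dots> = ip n u (mv n (\<lambda>r c. A $$ (r, c)) u)"
    by (intro ip_cong mv_cong) auto
  finally show "0 \<le> ip n u (mv n (\<lambda>r c. A $$ (r, c)) u)" .
qed

lemma consistent_vec:
  "A \<in> carrier_mat n n \<Longrightarrow> (\<And>r. r < n \<Longrightarrow> mv n (\<lambda>r c. A $$ (r, c)) u r = b r) \<Longrightarrow> consistent A (vec n b)"
  unfolding consistent_def
  by (rule bexI[of _ "vec n u"]) (auto intro!: eq_vecI simp: mult_mat_vec_ip simp del: index_mult_mat_vec cong: mv_cong)

lemma output_solves_iff:
  assumes "A \<in> carrier_mat n n" "b \<in> carrier_vec n"
  shows "output_solves A b X \<longleftrightarrow> (\<forall>r<n. mv n (\<lambda>r c. A $$ (r, c)) (X 0) r = b $ r)"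
proof -
  have "A *\<^sub>v vec n (\<lambda>i. X 0 i) = b \<longleftrightarrow> (\<forall>r<n. (A *\<^sub>v vec n (\<lambda>i. X 0 i)) $ r = b $ r)"
    using assms by (auto intro!: eq_vecI)
  also have "\<dots> \<longleftrightarrow> (\<forall>r<n. mv n (\<lambda>r c. A $$ (r, c)) (X 0) r = b $ r)"
    using assms mv_cong[of n "\<lambda>c. vec n (\<lambda>i. X 0 i) $ c" "X 0"]
    by (simp add: mult_mat_vec_ip del: index_mult_mat_vec)
  finally show ?thesis using assms by (simp add: output_solves_def)
qed

lemma system_input_store:
  assumes "b \<in> carrier_vec n"
  shows "(input_arrays (fst (system_input n es A b)), input_arrays (snd (system_input n es A b))) =
    solver_store n es (\<lambda>r c. A $$ (r, c)) (\<lambda>j. b $ j)"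
  using assms
  by (auto simp: system_input_def input_arrays_def solver_store_def fun_eq_iff nth_Cons' less_Suc_eq list_of_vec_index)

lemma solver_store_cong:
  assumes "\<And>p. p \<in> set es \<Longrightarrow> M (fst p) (snd p) = M' (fst p) (snd p)" "\<And>j. j < n \<Longrightarrow> b j = b' j"
  shows "solver_store n es M b = solver_store n es M' b'"
  using assms by (auto simp: solver_store_def fun_eq_iff)

text \<open>Behind the two added procedures, number 2 is the entry point of
  \<open>P\<close>.\<close>

lemma runs_shift:
  assumes "runs P (P ! 0) s t Q" "P \<noteq> []"
  shows "runs ([c, d] @ map (shift_calls 2) P) (([c, d] @ map (shift_calls 2) P) ! 2) s t Q"
proof -
  have "([c, d] @ map (shift_calls 2) P) ! 2 = shift_calls 2 (P ! 0)"
    using assms(2) by (simp add: nth_Cons' nth_append)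
  moreover obtain s' t' where *: "exec P (P ! 0) s s' t'" "t' \<le> t" "Q s'"
    using assms(1) unfolding runs_def by blast
  have "length [c, d] = 2" by simp
  from exec_shift_calls[OF *(1), of "[c, d]", unfolded this] *(2,3)
  have "runs ([c, d] @ map (shift_calls 2) P) (shift_calls 2 (P ! 0)) s t Q"
    unfolding runs_def by blast
  ultimately show ?thesis by (simp only:)
qed

section \<open>One instance: its geometry, its encoding and the program run on it\<close>

locale hessian_instance =
  fixes n :: nat and Ls :: "real mat list" and ess :: "(nat \<times> nat) list list"
    and ss :: "real vec list" and x y b :: "real vec"
  assumes fam: "psd_family n Ls" and ess: "list_all2 enumerates_entries ess Ls"
    and ss: "length ss = length Ls" "set ss \<subseteq> carrier_vec n"
    and x: "x \<in> carrier_vec n" and y: "y \<in> carrier_vec (length Ls)"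
    and pos: "\<And>i. i < length Ls \<Longrightarrow> mat_norm (Ls ! i) (x - ss ! i) < y $ i"
    and b: "b \<in> carrier_vec (n + length Ls)"
begin

abbreviation "k \<equiv> length Ls"
definition L :: "nat \<Rightarrow> nat \<Rightarrow> nat \<Rightarrow> real" where "L i r c = Ls ! i $$ (r, c)"
definition sf :: "nat \<Rightarrow> nat \<Rightarrow> real" where "sf i r = ss ! i $ r"
definition w :: "nat \<Rightarrow> real" where "w i = (if i < n then x $ i else y $ (i - n))"

lemma L_carrier: "i < k \<Longrightarrow> Ls ! i \<in> carrier_mat n n"
  using fam by (simp add: psd_family_def)

lemma psd_L: "i < k \<Longrightarrow> psd n (L i)"
  unfolding L_def[abs_def] using psd_psd_mat[OF L_carrier] fam by (simp add: psd_family_def)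

lemma s_carrier: "i < k \<Longrightarrow> ss ! i \<in> carrier_vec n"
  using ss by (metis nth_mem subsetD)

sublocale barrier_data n k L sf by unfold_locales (rule psd_L)

text \<open>\<open>u\<close> has to match \<open>z\<close> only below \<open>n\<close>, as it will
  be the joint vector of \<open>x\<close> and \<open>y\<close>.\<close>

lemma mat_norm_sq:
  assumes i: "i < k" and z: "z \<in> carrier_vec n" and u: "\<And>r. r < n \<Longrightarrow> u r = z $ r"
  shows "(mat_norm (Ls ! i) (z - ss ! i))\<^sup>2 = qf i u" "mat_norm (Ls ! i) (z - ss ! i) = sqrt (qf i u)"
proof -
  have "(z - ss ! i) \<bullet> (Ls ! i *\<^sub>v (z - ss ! i)) =
      ip n (\<lambda>c. (z - ss ! i) $ c) (mv n (L i) (\<lambda>c. (z - ss ! i) $ c))"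
    unfolding L_def[abs_def] using s_carrier[OF i] z by (intro quad_form_ip L_carrier i) auto
  also have "\<dots> = qf i u"
    unfolding qf_def vf_def using s_carrier[OF i] z u by (intro ip_cong mv_cong) (auto simp: sf_def)
  finally show *: "mat_norm (Ls ! i) (z - ss ! i) = sqrt (qf i u)"
    by (simp add: mat_norm_def)
  have "0 \<le> qf i u" by (rule qf_nonneg[OF i])
  then show "(mat_norm (Ls ! i) (z - ss ! i))\<^sup>2 = qf i u" using * by simp
qed



sublocale barrier_point n k L sf w
proof
  fix l assume l: "l < k"
  have n: "mat_norm (Ls ! l) (x - ss ! l) = sqrt (qf l w)"
    using l x by (intro mat_norm_sq) (auto simp: w_def)
  have q: "0 \<le> qf l w" by (rule qf_nonneg[OF l])
  have less: "sqrt (qf l w) < w (n + l)" using pos[OF l] n by (simp add: w_def)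
  then show "0 < w (n + l)" using q real_sqrt_ge_zero[of "qf l w"] by linarith
  from power_strict_mono[OF less, of 2] q show "qf l w < (w (n + l))\<^sup>2" by simp
qed

lemma barrier_hessian_eq:
  "barrier_hessian n Ls ss x y = mat (n + k) (n + k) (\<lambda>(i, j). hess i j w)"
proof -
  have "x @\<^sub>v y = vec (n + k) w"
    using x y by (intro eq_vecI) (auto simp: w_def)
  \<comment> \<open>True even outside the domain, as \<open>hessian_vec\<close> demands:
    \<open>qf\<close> is never negative, so squaring undoes the root.\<close>
  moreover have "barrier Ls ss (vec_first (vec (n + k) u) n) (vec_last (vec (n + k) u) k) = phi u" for u
    unfolding barrier_def phi_def F_def
    by (intro arg_cong[where f = uminus] sum.cong refl arg_cong[where f = ln]
        arg_cong2[where f = "(-)"] mat_norm_sq) (auto simp: vec_first_def vec_last_def)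
  ultimately show ?thesis
    unfolding barrier_hessian_def using hessian_vec domain_point by simp
qed

lemma hess_carrier: "barrier_hessian n Ls ss x y \<in> carrier_mat (n + k) (n + k)"
  by (simp add: barrier_hessian_eq)

lemma mv_barrier_hessian:
  "r < n + k \<Longrightarrow> mv (n + k) (\<lambda>r c. barrier_hessian n Ls ss x y $$ (r, c)) z r = (\<Sum>j<n + k. hess r j w * z j)"
  by (auto simp: barrier_hessian_eq mv_def intro!: sum.cong)

lemma output_solves_hessian:
  "output_solves (barrier_hessian n Ls ss x y) b X \<longleftrightarrow>
    (\<forall>i<n. mv n (S k) (X 0) i = rhs (\<lambda>i. b $ i) i) \<and> (\<forall>l<k. X 0 (n + l) = ysol (\<lambda>i. b $ i) (X 0) l)"
  unfolding output_solves_iff[OF hess_carrier b] hess_system[symmetric]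
  using mv_barrier_hessian by auto

lemma consistent_hessian:
  assumes "consistent (barrier_hessian n Ls ss x y) b"
  obtains z where "\<And>r. r < n \<Longrightarrow> mv n M z r = rhs (\<lambda>i. b $ i) r"
proof -
  obtain z where z: "z \<in> carrier_vec (n + k)" "barrier_hessian n Ls ss x y *\<^sub>v z = b"
    using assms hess_carrier unfolding consistent_def by auto
  have "vec (dim_col (barrier_hessian n Ls ss x y)) (\<lambda>i. z $ i) = z"
    using z hess_carrier by (intro eq_vecI) auto
  \<comment> \<open>An arbitrary solution is presented as an output array, so that
    \<open>output_solves_hessian\<close> applies to it.\<close>
  then have "output_solves (barrier_hessian n Ls ss x y) b (\<lambda>_ i. z $ i)"
    using z by (simp add: output_solves_def)
  then have "\<And>r. r < n \<Longrightarrow> mv n (S k) (\<lambda>i. z $ i) r = rhs (\<lambda>i. b $ i) r"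
    by (simp add: output_solves_hessian)
  from range_S[OF order_refl this] that show ?thesis by blast
qed

definition I :: input where "I = hessian_input n ess Ls ss x y b"
definition st :: store where "st = (input_arrays (fst I), input_arrays (snd I))"
definition len :: "nat \<Rightarrow> nat" where "len i = length (ess ! i)"

lemma length_ess: "length ess = k" using ess by (rule list_all2_lengthD)

lemma entries: "i < k \<Longrightarrow> enumerates_entries (ess ! i) (Ls ! i)"
  using ess by (simp add: list_all2_conv_all_nth)

definition "RR = fst st 1"
definition "CC = fst st 2"
definition "AA = snd st 0"
definition "SS = snd st 1"
definition "XX = snd st 2"

sublocale prog: solver_input Q n k len RR CC AA SS XX for Q .

lemma inp: "prog.inp st"
  unfolding prog.inp_def unfolding RR_def CC_def AA_def SS_def XX_def
  by (auto simp: st_def I_def hessian_input_def input_arrays_def length_ess len_def)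

lemma st_other: "3 \<le> a \<Longrightarrow> fst st a = (\<lambda>_ _. 0)" "3 \<le> a \<Longrightarrow> snd st a = (\<lambda>_ _. 0)"
  by (auto simp: st_def I_def hessian_input_def input_arrays_def fun_eq_iff)

lemma st_entries:
  assumes "i < k" "e < len i"
  shows "RR i e = fst (ess ! i ! e)" "CC i e = snd (ess ! i ! e)" "AA i e = Ls ! i $$ (ess ! i ! e)"
  using assms by (auto simp: RR_def CC_def AA_def st_def I_def hessian_input_def input_arrays_def length_ess len_def)

lemma st_vectors:
  "i < k \<Longrightarrow> r < n \<Longrightarrow> SS i r = sf i r" "r < n \<Longrightarrow> XX 0 r = w r"
  "l < k \<Longrightarrow> XX (Suc 0) l = w (n + l)" "j < n + k \<Longrightarrow> XX 2 j = b $ j"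
proof -
  show "i < k \<Longrightarrow> r < n \<Longrightarrow> SS i r = sf i r"
    using ss(1) s_carrier[of i]
    by (simp add: SS_def st_def I_def hessian_input_def input_arrays_def sf_def)
  show "r < n \<Longrightarrow> XX 0 r = w r"
    using x by (simp add: XX_def st_def I_def hessian_input_def input_arrays_def w_def)
  show "l < k \<Longrightarrow> XX (Suc 0) l = w (n + l)"
    using y by (simp add: XX_def st_def I_def hessian_input_def input_arrays_def w_def)
  show "j < n + k \<Longrightarrow> XX 2 j = b $ j"
    using b by (simp add: XX_def st_def I_def hessian_input_def input_arrays_def)
qed

lemma entry_bound: "i < k \<Longrightarrow> e < len i \<Longrightarrow> fst (ess ! i ! e) < n \<and> snd (ess ! i ! e) < n"
proof -
  assume "i < k" "e < len i"
  then have "ess ! i ! e \<in> set (ess ! i)" by (simp add: len_def)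
  with \<open>i < k\<close> have "ess ! i ! e \<in> nonzero_entries (Ls ! i)"
    using entries[of i] unfolding enumerates_entries_def by blast
  then show ?thesis using L_carrier[OF \<open>i < k\<close>] by (auto simp: nonzero_entries_def)
qed

lemma vv: "i < k \<Longrightarrow> r < n \<Longrightarrow> prog.vv i r = v i r"
proof -
  assume i: "i < k" and r: "r < n"
  let ?g = "\<lambda>p. if fst p = r then Ls ! i $$ p * (w (snd p) - sf i (snd p)) else 0"
  have "prog.vv i r = (\<Sum>e<length (ess ! i). ?g (ess ! i ! e))"
    unfolding prog.vv_def prog.v0_def len_def[symmetric]
    using i by (intro sum.cong) (auto simp: st_entries st_vectors entry_bound)
  also have "\<dots> = (\<Sum>p\<in>{..<n} \<times> {..<n}. ?g p)"
    by (rule enumerates_sum[OF entries[OF i] L_carrier[OF i]]) simp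
  also have "\<dots> = (\<Sum>a<n. \<Sum>c<n. if a = r then L i a c * (w c - sf i c) else 0)"
    unfolding sum.cartesian_product by (rule sum.cong) (auto simp: L_def)
  also have "\<dots> = (\<Sum>a<n. if a = r then \<Sum>c<n. L i a c * (w c - sf i c) else 0)"
    by (intro sum.cong) auto
  also have "\<dots> = v i r" using r by (subst sum.delta) (auto simp: vf_def mv_def)
  finally show ?thesis .
qed

lemma qq: "i < k \<Longrightarrow> prog.qq i = qf i w"
  unfolding prog.qq_def qf_def ip_def by (intro sum.cong) (auto simp: vv st_vectors)

lemma ff: "i < k \<Longrightarrow> prog.ff i = f i" and gg: "i < k \<Longrightarrow> prog.gg i = g i"
  by (simp_all add: prog.ff_def prog.gg_def F_def g_def qq st_vectors)

lemma M0: "i < k \<Longrightarrow> r < n \<Longrightarrow> c < n \<Longrightarrow> prog.M0 (len i) i r c = 2 / f i * L i r c"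
proof -
  assume i: "i < k" and rc: "r < n" "c < n"
  let ?g = "\<lambda>p. if p = (r, c) then 2 / f i * Ls ! i $$ p else 0"
  have "prog.M0 (len i) i r c = (\<Sum>e<length (ess ! i). ?g (ess ! i ! e))"
    unfolding prog.M0_def len_def[symmetric]
    using i by (intro sum.cong) (auto simp: st_entries ff prod_eq_iff)
  also have "\<dots> = (\<Sum>p\<in>{..<n} \<times> {..<n}. ?g p)"
    by (rule enumerates_sum[OF entries[OF i] L_carrier[OF i]]) auto
  also have "\<dots> = 2 / f i * L i r c" using rc by (subst sum.delta) (auto simp: L_def)
  finally show ?thesis .
qed

lemma MM: "r < n \<Longrightarrow> c < n \<Longrightarrow> prog.MM k r c = M r c"
  unfolding prog.MM_def M_def by (intro sum.cong) (auto simp: M0)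

lemma mv_MM: "r < n \<Longrightarrow> mv n (prog.MM k) u r = mv n M u r"
  by (auto simp: mv_def MM intro!: sum.cong)

lemma cc: "r < n \<Longrightarrow> prog.cc k r = rhs (\<lambda>i. b $ i) r"
  by (auto simp: prog.cc_def rhs_def st_vectors gg vv intro!: sum.cong)

text \<open>The weights \<open>2 / f i\<close> are positive, so this is a matrix that the given
  solver has to handle.\<close>

definition A :: "real mat" where "A = lin_comb n (\<lambda>i. 2 / f i) Ls"

lemma A: "A \<in> carrier_mat n n" "r < n \<Longrightarrow> c < n \<Longrightarrow> A $$ (r, c) = M r c"
  by (auto simp: A_def lin_comb_def M_def L_def)

lemma mv_A: "r < n \<Longrightarrow> mv n (\<lambda>r c. A $$ (r, c)) z r = mv n M z r"
  unfolding mv_def by (rule sum.cong) (simp_all add: A(2))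

lemma visited: "prog.visited k 0 = (\<Union>i<k. nonzero_entries (Ls ! i))"
proof -
  have "prog.visited k 0 = (\<Union>i<k. (\<lambda>e. (RR i e, CC i e)) ` {..<len i})"
    by (auto simp: prog.visited_def)
  also have "\<dots> = (\<Union>i<k. (\<lambda>e. ess ! i ! e) ` {..<len i})"
    by (intro SUP_cong image_cong) (auto simp: st_entries)
  also have "\<dots> = (\<Union>i<k. nonzero_entries (Ls ! i))"
  proof (intro SUP_cong refl)
    fix i assume "i \<in> {..<k}"
    then show "(\<lambda>e. ess ! i ! e) ` {..<len i} = nonzero_entries (Ls ! i)"
      using entries[of i] by (auto simp: enumerates_entries_def len_def set_conv_nth image_def)
  qed
  finally show ?thesis .
qed

text \<open>A nonzero entry of the combination comes from a nonzero entry of some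
  \<open>L i\<close>, so visiting the listed positions finds all of them.\<close>

lemma nonzero_A: "{(r, c) \<in> prog.visited k 0. prog.MM k r c \<noteq> 0} = nonzero_entries A"
proof -
  have bound: "(r, c) \<in> prog.visited k 0 \<Longrightarrow> r < n \<and> c < n" for r c
  proof -
    assume "(r, c) \<in> prog.visited k 0"
    then obtain i where "i < k" "(r, c) \<in> nonzero_entries (Ls ! i)" unfolding visited by blast
    then show ?thesis using L_carrier[of i] by (simp add: nonzero_entries_def)
  qed
  have "(r, c) \<in> prog.visited k 0" if "r < n" "c < n" "M r c \<noteq> 0" for r c
  proof -
    obtain i where "i \<in> {..<k}" "2 / f i * L i r c \<noteq> 0"
      using sum.not_neutral_contains_not_neutral[OF \<open>M r c \<noteq> 0\<close>[unfolded M_def]] .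
    then have "i < k" "L i r c \<noteq> 0" by auto
    then have "(r, c) \<in> nonzero_entries (Ls ! i)"
      using that L_carrier[of i] by (simp add: nonzero_entries_def L_def)
    then show ?thesis using \<open>i < k\<close> unfolding visited by blast
  qed
  then have "(r, c) \<in> prog.visited k 0 \<and> prog.MM k r c \<noteq> 0 \<longleftrightarrow> (r, c) \<in> nonzero_entries A" for r c
    using bound[of r c] A by (auto simp: nonzero_entries_def MM)
  then show ?thesis by auto
qed

lemma system_store:
  assumes "set es = nonzero_entries A" "l \<le> k"
  shows "solver_store n es (prog.MM k) (prog.V k l) =
    (input_arrays (fst (system_input n es A (vec n (prog.V k l)))),
     input_arrays (snd (system_input n es A (vec n (prog.V k l)))))"
  unfolding system_input_store[OF vec_carrier]
  using assms A by (intro solver_store_cong) (auto simp: nonzero_entries_def MM)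

lemma system_consistent:
  assumes "consistent (barrier_hessian n Ls ss x y) b" "l \<le> k"
  shows "consistent A (vec n (prog.V k l))"
proof -
  have "\<exists>z. \<forall>r<n. mv n M z r = prog.V k l r"
  proof (cases "l < k")
    case True
    obtain z where "\<And>r. r < n \<Longrightarrow> mv n M z r = v l r" using v_in_range_M[OF True] by blast
    then show ?thesis using True by (intro exI[of _ z]) (simp add: prog.V_def vv)
  next
    case False
    with assms(2) have "l = k" by simp
    obtain z where "\<And>r. r < n \<Longrightarrow> mv n M z r = rhs (\<lambda>i. b $ i) r"
      using consistent_hessian[OF assms(1)] by blast
    then show ?thesis using \<open>l = k\<close> by (intro exI[of _ z]) (simp add: prog.V_def cc)
  qed
  then obtain z where z: "\<forall>r<n. mv n M z r = prog.V k l r" by (rule exE)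
  show ?thesis
  proof (rule consistent_vec[OF A(1)])
    show "mv n (\<lambda>r c. A $$ (r, c)) z r = prog.V k l r" if "r < n" for r
      using z mv_A[OF that] that by simp
  qed
qed

lemma system_output:
  "output_solves A (vec n (prog.V k l)) X \<longleftrightarrow> (\<forall>r<n. mv n (prog.MM k) (X 0) r = prog.V k l r)"
  unfolding output_solves_iff[OF A(1) vec_carrier] by (simp add: mv_A mv_MM)

lemma hessian_output:
  assumes W: "\<And>l r. l \<le> k \<Longrightarrow> r < n \<Longrightarrow> mv n (prog.MM k) (W l) r = prog.V k l r"
    and z: "\<And>r. r < n \<Longrightarrow> X 0 r = all_updates n k (\<lambda>i. 4 / (prog.ff i * prog.gg i)) (prog.V k) W k k r"
    and u: "\<And>i. i < k \<Longrightarrow> X 0 (n + i) = (XX 2 (n + i) + 4 * XX 1 i / (prog.ff i)\<^sup>2 *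
          ip n (prog.vv i) (all_updates n k (\<lambda>i. 4 / (prog.ff i * prog.gg i)) (prog.V k) W k k)) *
          (prog.ff i)\<^sup>2 / (2 * prog.gg i)"
  shows "output_solves (barrier_hessian n Ls ss x y) b X"
proof -
  let ?z = "all_updates n k (\<lambda>i. 4 / (f i * g i)) (prog.V k) W k k"
  \<comment> \<open>The computed coefficients are known to be the true ones only below
    \<open>k\<close>, so the updates must be seen to use no others.\<close>
  have cong: "all_updates n k d U W i = all_updates n k d' U W i"
    if "i \<le> k" "\<And>i. i < k \<Longrightarrow> d i = d' i" for d d' :: "nat \<Rightarrow> real" and U i
    using that(1)
  proof (induction i)
    case (Suc i)
    then have "all_updates n k d U W i = all_updates n k d' U W i" "d i = d' i" using that(2) by auto
    then show ?case by (simp only: all_updates.simps)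
  qed simp
  have upd: "all_updates n k (\<lambda>i. 4 / (prog.ff i * prog.gg i)) (prog.V k) W k =
      all_updates n k (\<lambda>i. 4 / (f i * g i)) (prog.V k) W k"
    by (rule cong) (simp_all add: ff gg)
  have "mv n (S k) ?z r = prog.V k k r" if "r < n" for r
  proof (rule all_updates_correct[OF _ _ order_refl order_refl that])
    show "prog.V k i r = v i r" if "i < k" "r < n" for i r using that by (simp add: prog.V_def vv)
    show "mv n M (W l) r = prog.V k l r" if "l \<le> k" "r < n" for l r
      using W[OF that] mv_MM that by simp
  qed
  moreover have X0: "X 0 r = ?z r" if "r < n" for r
    using z[OF that] unfolding upd .
  then have "mv n (S k) (X 0) r = mv n (S k) ?z r" for r by (rule mv_cong)
  ultimately have x: "mv n (S k) (X 0) r = rhs (\<lambda>i. b $ i) r" if "r < n" for r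
    using that by (simp only: prog.V_def less_irrefl if_False if_True refl cc)
  have "X 0 (n + l) = ysol (\<lambda>i. b $ i) (X 0) l" if "l < k" for l
  proof -
    have "ip n (prog.vv l) ?z = ip n (v l) (X 0)"
      by (rule ip_cong) (simp_all only: vv[OF that] X0)
    then show ?thesis using u[OF that] that unfolding upd by (simp add: ysol_def ff gg st_vectors)
  qed
  with x show ?thesis unfolding output_solves_hessian by blast
qed

end

section \<open>Running time\<close>

lemma finite_nonzero_entries: "finite (nonzero_entries A)"
  by (rule finite_subset[of _ "{..<dim_row A} \<times> {..<dim_col A}"]) (auto simp: nonzero_entries_def)

text \<open>For all but finitely many weights of \<open>L\<^sub>i\<close> no entry of \<open>L\<^sub>i\<close> cancels in the combination.\<close>

lemma nonzero_entries_lin_comb: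
  assumes fam: "psd_family n Ls" and i: "i < length Ls"
  obtains \<alpha> where "\<And>j. 0 < \<alpha> j" "nonzero_entries (Ls ! i) \<subseteq> nonzero_entries (lin_comb n \<alpha> Ls)"
proof -
  have Li: "Ls ! i \<in> carrier_mat n n" using fam i by (simp add: psd_family_def)
  define rest where "rest r c = (\<Sum>j\<in>{..<length Ls} - {i}. Ls ! j $$ (r, c))" for r c
  \<comment> \<open>The entry at \<open>(r, c)\<close> cancels for a single value of the weight of
    \<open>L i\<close>, namely this quotient.\<close>
  define B where "B = (\<lambda>(r, c). - rest r c / Ls ! i $$ (r, c)) ` nonzero_entries (Ls ! i)"
  have "finite B" unfolding B_def by (intro finite_imageI finite_nonzero_entries)
  then have "infinite ({0<..} - B)" using infinite_Ioi[of "0 :: real"] by (rule Diff_infinite_finite)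
  then obtain t where t: "0 < t" "t \<notin> B" using infinite_imp_nonempty by blast
  define \<alpha> where "\<alpha> j = (if j = i then t else 1)" for j
  have "nonzero_entries (Ls ! i) \<subseteq> nonzero_entries (lin_comb n \<alpha> Ls)"
  proof
    fix p assume p: "p \<in> nonzero_entries (Ls ! i)"
    obtain r c where rc: "p = (r, c)" by fastforce
    then have dims: "r < n" "c < n" and nz: "Ls ! i $$ (r, c) \<noteq> 0"
      using p Li by (auto simp: nonzero_entries_def)
    have "(\<Sum>j<length Ls. \<alpha> j * Ls ! j $$ (r, c)) =
        \<alpha> i * Ls ! i $$ (r, c) + (\<Sum>j\<in>{..<length Ls} - {i}. \<alpha> j * Ls ! j $$ (r, c))"
      using i by (intro sum.remove) auto
    also have "(\<Sum>j\<in>{..<length Ls} - {i}. \<alpha> j * Ls ! j $$ (r, c)) = rest r c"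
      unfolding rest_def by (intro sum.cong) (auto simp: \<alpha>_def)
    finally have sum: "(\<Sum>j<length Ls. \<alpha> j * Ls ! j $$ (r, c)) = t * Ls ! i $$ (r, c) + rest r c"
      by (simp add: \<alpha>_def)
    have "t * Ls ! i $$ (r, c) + rest r c \<noteq> 0"
    proof
      assume "t * Ls ! i $$ (r, c) + rest r c = 0"
      then have "t * Ls ! i $$ (r, c) = - rest r c" by (simp only: eq_neg_iff_add_eq_0)
      then have "t = - rest r c / Ls ! i $$ (r, c)" unfolding nonzero_eq_divide_eq[OF nz] .
      then have "t \<in> B" using p rc unfolding B_def by (intro image_eqI[of _ _ "(r, c)"]) auto
      with t show False by simp
    qed
    then show "p \<in> nonzero_entries (lin_comb n \<alpha> Ls)"
      using dims sum by (simp add: rc nonzero_entries_def lin_comb_def)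
  qed
  moreover have "0 < \<alpha> j" for j using t by (simp add: \<alpha>_def)
  ultimately show ?thesis using that by blast
qed

text \<open>The system with right-hand side 0 is always consistent, and its size is part of the
  solver's time. With weights that avoid cancellation in \<open>L i\<close>, it contains all entries
  of \<open>L i\<close>. Summed over \<open>i\<close>, this lets \<open>k * T\<close> pay for
  reading the input.\<close>

lemma solver_time_bounds:
  assumes fam: "psd_family n Ls" and P: "solves_combinations_within P n Ls T" and i: "i < length Ls"
  shows "P \<noteq> []" "real (2 + n + 3 * card (nonzero_entries (Ls ! i))) \<le> T"
proof -
  obtain \<alpha> where \<alpha>: "\<And>j. 0 < \<alpha> j" "nonzero_entries (Ls ! i) \<subseteq> nonzero_entries (lin_comb n \<alpha> Ls)"
    using nonzero_entries_lin_comb[OF fam i] by blast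
  let ?A = "lin_comb n \<alpha> Ls"
  have A: "?A \<in> carrier_mat n n" by (simp add: lin_comb_def)
  obtain es where es: "distinct es" "set es = nonzero_entries ?A"
    using finite_distinct_list[OF finite_nonzero_entries] by blast
  have "consistent ?A (0\<^sub>v n)"
    unfolding consistent_def using A by (intro bexI[of _ "0\<^sub>v n"]) (auto intro!: eq_vecI)
  then have "computes_within P (system_input n es ?A (0\<^sub>v n)) (output_solves ?A (0\<^sub>v n)) T"
    using P \<alpha> es by (simp add: solves_combinations_within_def enumerates_entries_def)
  then have *: "P \<noteq> []" "real (input_size (system_input n es ?A (0\<^sub>v n))) \<le> T"
    unfolding computes_within_def by auto
  show "P \<noteq> []" by (rule *(1))
  have "card (nonzero_entries (Ls ! i)) \<le> length es"
    using card_mono[OF _ \<alpha>(2)] es by (metis distinct_card finite_nonzero_entries)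
  moreover have "input_size (system_input n es ?A (0\<^sub>v n)) = 2 + n + 3 * length es"
    by (simp add: input_size_def system_input_def)
  ultimately show "real (2 + n + 3 * card (nonzero_entries (Ls ! i))) \<le> T"
    using *(2) by linarith
qed

context hessian_instance
begin

lemma input_size_I: "input_size I = 2 + 3 * k + 2 * n + k * n + 3 * (\<Sum>i<k. len i)"
proof -
  have ess_len: "sum_list (map length ess) = (\<Sum>i<k. len i)"
    by (simp add: sum_list_sum_nth length_ess len_def lessThan_atLeast0)
  have "map length (map2 (\<lambda>L. map (\<lambda>p. L $$ p)) Ls ess) = map length ess"
    by (rule nth_equalityI) (auto simp: length_ess)
  moreover have "sum_list (map length (map list_of_vec ss)) = k * n"
  proof -
    have "map length (map list_of_vec ss) = replicate k n"
      by (rule nth_equalityI) (use ss s_carrier in auto)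
    then show ?thesis by (simp add: sum_list_replicate)
  qed
  moreover have "map length (map (map fst) ess) = map length ess" "map length (map (map snd) ess) = map length ess"
    by simp_all
  ultimately show ?thesis using x y b
    by (simp only: input_size_def I_def hessian_input_def fst_conv snd_conv list.map sum_list.Cons
        sum_list.Nil ess_len length_map length_ess length_list_of_vec carrier_vecD list.size)
qed

lemma computes_hessian:
  assumes P: "solves_combinations_within P n Ls T"
    and cons: "consistent (barrier_hessian n Ls ss x y) b"
  shows "computes_within ([main_com, solve_com] @ map (shift_calls 2) P) I
    (output_solves (barrier_hessian n Ls ss x y) b) (10000 * (real k * T + (real k)\<^sup>2 * real n))"
    (is "computes_within ?Q _ _ ?T")
proof -
  \<comment> \<open>Step counts are natural numbers, so a bound by the real number \<open>T\<close>
    is a bound by its floor.\<close>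
  define t where "t = nat \<lfloor>T\<rfloor>"
  have k: "0 < k" using fam by (simp add: psd_family_def)
  note bounds = solver_time_bounds[OF fam P]
  have len: "len i = card (nonzero_entries (Ls ! i))" if "i < k" for i
    using entries[OF that] by (metis enumerates_entries_def distinct_card len_def)
  have T: "real m \<le> T \<Longrightarrow> m \<le> t" for m unfolding t_def by (rule le_nat_floor)
  have t_T: "real t \<le> T" using bounds(2)[OF k] by (simp add: t_def)
  have t: "2 + n \<le> t" using bounds(2)[OF k] by (intro T) simp
  have len_t: "len i \<le> t" if "i < k" for i using bounds(2)[OF that] len[OF that] by (intro T) simp
  have sys: "length es \<le> t \<and> runs ?Q (?Q ! 2) (solver_store n es (prog.MM k) (prog.V k l)) t
        (\<lambda>s'. \<forall>r<n. mv n (prog.MM k) (snd s' 1 0) r = prog.V k l r)"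
    if es: "distinct es" "set es = {(r, c) \<in> prog.visited k 0. prog.MM k r c \<noteq> 0}" and l: "l \<le> k" for es l
  proof -
    let ?b = "vec n (prog.V k l)"
    have set: "set es = nonzero_entries A" using es(2) nonzero_A by simp
    have "computes_within P (system_input n es A ?b) (output_solves A ?b) T"
      using P system_consistent[OF cons l] es(1) set f_pos
      by (auto simp: solves_combinations_within_def A_def enumerates_entries_def)
    then obtain s' c where c: "exec P (P ! 0) (solver_store n es (prog.MM k) (prog.V k l)) s' c"
      "output_solves A ?b (snd s' 1)" "real (input_size (system_input n es A ?b) + c) \<le> T"
      unfolding computes_within_def system_store[OF set l] by (auto simp: system_input_def)
    have "length es \<le> input_size (system_input n es A ?b) + c"
      by (simp add: input_size_def system_input_def)
    then have "length es \<le> t" "c \<le> t" using T[OF c(3)] by simp_all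
    moreover from c(1,2) \<open>c \<le> t\<close>
    have "runs P (P ! 0) (solver_store n es (prog.MM k) (prog.V k l)) t
        (\<lambda>s'. \<forall>r<n. mv n (prog.MM k) (snd s' 1 0) r = prog.V k l r)"
      unfolding runs_def system_output by blast
    ultimately show ?thesis using runs_shift bounds(1)[OF k] by blast
  qed
  let ?time = "240 + 260 * n + (\<Sum>i<k. 900 + 390 * n + 490 * len i) +
    (k + 1) * (250 + 200 * t + 300 * n + t) + n * (k * (500 + k * 1000))"
  have "2 < length ?Q" "?Q ! 1 = solve_com" using bounds(1)[OF k] by (cases P; simp)+
  from prog.runs_main[OF this sys inp st_other]
  obtain s' c W where c: "exec ?Q main_com st s' c" "c \<le> ?time"
    and W: "\<forall>l\<le>k. \<forall>r<n. mv n (prog.MM k) (W l) r = prog.V k l r"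
      "\<forall>r<n. snd s' 3 0 r = all_updates n k (\<lambda>i. 4 / (prog.ff i * prog.gg i)) (prog.V k) W k k r"
      "\<forall>i<k. snd s' 3 0 (n + i) = (XX 2 (n + i) + 4 * XX 1 i / (prog.ff i)\<^sup>2 *
          ip n (prog.vv i) (all_updates n k (\<lambda>i. 4 / (prog.ff i * prog.gg i)) (prog.V k) W k k)) *
          (prog.ff i)\<^sup>2 / (2 * prog.gg i)"
    unfolding runs_def by blast
  have "output_solves (barrier_hessian n Ls ss x y) b (snd s' 3)"
    by (rule hessian_output[of W]) (use W in blast)+
  moreover have "real (input_size I + c) \<le> ?T"
  proof -
    have sum_len: "(\<Sum>i<k. len i) \<le> k * t"
      using sum_mono[of "{..<k}" len "\<lambda>_. t"] len_t by simp
    \<comment> \<open>As \<open>k \<ge> 1\<close>, additive terms \<open>t\<close> and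
      \<open>n\<close> are covered by \<open>k * t\<close>.\<close>
    have "1 * t \<le> k * t" by (rule mult_le_mono1) (use k in linarith)
    then have kt: "t \<le> k * t" "2 \<le> t" "n \<le> t" using t by auto
    have kn: "k * n \<le> k * t" "2 * k \<le> k * t" using kt by simp_all
    have "(\<Sum>i<k. 900 + 390 * n + 490 * len i) = 900 * k + 390 * (k * n) + 490 * (\<Sum>i<k. len i)"
      by (simp add: sum.distrib sum_distrib_left[symmetric] distrib_left)
    also have "\<dots> \<le> 1500 * (k * t)" using sum_len kn by linarith
    finally have 1: "(\<Sum>i<k. 900 + 390 * n + 490 * len i) \<le> 1500 * (k * t)" .
    \<comment> \<open>Uses \<open>k + 1 \<le> 2 * k\<close>, and \<open>250 \<le> 125 * t\<close>
      from \<open>2 \<le> t\<close>.\<close>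
    have "(k + 1) * (250 + 200 * t + 300 * n + t) \<le> (2 * k) * (650 * t)"
      using k kt by (intro mult_le_mono) auto
    then have 2: "(k + 1) * (250 + 200 * t + 300 * n + t) \<le> 1300 * (k * t)" by simp
    have 3: "n * (k * (500 + k * 1000)) = 500 * (k * n) + 1000 * (k * k * n)"
      by (simp add: algebra_simps)
    have "input_size I + c \<le> 10000 * (k * t + k * k * n)"
      using c(2) 1 2 3 kt kn sum_len unfolding input_size_I distrib_left by linarith
    then have "real (input_size I + c) \<le> real (10000 * (k * t + k * k * n))" by (rule of_nat_mono)
    also have "\<dots> \<le> ?T" using t_T k by (simp add: power2_eq_square mult_left_mono)
    finally show ?thesis .
  qed
  moreover have "length (snd I) = 3" by (simp add: I_def hessian_input_def)
  moreover have "?Q \<noteq> []" "?Q ! 0 = main_com" by simp_all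
  ultimately show ?thesis using c(1) unfolding computes_within_def st_def by metis
qed

end

theorem theorem5p3:
  fixes \<tau> :: real
  assumes "\<tau> > matmul_omega \<or> (\<tau> = matmul_omega \<and> matmul_omega \<in> matmul_exponents)"
  shows "\<exists>C>0. \<forall>(F :: (nat \<times> real mat list) set) (T :: nat \<Rightarrow> nat \<Rightarrow> real).
    (\<forall>(n, Ls)\<in>F. psd_family n Ls) \<longrightarrow>
    (\<exists>P. \<forall>(n, Ls)\<in>F. solves_combinations_within P n Ls (T n (total_nonzeros Ls))) \<longrightarrow>
    (\<exists>Q. \<forall>(n, Ls)\<in>F. let k = length Ls; m = total_nonzeros Ls in
       solves_barrier_hessians_within Q n Ls
         (C * (real k powr \<tau> + real k * T n m + (real k)\<^sup>2 * real n)))"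
\<comment> \<open>The constant is absolute: the cost of the unknown program \<open>P\<close> enters
  only through \<open>T\<close>.\<close>
proof (intro exI[of _ 10000] conjI allI impI)
  fix F :: "(nat \<times> real mat list) set" and T :: "nat \<Rightarrow> nat \<Rightarrow> real"
  assume F: "\<forall>(n, Ls)\<in>F. psd_family n Ls"
    and "\<exists>P. \<forall>(n, Ls)\<in>F. solves_combinations_within P n Ls (T n (total_nonzeros Ls))"
  then obtain P where P: "\<forall>(n, Ls)\<in>F. solves_combinations_within P n Ls (T n (total_nonzeros Ls))"
    by blast
  \<comment> \<open>One program for the whole family: its text depends on \<open>P\<close> alone,
    and the dimensions are read from the input.\<close>
  let ?Q = "[main_com, solve_com] @ map (shift_calls 2) P"
  have "solves_barrier_hessians_within ?Q n Ls (10000 * (real (length Ls) powr \<tau> +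
      real (length Ls) * T n (total_nonzeros Ls) + (real (length Ls))\<^sup>2 * real n))"
    if "(n, Ls) \<in> F" for n Ls
    unfolding solves_barrier_hessians_within_def
  proof (intro allI impI, elim conjE)
    fix ess ss x y b
    assume *: "list_all2 enumerates_entries ess Ls" "length ss = length Ls" "set ss \<subseteq> carrier_vec n"
      "x \<in> carrier_vec n" "y \<in> carrier_vec (length Ls)"
      "\<forall>i<length Ls. mat_norm (Ls ! i) (x - ss ! i) < y $ i"
      "b \<in> carrier_vec (n + length Ls)" and cons: "consistent (barrier_hessian n Ls ss x y) b"
    interpret hessian_instance n Ls ess ss x y b
      by unfold_locales (use * F that in auto)
    have "computes_within ?Q I (output_solves (barrier_hessian n Ls ss x y) b)
        (10000 * (real k * T n (total_nonzeros Ls) + (real k)\<^sup>2 * real n))"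
      using P that by (intro computes_hessian cons) auto
    moreover have "10000 * (real k * T n (total_nonzeros Ls) + (real k)\<^sup>2 * real n) \<le>
        10000 * (real k powr \<tau> + real k * T n (total_nonzeros Ls) + (real k)\<^sup>2 * real n)"
      by simp
    ultimately show "computes_within ?Q (hessian_input n ess Ls ss x y b)
        (output_solves (barrier_hessian n Ls ss x y) b)
        (10000 * (real k powr \<tau> + real k * T n (total_nonzeros Ls) + (real k)\<^sup>2 * real n))"
      unfolding computes_within_def I_def by (meson order_trans)
  qed
  then show "\<exists>Q. \<forall>(n, Ls)\<in>F. let k = length Ls; m = total_nonzeros Ls in
       solves_barrier_hessians_within Q n Ls
         (10000 * (real k powr \<tau> + real k * T n m + (real k)\<^sup>2 * real n))"
    by (intro exI[of _ ?Q]) (auto simp: Let_def)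
qed simp

end
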